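(* Let $(E\to M,\langle\cdot,\cdot\rangle,[\cdot,\cdot],\rho)$ be a Courant algebroid over a manifold $M$, with associated operator $\mathcal{D}:C^\infty(M)\to\Gamma(E)$ and function $T$. Let $X=X_0\oplus X_1\oplus X_2$ be the graded vector space with $X_0=\Gamma(E)$, $X_1=C^\infty(M)$, $X_2=\ker\mathcal{D}$ (and $X_k=0$ for all other $k$), which together with $d_1=\mathcal{D}:X_1\to X_0$ and $d_2=\iota:\ker\mathcal{D}\hookrightarrow C^\infty(M)$ (the inclusion) $:X_2\to X_1$ is a resolution $$\cdots\to 0\to X_2\xrightarrow{d_2}X_1\xrightarrow{d_1}X_0\to H\to 0$$ of $H=\operatorname{coker}\mathcal{D}$. Then the following maps $l_k:\bigwedge^kX\to X$ make $X$ a strongly homotopy Lie algebra ($L_\infty$-algebra): - $l_1=d$, i.e. $l_1=0$ on $X_0$, $l_1=\mathcal{D}$ on $X_1$, $l_1=\iota$ on $X_2$; - $l_2(e_1\wedge e_2)=[e_1,e_2]$ for $e_1,e_2\in X_0$; $l_2(e\wedge f)=\langle e,\mathcal{D}f\rangle$ for $e\in X_0$, $f\in X_1$; $l_2=0$ on elements of $\bigwedge^2X$ of total degree $>1$; - $l_3(e_1\wedge e_2\wedge e_3)=-T(e_1,e_2,e_3)\in X_1$ for $e_1,e_2,e_3\in X_0$; $l_3=0$ on elements of $\bigwedge^3X$ of total degree $>0$; - $l_n=0$ for all $n>3$.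
   Context: **Courant algebroid.** A Courant algebroid is a vector bundle $E\to M$ equipped with a nondegenerate symmetric bilinear form $\langle\cdot,\cdot\rangle$ on the bundle, a skew-symmetric ($\mathbb{R}$-bilinear) bracket $[\cdot,\cdot]$ on $\Gamma(E)$, and a bundle map $\rho:E\to TM$, such that: 1. for all $e_1,e_2,e_3\in\Gamma(E)$, $J(e_1,e_2,e_3)=\mathcal{D}T(e_1,e_2,e_3)$; 2. for all $e_1,e_2\in\Gamma(E)$, $\rho[e_1,e_2]=[\rho e_1,\rho e_2]$; 3. for all $e_1,e_2\in\Gamma(E)$ and $f\in C^\infty(M)$, $[e_1,fe_2]=f[e_1,e_2]+(\rho(e_1)f)e_2-\langle e_1,e_2\rangle\mathcal{D}f$; 4. $\rho\circ\mathcal{D}=0$, i.e. for all $f,g\in C^\infty(M)$, $\langle\mathcal{D}f,\mathcal{D}g\rangle=0$; 5. for all $e,h_1,h_2\in\Gamma(E)$, $\rho(e)\langle h_1,h_2\rangle=\langle[e,h_1]+\mathcal{D}\langle e,h_1\rangle,h_2\rangle+\langle h_1,[e,h_2]+\mathcal{D}\langle e,h_2\rangle\rangle$. Here $J(e_1,e_2,e_3)=[[e_1,e_2],e_3]+[[e_2,e_3],e_1]+[[e_3,e_1],e_2]$ is the Jacobiator; $T(e_1,e_2,e_3)=\frac13\big(\langle[e_1,e_2],e_3\rangle+\langle[e_2,e_3],e_1\rangle+\langle[e_3,e_1],e_2\rangle\big)\in C^\infty(M)$; and $\mathcal{D}:C^\infty(M)\to\Gamma(E)$ is defined by $\langle\mathcal{D}f,e\rangle=\frac12\rho(e)f$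 for all $e\in\Gamma(E)$. **Graded exterior algebra.** For a graded vector space $V$ (over $\mathbb{R}$), $\bigwedge V=T(V)/\langle v\otimes w+(-1)^{\tilde v\tilde w}w\otimes v\rangle$, where $\tilde v$ is the degree of a homogeneous $v$; so $v\wedge w=-(-1)^{\tilde v\tilde w}w\wedge v$. The degree of $x_1\wedge\dots\wedge x_n$ is the sum of the degrees of the $x_i$. **Strongly homotopy Lie algebra.** A strongly homotopy Lie algebra ($L_\infty$-algebra) is a graded vector space $V$ with linear maps $l_k:\bigwedge^kV\to V$ of degree $k-2$, $k\ge1$, such that for each $n\ge1$ and all homogeneous $x_1,\dots,x_n\in V$, $$\sum_{i+j=n+1}(-1)^{i(j-1)}\sum_{\sigma}(-1)^{\sigma}\epsilon(\sigma)\,l_j\big(l_i(x_{\sigma(1)},\dots,x_{\sigma(i)}),x_{\sigma(i+1)},\dots,x_{\sigma(n)}\big)=0,$$ where $i,j\ge1$, $\sigma$ runs over all $(i,n-i)$-unshuffles (permutations with $\sigma(1)<\dots<\sigma(i)$ and $\sigma(i+1)<\dots<\sigma(n)$), $(-1)^\sigma$ is the sign of $\sigma$, and $\epsilon(\sigma)$ is the Koszul sign (a factor $-1$ for each interchange of two consecutive odd-degree elements). *)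

theory Defs
  imports
    "HOL-Analysis.Analysis"
    "HOL-Combinatorics.Permutations"
    "HOL-Library.Function_Algebras"
begin

section \<open>Linear algebra\<close>

instantiation "fun" :: (type, real_vector) real_vector
begin

definition scaleR_fun_def: "scaleR r f = (\<lambda>x. r *\<^sub>R f x)"

instance
  by standard (auto simp: scaleR_fun_def fun_eq_iff scaleR_add_right scaleR_add_left)

end

definition lin_on :: "'a::real_vector set \<Rightarrow> ('a \<Rightarrow> 'b::real_vector) \<Rightarrow> bool" where
  "lin_on S f \<longleftrightarrow>
     (\<forall>x\<in>S. \<forall>y\<in>S. \<forall>a b. f (a *\<^sub>R x + b *\<^sub>R y) = a *\<^sub>R f x + b *\<^sub>R f y)"

definition coset :: "'a::real_vector set \<Rightarrow> 'a \<Rightarrow> 'a set" where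
  "coset S x = {y. y - x \<in> S}"

section \<open>Smooth manifolds\<close>

primrec ck_on :: "nat \<Rightarrow> 'a::real_normed_vector set \<Rightarrow> ('a \<Rightarrow> 'b::real_normed_vector) \<Rightarrow> bool" where
  "ck_on 0 S f \<longleftrightarrow> continuous_on S f"
| "ck_on (Suc k) S f \<longleftrightarrow>
     (\<forall>x\<in>S. f differentiable (at x)) \<and> (\<forall>v. ck_on k S (\<lambda>x. frechet_derivative f (at x) v))"

text \<open>Meaningful for open subsets of finite-dimensional spaces, the only case used below.\<close>

definition smooth_on :: "'a::real_normed_vector set \<Rightarrow> ('a \<Rightarrow> 'b::real_normed_vector) \<Rightarrow> bool" where
  "smooth_on S f \<longleftrightarrow> (\<forall>k. ck_on k S f)"

text \<open>
  The model space is a finite-dimensional inner product space rather than a type of class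
  \<open>euclidean_space\<close>, because the latter excludes dimension 0.
\<close>

locale smooth_manifold =
  fixes atlas :: "('m::{t2_space,second_countable_topology} set \<times> ('m \<Rightarrow> 'b::real_inner)) set"
  assumes model_finite_dim: "\<exists>B. finite B \<and> span B = (UNIV :: 'b set)"
    and chart: "\<And>U \<phi>. (U, \<phi>) \<in> atlas \<Longrightarrow>
          open U \<and> open (\<phi> ` U) \<and> homeomorphism U (\<phi> ` U) \<phi> (inv_into U \<phi>)"
    and chart_cover: "(\<Union>(U, \<phi>)\<in>atlas. U) = UNIV"
    and chart_change: "\<And>U \<phi> V \<psi>. (U, \<phi>) \<in> atlas \<Longrightarrow> (V, \<psi>) \<in> atlas \<Longrightarrow>
          smooth_on (\<phi> ` (U \<inter> V)) (\<psi> \<circ> inv_into U \<phi>)"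
begin

definition smooth_map_on :: "'m set \<Rightarrow> ('m \<Rightarrow> 'c::real_normed_vector) \<Rightarrow> bool" where
  "smooth_map_on W f \<longleftrightarrow> (\<forall>(U, \<phi>)\<in>atlas. smooth_on (\<phi> ` (U \<inter> W)) (f \<circ> inv_into U \<phi>))"

definition smooth_functions :: "('m \<Rightarrow> real) set" where
  "smooth_functions = {f. smooth_map_on UNIV f}"

text \<open>
  Tangent vectors are derivations of the algebra of smooth functions at a point. They are required
  to vanish off that algebra, so that equal tangent vectors are equal as HOL functions.
\<close>

definition tangent_space :: "'m \<Rightarrow> (('m \<Rightarrow> real) \<Rightarrow> real) set" where
  "tangent_space p = {v. lin_on smooth_functions v
     \<and> (\<forall>f\<in>smooth_functions. \<forall>h\<in>smooth_functions.
          v (\<lambda>q. f q * h q) = v f * h p + f p * v h)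
     \<and> (\<forall>f. f \<notin> smooth_functions \<longrightarrow> v f = 0)}"

definition vector_fields :: "('m \<Rightarrow> ('m \<Rightarrow> real) \<Rightarrow> real) set" where
  "vector_fields = {X. (\<forall>p. X p \<in> tangent_space p)
     \<and> (\<forall>f\<in>smooth_functions. (\<lambda>p. X p f) \<in> smooth_functions)}"

definition lie_bracket ::
  "('m \<Rightarrow> ('m \<Rightarrow> real) \<Rightarrow> real) \<Rightarrow> ('m \<Rightarrow> ('m \<Rightarrow> real) \<Rightarrow> real) \<Rightarrow> 'm \<Rightarrow> ('m \<Rightarrow> real) \<Rightarrow> real" where
  "lie_bracket X Y = (\<lambda>p f. X p (\<lambda>q. Y q f) - Y p (\<lambda>q. X q f))"

end

section \<open>Vector bundles\<close>

text \<open>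
  The fibres are subspaces \<open>E p\<close> of a real vector space \<open>'v\<close>, which may have infinite dimension and
  carries no topology. This loses no generality: any family of vector spaces embeds
  in its direct sum. The total space is the disjoint union \<open>Sigma UNIV E\<close>, whose smooth structure is
  determined by the local trivializations \<open>(U, \<Phi>)\<close>, with \<open>\<Phi> p\<close> an isomorphism from \<open>E p\<close>
  to the model fibre for \<open>p \<in> U\<close>.
\<close>

locale vector_bundle = smooth_manifold atlas
  for atlas :: "('m::{t2_space,second_countable_topology} set \<times> ('m \<Rightarrow> 'b::real_inner)) set" +
  fixes E :: "'m \<Rightarrow> 'v::real_vector set"
    and trivs :: "('m set \<times> ('m \<Rightarrow> 'v \<Rightarrow> 'f::real_inner)) set"
  assumes fibre_finite_dim: "\<exists>B. finite B \<and> span B = (UNIV :: 'f set)"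
    and fibre_subspace: "\<And>p. subspace (E p)"
    and triv: "\<And>U \<Phi>. (U, \<Phi>) \<in> trivs \<Longrightarrow>
          open U \<and> (\<forall>p\<in>U. lin_on (E p) (\<Phi> p) \<and> bij_betw (\<Phi> p) (E p) UNIV)"
    and triv_cover: "(\<Union>(U, \<Phi>)\<in>trivs. U) = UNIV"
    and triv_change: "\<And>U \<Phi> V \<Psi> w. (U, \<Phi>) \<in> trivs \<Longrightarrow> (V, \<Psi>) \<in> trivs \<Longrightarrow>
          smooth_map_on (U \<inter> V) (\<lambda>p. \<Psi> p (inv_into (E p) (\<Phi> p) w))"
begin

definition sections :: "('m \<Rightarrow> 'v) set" where
  "sections = {s. (\<forall>p. s p \<in> E p) \<and> (\<forall>(U, \<Phi>)\<in>trivs. smooth_map_on U (\<lambda>p. \<Phi> p (s p)))}"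

end

section \<open>Courant algebroids\<close>

text \<open>
  A vector bundle with a nondegenerate symmetric bilinear form \<open>g\<close> and a bundle map
  \<open>\<rho> : E \<rightarrow> TM\<close> over the identity of the base; the bracket \<open>br\<close> is
  constrained only in the locale \<open>courant_algebroid\<close> below. The formulas for \<open>\<D>\<close>,
  \<open>T\<close> and the Jacobiator do not depend on the axioms of a Courant algebroid.
\<close>

locale courant_data = vector_bundle atlas E trivs
  for atlas :: "('m::{t2_space,second_countable_topology} set \<times> ('m \<Rightarrow> 'b::real_inner)) set"
    and E :: "'m \<Rightarrow> 'v::real_vector set"
    and trivs :: "('m set \<times> ('m \<Rightarrow> 'v \<Rightarrow> 'f::real_inner)) set" +
  fixes g :: "'m \<Rightarrow> 'v \<Rightarrow> 'v \<Rightarrow> real"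
    and \<rho> :: "'m \<Rightarrow> 'v \<Rightarrow> ('m \<Rightarrow> real) \<Rightarrow> real"
    and br :: "('m \<Rightarrow> 'v) \<Rightarrow> ('m \<Rightarrow> 'v) \<Rightarrow> 'm \<Rightarrow> 'v"
  assumes form_linear: "\<And>p v. v \<in> E p \<Longrightarrow> lin_on (E p) (g p v)"
    and form_sym: "\<And>p v w. v \<in> E p \<Longrightarrow> w \<in> E p \<Longrightarrow> g p v w = g p w v"
    and form_nondegenerate: "\<And>p v. v \<in> E p \<Longrightarrow> (\<And>w. w \<in> E p \<Longrightarrow> g p v w = 0) \<Longrightarrow> v = 0"
    and form_smooth: "\<And>s t. s \<in> sections \<Longrightarrow> t \<in> sections \<Longrightarrow>
          (\<lambda>p. g p (s p) (t p)) \<in> smooth_functions"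
    and anchor_fibre: "\<And>p v. v \<in> E p \<Longrightarrow> \<rho> p v \<in> tangent_space p"
    and anchor_linear: "\<And>p. lin_on (E p) (\<rho> p)"
    and anchor_smooth: "\<And>s. s \<in> sections \<Longrightarrow> (\<lambda>p. \<rho> p (s p)) \<in> vector_fields"
begin

definition pair :: "('m \<Rightarrow> 'v) \<Rightarrow> ('m \<Rightarrow> 'v) \<Rightarrow> 'm \<Rightarrow> real" where
  "pair s t = (\<lambda>p. g p (s p) (t p))"

definition anchor :: "('m \<Rightarrow> 'v) \<Rightarrow> 'm \<Rightarrow> ('m \<Rightarrow> real) \<Rightarrow> real" where
  "anchor s = (\<lambda>p. \<rho> p (s p))"

definition act :: "('m \<Rightarrow> 'v) \<Rightarrow> ('m \<Rightarrow> real) \<Rightarrow> 'm \<Rightarrow> real" where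
  "act s f = (\<lambda>p. anchor s p f)"

definition \<D> :: "('m \<Rightarrow> real) \<Rightarrow> 'm \<Rightarrow> 'v" where
  "\<D> f = (THE s. s \<in> sections \<and> (\<forall>e\<in>sections. pair s e = (1/2) *\<^sub>R act e f))"

definition T :: "('m \<Rightarrow> 'v) \<Rightarrow> ('m \<Rightarrow> 'v) \<Rightarrow> ('m \<Rightarrow> 'v) \<Rightarrow> 'm \<Rightarrow> real" where
  "T e1 e2 e3 = (1/3) *\<^sub>R (pair (br e1 e2) e3 + pair (br e2 e3) e1 + pair (br e3 e1) e2)"

definition jacobiator :: "('m \<Rightarrow> 'v) \<Rightarrow> ('m \<Rightarrow> 'v) \<Rightarrow> ('m \<Rightarrow> 'v) \<Rightarrow> 'm \<Rightarrow> 'v" where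
  "jacobiator e1 e2 e3 = br (br e1 e2) e3 + br (br e2 e3) e1 + br (br e3 e1) e2"

end

locale courant_algebroid = courant_data atlas E trivs g \<rho> br
  for atlas :: "('m::{t2_space,second_countable_topology} set \<times> ('m \<Rightarrow> 'b::real_inner)) set"
    and E :: "'m \<Rightarrow> 'v::real_vector set"
    and trivs :: "('m set \<times> ('m \<Rightarrow> 'v \<Rightarrow> 'f::real_inner)) set"
    and g \<rho> br +
  assumes br_closed: "\<And>e1 e2. e1 \<in> sections \<Longrightarrow> e2 \<in> sections \<Longrightarrow> br e1 e2 \<in> sections"
    and br_linear: "\<And>e. e \<in> sections \<Longrightarrow> lin_on sections (br e)"
    and br_skew: "\<And>e1 e2. e1 \<in> sections \<Longrightarrow> e2 \<in> sections \<Longrightarrow> br e1 e2 = - br e2 e1"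
    and jacobi: "\<And>e1 e2 e3. e1 \<in> sections \<Longrightarrow> e2 \<in> sections \<Longrightarrow> e3 \<in> sections \<Longrightarrow>
          jacobiator e1 e2 e3 = \<D> (T e1 e2 e3)"
    and anchor_br: "\<And>e1 e2. e1 \<in> sections \<Longrightarrow> e2 \<in> sections \<Longrightarrow>
          anchor (br e1 e2) = lie_bracket (anchor e1) (anchor e2)"
    and leibniz: "\<And>e1 e2 f. e1 \<in> sections \<Longrightarrow> e2 \<in> sections \<Longrightarrow> f \<in> smooth_functions \<Longrightarrow>
          br e1 (\<lambda>p. f p *\<^sub>R e2 p) =
            (\<lambda>p. f p *\<^sub>R br e1 e2 p + act e1 f p *\<^sub>R e2 p - pair e1 e2 p *\<^sub>R \<D> f p)"
    and anchor_\<D>: "\<And>f. f \<in> smooth_functions \<Longrightarrow> anchor (\<D> f) = 0"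
    and form_invariant: "\<And>e h1 h2. e \<in> sections \<Longrightarrow> h1 \<in> sections \<Longrightarrow> h2 \<in> sections \<Longrightarrow>
          act e (pair h1 h2) =
            pair (br e h1 + \<D> (pair e h1)) h2 + pair h1 (br e h2 + \<D> (pair e h2))"

section \<open>The graded exterior algebra\<close>

text \<open>A graded vector space is given by its homogeneous components inside an ambient space.\<close>

definition total :: "(int \<Rightarrow> 'x::real_vector set) \<Rightarrow> 'x set" where
  "total V = span (\<Union>k. V k)"

definition graded_space :: "(int \<Rightarrow> 'x::real_vector set) \<Rightarrow> bool" where
  "graded_space V \<longleftrightarrow> (\<forall>k. subspace (V k))
     \<and> (\<forall>K x. finite K \<and> (\<forall>k\<in>K. x k \<in> V k) \<and> (\<Sum>k\<in>K. x k) = 0 \<longrightarrow> (\<forall>k\<in>K. x k = 0))"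

text \<open>
  The tensor algebra is presented as the free vector space on words \<open>x\<^sub>1\<dots>x\<^sub>n\<close> (finitely supported
  functions on lists) modulo multilinearity. The exterior algebra is therefore the quotient of the
  free space by the span of the multilinearity relations and of the ideal generated by
  \<open>v \<otimes> w + (-1)\<^sup>i\<^sup>j w \<otimes> v\<close>, for \<open>v\<close>, \<open>w\<close> homogeneous of degrees \<open>i\<close>, \<open>j\<close>.
\<close>

definition word :: "'x list \<Rightarrow> 'x list \<Rightarrow> real" where
  "word xs = (\<lambda>ys. if ys = xs then 1 else 0)"

definition ext_relations :: "(int \<Rightarrow> 'x::real_vector set) \<Rightarrow> ('x list \<Rightarrow> real) set" where
  "ext_relations V = span (
     {word (us @ [a *\<^sub>R x + b *\<^sub>R y] @ vs) - a *\<^sub>R word (us @ [x] @ vs) - b *\<^sub>R word (us @ [y] @ vs)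
       | us vs x y a b. set us \<subseteq> total V \<and> set vs \<subseteq> total V \<and> x \<in> total V \<and> y \<in> total V}
     \<union> {word (us @ [v, w] @ vs) + ((-1) powi (i * j)) *\<^sub>R word (us @ [w, v] @ vs)
       | us vs v w i j. set us \<subseteq> total V \<and> set vs \<subseteq> total V \<and> v \<in> V i \<and> w \<in> V j})"

definition tensor_words :: "(int \<Rightarrow> 'x::real_vector set) \<Rightarrow> nat \<Rightarrow> ('x list \<Rightarrow> real) set" where
  "tensor_words V k = span {word xs | xs. length xs = k \<and> set xs \<subseteq> total V}"

definition wedge :: "(int \<Rightarrow> 'x::real_vector set) \<Rightarrow> 'x list \<Rightarrow> ('x list \<Rightarrow> real) set" where
  "wedge V xs = coset (ext_relations V) (word xs)"

definition ext_power :: "(int \<Rightarrow> 'x::real_vector set) \<Rightarrow> nat \<Rightarrow> ('x list \<Rightarrow> real) set set" where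
  "ext_power V k = coset (ext_relations V) ` tensor_words V k"

text \<open>The elements of total degree \<open>m\<close> in the \<open>k\<close>-th exterior power.\<close>

definition ext_power_deg ::
  "(int \<Rightarrow> 'x::real_vector set) \<Rightarrow> nat \<Rightarrow> int \<Rightarrow> ('x list \<Rightarrow> real) set set" where
  "ext_power_deg V k m = coset (ext_relations V) `
     span {word xs | xs ds. length xs = k \<and> list_all2 (\<lambda>x d. x \<in> V d) xs ds \<and> sum_list ds = m}"

text \<open>
  Linear maps from \<open>ext_power V k\<close> to \<open>V\<close>, for the vector space structure of a quotient,
  \<open>a[x] + b[y] = [ax + by]\<close>. The map acts on cosets, so it is well defined by its type.
\<close>

definition ext_linear ::
  "(int \<Rightarrow> 'x::real_vector set) \<Rightarrow> nat \<Rightarrow> (('x list \<Rightarrow> real) set \<Rightarrow> 'x) \<Rightarrow> bool" where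
  "ext_linear V k L \<longleftrightarrow> L ` ext_power V k \<subseteq> total V
     \<and> lin_on (tensor_words V k) (\<lambda>x. L (coset (ext_relations V) x))"

section \<open>Strongly homotopy Lie algebras\<close>

definition unshuffles :: "nat \<Rightarrow> nat \<Rightarrow> (nat \<Rightarrow> nat) set" where
  "unshuffles i n =
     {\<sigma>. \<sigma> permutes {1..n} \<and> strict_mono_on {1..i} \<sigma> \<and> strict_mono_on {i+1..n} \<sigma>}"

text \<open>
  Sorting \<open>x (\<sigma> 1), \<dots>, x (\<sigma> n)\<close> by adjacent interchanges swaps each inverted pair once, so
  the Koszul sign is a product over inversions. Here \<open>d m\<close> is the degree of \<open>x m\<close>.
\<close>

definition koszul :: "(nat \<Rightarrow> int) \<Rightarrow> nat \<Rightarrow> (nat \<Rightarrow> nat) \<Rightarrow> real" where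
  "koszul d n \<sigma> = (\<Prod>(a, b) | 1 \<le> a \<and> a < b \<and> b \<le> n \<and> \<sigma> b < \<sigma> a.
     if odd (d (\<sigma> a)) \<and> odd (d (\<sigma> b)) then -1 else 1)"

definition L_infinity ::
  "(int \<Rightarrow> 'x::real_vector set) \<Rightarrow> (nat \<Rightarrow> ('x list \<Rightarrow> real) set \<Rightarrow> 'x) \<Rightarrow> bool" where
  "L_infinity V l \<longleftrightarrow> graded_space V
     \<and> (\<forall>k\<ge>1. ext_linear V k (l k) \<and> (\<forall>m. l k ` ext_power_deg V k m \<subseteq> V (m + int k - 2)))
     \<and> (\<forall>n\<ge>1. \<forall>x d. (\<forall>m\<in>{1..n}. x m \<in> V (d m)) \<longrightarrow>
          (\<Sum>(i, j) | 1 \<le> i \<and> 1 \<le> j \<and> i + j = n + 1.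
            (-1) ^ (i * (j - 1)) *\<^sub>R
              (\<Sum>\<sigma>\<in>unshuffles i n. (of_int (sign \<sigma>) * koszul d n \<sigma>) *\<^sub>R
                l j (wedge V (l i (wedge V (map (\<lambda>m. x (\<sigma> m)) [1..<i+1]))
                                # map (\<lambda>m. x (\<sigma> m)) [i+1..<n+1])))) = 0)"

section \<open>Resolutions\<close>

text \<open>
  \<open>\<dots> \<rightarrow> V 2 \<rightarrow> V 1 \<rightarrow> V 0 \<rightarrow> W/S \<rightarrow> 0\<close> is exact, where the
  augmentation sends \<open>x \<in> V 0\<close> to the class of \<open>\<eta> x \<in> W\<close>.
\<close>

definition resolution_of_quotient ::
  "(int \<Rightarrow> 'x::real_vector set) \<Rightarrow> ('x \<Rightarrow> 'x) \<Rightarrow> ('x \<Rightarrow> 'w::real_vector) \<Rightarrow> 'w set \<Rightarrow> 'w set \<Rightarrow> bool"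
where
  "resolution_of_quotient V d \<eta> W S \<longleftrightarrow>
     graded_space V \<and> (\<forall>k<0. V k = {0}) \<and> subspace W \<and> subspace S \<and> S \<subseteq> W
     \<and> (\<forall>k. lin_on (V k) d \<and> d ` V k \<subseteq> V (k - 1))
     \<and> (\<forall>k>0. {x \<in> V k. d x = 0} = d ` V (k + 1))
     \<and> lin_on (V 0) \<eta> \<and> \<eta> ` V 0 \<subseteq> W
     \<and> {x \<in> V 0. coset S (\<eta> x) = coset S 0} = d ` V 1
     \<and> (\<lambda>x. coset S (\<eta> x)) ` V 0 = coset S ` W"

section \<open>The structure maps of a Courant algebroid\<close>

text \<open>
  The underlying type of the direct sum of the graded pieces of degrees 0, 1, 2. The maps
  \<open>X0\<close>, \<open>X1\<close>, \<open>X2\<close> are the inclusions of the summands.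
\<close>

type_synonym ('m, 'v) complex_space = "('m \<Rightarrow> 'v) \<times> ('m \<Rightarrow> real) \<times> ('m \<Rightarrow> real)"

context courant_data
begin

definition X0 :: "('m \<Rightarrow> 'v) \<Rightarrow> ('m, 'v) complex_space" where
  "X0 e = (e, 0, 0)"

definition X1 :: "('m \<Rightarrow> real) \<Rightarrow> ('m, 'v) complex_space" where
  "X1 f = (0, f, 0)"

definition X2 :: "('m \<Rightarrow> real) \<Rightarrow> ('m, 'v) complex_space" where
  "X2 c = (0, 0, c)"

definition ker_\<D> :: "('m \<Rightarrow> real) set" where
  "ker_\<D> = {c \<in> smooth_functions. \<D> c = 0}"

definition X :: "int \<Rightarrow> ('m, 'v) complex_space set" where
  "X k = (if k = 0 then X0 ` sections
          else if k = 1 then X1 ` smooth_functions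
          else if k = 2 then X2 ` ker_\<D>
          else {0})"

definition d :: "('m, 'v) complex_space \<Rightarrow> ('m, 'v) complex_space" where
  "d = (\<lambda>(e, f, c). (\<D> f, c, 0))"

text \<open>
  The linear maps with the prescribed values. By graded skew-symmetry these values determine
  \<open>l k\<close> on the whole of \<open>ext_power X k\<close>.
\<close>

definition courant_maps ::
  "(nat \<Rightarrow> (('m, 'v) complex_space list \<Rightarrow> real) set \<Rightarrow> ('m, 'v) complex_space) \<Rightarrow> bool" where
  "courant_maps l \<longleftrightarrow>
     (\<forall>k\<ge>1. ext_linear X k (l k))
     \<and> (\<forall>e\<in>sections. l 1 (wedge X [X0 e]) = 0)
     \<and> (\<forall>f\<in>smooth_functions. l 1 (wedge X [X1 f]) = X0 (\<D> f))
     \<and> (\<forall>c\<in>ker_\<D>. l 1 (wedge X [X2 c]) = X1 c)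
     \<and> (\<forall>e1\<in>sections. \<forall>e2\<in>sections. l 2 (wedge X [X0 e1, X0 e2]) = X0 (br e1 e2))
     \<and> (\<forall>e\<in>sections. \<forall>f\<in>smooth_functions. l 2 (wedge X [X0 e, X1 f]) = X1 (pair e (\<D> f)))
     \<and> (\<forall>m>1. \<forall>w\<in>ext_power_deg X 2 m. l 2 w = 0)
     \<and> (\<forall>e1\<in>sections. \<forall>e2\<in>sections. \<forall>e3\<in>sections.
          l 3 (wedge X [X0 e1, X0 e2, X0 e3]) = X1 (- T e1 e2 e3))
     \<and> (\<forall>m>0. \<forall>w\<in>ext_power_deg X 3 m. l 3 w = 0)
     \<and> (\<forall>n>3. \<forall>w\<in>ext_power X n. l n w = 0)"

end

end

theory Submission
  imports Defs
begin

text \<open>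
  Bump functions extend every vector of a fibre to a section, so a section is determined by its
  pairings with all sections. The Leibniz rule shows that \<open>\<langle>e\<^sub>1, e\<^sub>2\<rangle> \<D>f\<close> is a section; since
  \<open>\<langle>e\<^sub>1, e\<^sub>2\<rangle>\<close> can be made nonzero near any point, \<open>\<D>f\<close> is one too. Comparing axiom 5 for \<open>e\<close>, \<open>h\<close>
  with its versions for \<open>fe\<close> and \<open>fh\<close> then gives \<open>\<langle>\<D>f, e\<rangle> = \<rho>(e)f / 2\<close>.

  Graded skew-symmetric multilinear maps on words descend to the exterior powers, and the prescribed
  values determine them on homogeneous words. For degree reasons the homotopy Jacobi
  identities are nontrivial only for \<open>n \<le> 4\<close>. They reduce to \<open>J = \<D>T\<close>, to \<open>[e, \<D>f] = \<D>\<langle>e, \<D>f\<rangle>\<close>, to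
  \<open>T(\<D>f, e\<^sub>1, e\<^sub>2) = \<rho>([e\<^sub>1, e\<^sub>2])f / 4\<close>, and for four sections to the cocycle identity
  for \<open>T\<close>, which follows from \<open>J = \<D>T\<close> by invariance of the pairing.
\<close>

section \<open>Smooth functions and bump functions\<close>

text \<open>\<open>\<D>\<close> is a definite description, and the axioms mention it without
  asserting that a gradient exists. The usual existence argument inverts the matrix of the form in a
  local frame. Here the axioms are instead read as equations for the unknown \<open>\<D> f\<close>:
  they hold for whatever value \<open>THE\<close> returns, and they force that value to be the
  gradient. This needs a nonvanishing pairing near each point, so bundles with zero fibres are
  treated separately.

  Two facts tame the signs. A binary or ternary bracket with two odd arguments vanishes, so the
  brackets are antisymmetric in the ordinary, ungraded sense. In the identities with three or more
  arguments, the cases that do not vanish term by term have at most one odd argument, so their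
  Koszul signs are 1.

  Zero lies in every homogeneous component, so an element does not determine its degree. Most case
  splits therefore ask whether the section component \<open>fst x\<close> vanishes, not what the
  degree is.\<close>

lemma ck_on_subset: "ck_on k S f \<Longrightarrow> T \<subseteq> S \<Longrightarrow> ck_on k T f"
  by (induction k arbitrary: f) (auto intro: continuous_on_subset)

section \<open>Calculus of functions of class C^k on open sets\<close>

text \<open>\<open>frechet_derivative\<close> is a choice among derivatives. Both functions have the
  same candidates at \<open>x\<close>, so the choices agree even where no derivative exists.\<close>

lemma frechet_derivative_cong_open:
  assumes "open S" "x \<in> S" "\<And>y. y \<in> S \<Longrightarrow> f y = h y"
  shows "frechet_derivative f (at x) = frechet_derivative h (at x)"
proof -
  have "(f has_derivative D) (at x) \<longleftrightarrow> (h has_derivative D) (at x)" for D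
    using has_derivative_transform_within_open[of f D x UNIV S h]
      has_derivative_transform_within_open[of h D x UNIV S f] assms by auto
  then show ?thesis unfolding frechet_derivative_def by simp
qed

lemma ck_on_cong:
  assumes "open S" "\<And>x. x \<in> S \<Longrightarrow> f x = h x" "ck_on k S f"
  shows "ck_on k S h"
  using assms(2,3)
proof (induction k arbitrary: f h)
  case 0
  from 0(2) have "continuous_on S f" by simp
  then have "continuous_on S h" by (rule continuous_on_eq) (rule 0(1))
  then show ?case by simp
next
  case (Suc k)
  have "h differentiable (at x)" if "x \<in> S" for x
  proof -
    have "f differentiable (at x)" using Suc.prems(2) that by simp
    then obtain D where "(f has_derivative D) (at x)" unfolding differentiable_def by (rule exE)
    then have "(h has_derivative D) (at x)"
      by (rule has_derivative_transform_within_open[OF _ assms(1) that]) (rule Suc.prems(1))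
    then show ?thesis by (rule differentiableI)
  qed
  moreover have "ck_on k S (\<lambda>x. frechet_derivative h (at x) v)" for v
  proof (rule Suc.IH[of "\<lambda>x. frechet_derivative f (at x) v"])
    show "frechet_derivative f (at x) v = frechet_derivative h (at x) v" if "x \<in> S" for x
      using frechet_derivative_cong_open[OF assms(1) that Suc.prems(1)] by (rule fun_cong)
    show "ck_on k S (\<lambda>x. frechet_derivative f (at x) v)"
      using Suc.prems(2) by simp
  qed
  ultimately show ?case by simp
qed

text \<open>Replaces the chosen derivative by an explicit formula, which turns the closure
  properties below into inductions on the order of differentiability.\<close>

lemma ck_on_has_derivativeI:
  assumes "open S" "\<And>x. x \<in> S \<Longrightarrow> (f has_derivative D x) (at x)"
    and "\<And>v. ck_on k S (\<lambda>x. D x v)"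
  shows "ck_on (Suc k) S f"
proof -
  have "frechet_derivative f (at x) = D x" if "x \<in> S" for x
    using frechet_derivative_at[OF assms(2)[OF that]] by simp
  then have "ck_on k S (\<lambda>x. frechet_derivative f (at x) v)" for v
    by (intro ck_on_cong[OF assms(1) _ assms(3)[of v]]) simp
  then show ?thesis using assms(2) differentiableI unfolding ck_on.simps by blast
qed

lemma ck_on_Suc_continuous_on: "ck_on (Suc k) S f \<Longrightarrow> continuous_on S f"
  unfolding ck_on.simps
  by (blast intro: continuous_at_imp_continuous_on differentiable_imp_continuous_within)

lemma ck_on_SucD: "ck_on (Suc k) S f \<Longrightarrow> ck_on k S f"
proof (induction k arbitrary: f)
  case 0
  from ck_on_Suc_continuous_on[OF 0] show ?case by simp
qed simp

lemma ck_on_open_cover: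
  assumes "\<And>x. x \<in> S \<Longrightarrow> \<exists>U. open U \<and> x \<in> U \<and> ck_on k (S \<inter> U) f" and "open S"
  shows "ck_on k S f"
  using assms(1)
proof (induction k arbitrary: f)
  case 0
  show ?case
  proof (simp, rule continuous_at_imp_continuous_on, rule ballI)
    fix x assume "x \<in> S"
    with 0 obtain U where U: "open U" "x \<in> U" "continuous_on (S \<inter> U) f" by auto
    then show "isCont f x"
      using \<open>open S\<close> \<open>x \<in> S\<close> continuous_on_eq_continuous_at[of "S \<inter> U" f] by blast
  qed
next
  case (Suc k)
  have "f differentiable (at x)" if "x \<in> S" for x
    using Suc.prems[OF that] that by auto
  moreover have "ck_on k S (\<lambda>x. frechet_derivative f (at x) v)" for v
    by (rule Suc.IH) (use Suc.prems in fastforce)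
  ultimately show ?case by simp
qed

lemma ck_on_const: "open S \<Longrightarrow> ck_on k S (\<lambda>x. c)"
proof (induction k arbitrary: c)
  case (Suc k)
  show ?case
    by (rule ck_on_has_derivativeI[where D="\<lambda>_ _. 0"]) (use Suc in auto)
qed simp

lemma ck_on_add:
  "open S \<Longrightarrow> ck_on k S f \<Longrightarrow> ck_on k S h \<Longrightarrow> ck_on k S (\<lambda>x. f x + h x)"
proof (induction k arbitrary: f h)
  case 0
  then show ?case by (auto intro: continuous_intros)
next
  case (Suc k)
  show ?case
  proof (rule ck_on_has_derivativeI[OF Suc.prems(1)])
    fix x assume "x \<in> S"
    then show "((\<lambda>x. f x + h x) has_derivative
      (\<lambda>v. frechet_derivative f (at x) v + frechet_derivative h (at x) v)) (at x)"
      using Suc.prems by (auto intro!: has_derivative_add simp: frechet_derivative_works)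
  qed (use Suc in auto)
qed

lemma (in bounded_bilinear) ck_on:
  "open S \<Longrightarrow> ck_on k S f \<Longrightarrow> ck_on k S h \<Longrightarrow> ck_on k S (\<lambda>x. prod (f x) (h x))"
proof (induction k arbitrary: f h)
  case 0
  then show ?case by (auto intro: continuous_on)
next
  case (Suc k)
  show ?case
  proof (rule ck_on_has_derivativeI[OF Suc.prems(1)])
    fix x assume "x \<in> S"
    then show "((\<lambda>x. prod (f x) (h x)) has_derivative
      (\<lambda>v. prod (f x) (frechet_derivative h (at x) v) + prod (frechet_derivative f (at x) v) (h x))) (at x)"
      using Suc.prems by (auto intro!: FDERIV simp: frechet_derivative_works)
  next
    fix v
    show "ck_on k S (\<lambda>x. prod (f x) (frechet_derivative h (at x) v)
        + prod (frechet_derivative f (at x) v) (h x))"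
      using Suc.prems ck_on_SucD[OF Suc.prems(2)] ck_on_SucD[OF Suc.prems(3)]
      by (intro ck_on_add Suc.IH) auto
  qed
qed

lemma ck_on_real_compose:
  fixes f :: "'a::real_normed_vector \<Rightarrow> real" and h :: "real \<Rightarrow> real"
  shows "open S \<Longrightarrow> open T \<Longrightarrow> ck_on k S f \<Longrightarrow> ck_on k T h \<Longrightarrow> f ` S \<subseteq> T \<Longrightarrow> ck_on k S (\<lambda>x. h (f x))"
proof (induction k arbitrary: h)
  case 0
  then show ?case by (auto intro: continuous_on_compose2)
next
  case (Suc k)
  let ?h' = "\<lambda>t. frechet_derivative h (at t) 1"
  show ?case
  proof (rule ck_on_has_derivativeI[OF Suc.prems(1)])
    fix x assume x: "x \<in> S"
    have f: "(f has_derivative frechet_derivative f (at x)) (at x)"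
      using Suc.prems x by (simp add: frechet_derivative_works)
    have h: "(h has_derivative frechet_derivative h (at (f x))) (at (f x))"
      using Suc.prems x by (auto simp: frechet_derivative_works[symmetric])
    \<comment> \<open>A linear map on the reals is multiplication by its value at 1. The chain rule
      thus becomes a product whose second factor is again a composite with \<open>f\<close>, ready
      for the induction hypothesis.\<close>
    have "frechet_derivative h (at (f x)) t = t * ?h' (f x)" for t
      using linear_cmul[OF has_derivative_linear[OF h], of t 1] by simp
    then have "(\<lambda>v. frechet_derivative h (at (f x)) (frechet_derivative f (at x) v))
        = (\<lambda>v. frechet_derivative f (at x) v * ?h' (f x))" by (intro ext)
    with has_derivative_compose[OF f h]
    show "((\<lambda>x. h (f x)) has_derivative (\<lambda>v. frechet_derivative f (at x) v * ?h' (f x))) (at x)"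
      by (simp only:)
  next
    fix v
    have "ck_on k S (\<lambda>x. ?h' (f x))"
      by (rule Suc.IH[OF Suc.prems(1,2) ck_on_SucD[OF Suc.prems(3)] _ Suc.prems(5)])
        (use Suc.prems(4) in simp)
    then show "ck_on k S (\<lambda>x. frechet_derivative f (at x) v * ?h' (f x))"
      using Suc.prems by (intro bounded_bilinear.ck_on[OF bounded_bilinear_mult]) auto
  qed
qed

lemma smooth_on_subset: "smooth_on S f \<Longrightarrow> T \<subseteq> S \<Longrightarrow> smooth_on T f"
  using ck_on_subset unfolding smooth_on_def by blast

lemma smooth_on_cong:
  "open S \<Longrightarrow> (\<And>x. x \<in> S \<Longrightarrow> f x = h x) \<Longrightarrow> smooth_on S f \<Longrightarrow> smooth_on S h"
  using ck_on_cong unfolding smooth_on_def by blast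

lemma smooth_on_const: "open S \<Longrightarrow> smooth_on S (\<lambda>x. c)"
  by (simp add: smooth_on_def ck_on_const)

lemma smooth_on_add:
  "open S \<Longrightarrow> smooth_on S f \<Longrightarrow> smooth_on S h \<Longrightarrow> smooth_on S (\<lambda>x. f x + h x)"
  by (simp add: smooth_on_def ck_on_add)

lemma (in bounded_bilinear) smooth_on:
  "open S \<Longrightarrow> smooth_on S f \<Longrightarrow> smooth_on S h \<Longrightarrow> smooth_on S (\<lambda>x. prod (f x) (h x))"
  by (simp add: smooth_on_def ck_on)

lemma smooth_on_real_compose:
  fixes f :: "'a::real_normed_vector \<Rightarrow> real" and h :: "real \<Rightarrow> real"
  shows "open S \<Longrightarrow> open T \<Longrightarrow> smooth_on S f \<Longrightarrow> smooth_on T h \<Longrightarrow> f ` S \<subseteq> T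
    \<Longrightarrow> smooth_on S (\<lambda>x. h (f x))"
  using ck_on_real_compose[of S T] by (simp add: smooth_on_def)

text \<open>The derivative is a product of constants and copies of \<open>inverse\<close>, so the
  induction hypothesis and the product rule close the induction.\<close>

lemma smooth_on_inverse: "smooth_on (- {0::real}) inverse"
proof -
  have "ck_on k (- {0::real}) inverse" for k
  proof (induction k)
    case 0
    show ?case by (auto intro: continuous_intros)
  next
    case (Suc k)
    have "open (- {0::real})" by auto
    then show ?case
    proof (rule ck_on_has_derivativeI[where D="\<lambda>x v. (-v) * (inverse x * inverse x)"])
      show "(inverse has_derivative (\<lambda>v. (-v) * (inverse x * inverse x))) (at x)" if "x \<in> - {0}" for x :: real
        using that by (auto intro!: derivative_eq_intros)
      show "ck_on k (- {0::real}) (\<lambda>x. (-v) * (inverse x * inverse x))" for v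
        by (intro bounded_bilinear.ck_on[OF bounded_bilinear_mult] ck_on_const Suc) auto
    qed
  qed
  then show ?thesis by (simp add: smooth_on_def)
qed

section \<open>The flat function exp(-1/t)\<close>

text \<open>The family is closed under differentiation, up to linear combinations.\<close>

definition flat :: "nat \<Rightarrow> real \<Rightarrow> real" where
  "flat k t = (if t > 0 then exp (- inverse t) * inverse t ^ k else 0)"

text \<open>The substitution u = 1/t turns the right-hand limit into the decay of u^k / exp u at
  infinity; on the left the function is zero.\<close>

lemma flat_tendsto_0: "(flat k \<longlongrightarrow> 0) (at 0)"
proof -
  have "((\<lambda>u::real. u ^ k / exp u) \<longlongrightarrow> 0) at_top"
    by (rule tendsto_power_div_exp_0)
  then have "((\<lambda>t::real. inverse t ^ k / exp (inverse t)) \<longlongrightarrow> 0) (at_right 0)"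
    by (rule filterlim_compose[OF _ filterlim_inverse_at_top_right])
  then have "(flat k \<longlongrightarrow> 0) (at_right 0)"
    by (rule Lim_transform_eventually)
      (auto simp: flat_def eventually_at_filter exp_minus field_simps)
  moreover have "(flat k \<longlongrightarrow> 0) (at_left 0)"
    by (rule Lim_transform_eventually[of "\<lambda>_. 0"]) (auto simp: flat_def eventually_at_filter)
  ultimately show ?thesis
    by (simp add: filterlim_split_at)
qed

lemma flat_has_real_derivative:
  "(flat k has_real_derivative flat (k + 2) t - real k * flat (k + 1) t) (at t)"
proof -
  consider "t > 0" | "t < 0" | "t = 0" by linarith
  then show ?thesis
  proof cases
    case 1
    have "((\<lambda>t. exp (- inverse t) * inverse t ^ k) has_real_derivative
       flat (k + 2) t - real k * flat (k + 1) t) (at t)"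
    proof -
      have "real k * inverse t ^ (k - Suc 0) * (inverse t * inverse t) = real k * inverse t ^ Suc k"
        by (cases k) auto
      then show ?thesis
        using 1 by (auto intro!: derivative_eq_intros simp: flat_def algebra_simps)
    qed
    then show ?thesis
      by (rule has_field_derivative_transform_within_open[of _ _ _ "{0<..}"])
        (use 1 in \<open>auto simp: flat_def\<close>)
  next
    case 2
    have "((\<lambda>t. 0) has_real_derivative 0) (at t)" by simp
    then have "(flat k has_real_derivative 0) (at t)"
      by (rule has_field_derivative_transform_within_open[of _ _ _ "{..<0}"])
        (use 2 in \<open>auto simp: flat_def\<close>)
    then show ?thesis using 2 by (simp add: flat_def)
  next
    case 3
    \<comment> \<open>Away from 0 the difference quotient of \<open>flat k\<close> at 0 is
      \<open>flat (k + 1)\<close>.\<close>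
    have "((\<lambda>s. (flat k s - flat k 0) / (s - 0)) \<longlongrightarrow> 0) (at 0)"
      by (rule Lim_transform_eventually[OF flat_tendsto_0[of "k + 1"]])
        (auto simp: flat_def eventually_at_filter field_simps)
    then have "(flat k has_real_derivative 0) (at 0)"
      by (simp add: has_field_derivative_iff)
    then show ?thesis using 3 by (simp add: flat_def)
  qed
qed

lemma smooth_on_flat: "smooth_on UNIV (flat k)"
proof -
  have "ck_on n UNIV (flat k)" for n
  proof (induction n arbitrary: k)
    case 0
    show ?case
      using flat_has_real_derivative by (auto intro!: continuous_at_imp_continuous_on DERIV_isCont)
  next
    case (Suc n)
    show ?case
    proof (rule ck_on_has_derivativeI)
      show "(flat k has_derivative (\<lambda>v. v * (flat (k + 2) t + (- real k) * flat (k + 1) t))) (at t)" for t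
        using flat_has_real_derivative[of k t] unfolding has_field_derivative_def
        by (rule has_derivative_eq_rhs) (simp add: fun_eq_iff algebra_simps)
      show "ck_on n UNIV (\<lambda>t. v * (flat (k + 2) t + (- real k) * flat (k + 1) t))" for v
        by (intro bounded_bilinear.ck_on[OF bounded_bilinear_mult] ck_on_add ck_on_const Suc open_UNIV)
    qed auto
  qed
  then show ?thesis by (simp add: smooth_on_def)
qed

section \<open>Compact balls in finite-dimensional inner product spaces\<close>

text \<open>Gram-Schmidt. With an orthonormal spanning set, coordinates are inner products and are
  therefore bounded on balls.\<close>

lemma orthonormal_spanning_set:
  fixes S :: "'a::real_inner set"
  assumes "finite S"
  shows "\<exists>B. finite B \<and> span B = span S \<and> (\<forall>b\<in>B. norm b = 1) \<and> (\<forall>b\<in>B. \<forall>c\<in>B. b \<noteq> c \<longrightarrow> inner b c = 0)"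
  using assms
proof (induction S)
  case empty
  show ?case by (rule exI[of _ "{}"]) auto
next
  case (insert x S)
  from insert.IH obtain B where B': "finite B \<and> span B = span S \<and> (\<forall>b\<in>B. norm b = 1)
    \<and> (\<forall>b\<in>B. \<forall>c\<in>B. b \<noteq> c \<longrightarrow> inner b c = 0)" by (rule exE)
  then have B: "finite B" "span B = span S" "\<And>b. b \<in> B \<Longrightarrow> norm b = 1"
    "\<And>b c. b \<in> B \<Longrightarrow> c \<in> B \<Longrightarrow> b \<noteq> c \<Longrightarrow> inner b c = 0" by auto
  \<comment> \<open>\<open>z\<close> is the orthogonal projection of \<open>x\<close> to the span of
    \<open>B\<close>, and \<open>y\<close> is the remainder; \<open>y\<close> is normalized and
    added to \<open>B\<close> unless it is 0.\<close>
  define z where "z = (\<Sum>b\<in>B. inner x b *\<^sub>R b)"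
  define y where "y = x - z"
  have z: "z \<in> span B" unfolding z_def by (intro span_sum span_scale span_base)
  have zc: "inner z c = inner x c" if "c \<in> B" for c
  proof -
    have "inner z c = (\<Sum>b\<in>B. if b = c then inner x c else 0)"
      unfolding z_def inner_sum_left
    proof (rule sum.cong[OF refl])
      fix b assume "b \<in> B"
      then show "inner (inner x b *\<^sub>R b) c = (if b = c then inner x c else 0)"
        using B(3)[OF \<open>b \<in> B\<close>] B(4)[OF _ \<open>c \<in> B\<close>] by (auto simp: dot_square_norm)
    qed
    then show ?thesis using that B(1) by simp
  qed
  have yc: "inner y c = 0" if "c \<in> B" for c
    using zc[OF that] by (simp add: y_def inner_diff_left)
  have xy: "x = y + z" by (simp add: y_def)
  have span_x: "span (insert x S) = span (insert y B)"
  proof -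
    have "span (insert x S) = span (insert x B)"
      using B(2) by (simp add: span_insert)
    also have "\<dots> = span (insert y B)"
    proof (rule span_eq[THEN iffD2], intro conjI insert_subsetI)
      have "y \<in> span (insert y B)" "z \<in> span (insert y B)"
        using z span_mono[of B "insert y B"] by (auto intro: span_base)
      then show "x \<in> span (insert y B)" unfolding xy by (rule span_add)
      have "x \<in> span (insert x B)" "z \<in> span (insert x B)"
        using z span_mono[of B "insert x B"] by (auto intro: span_base)
      then show "y \<in> span (insert x B)" unfolding y_def by (rule span_diff)
    qed (auto intro: span_base)
    finally show ?thesis .
  qed
  show ?case
  proof (cases "y = 0")
    case True
    then show ?thesis using B span_x by (intro exI[of _ B]) (auto simp: span_insert_0)
  next
    case False
    have "span (insert (y /\<^sub>R norm y) B) = span (insert y B)"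
    proof (rule span_eq[THEN iffD2], intro conjI insert_subsetI)
      show "y /\<^sub>R norm y \<in> span (insert y B)" by (intro span_scale span_base) auto
      have "norm y *\<^sub>R (y /\<^sub>R norm y) \<in> span (insert (y /\<^sub>R norm y) B)"
        by (intro span_scale span_base) auto
      then show "y \<in> span (insert (y /\<^sub>R norm y) B)" using False by simp
    qed (auto intro: span_base)
    then show ?thesis
      using B span_x yc False
      by (intro exI[of _ "insert (y /\<^sub>R norm y) B"]) (auto simp: inner_commute)
  qed
qed

text \<open>The class \<open>real_inner\<close> has infinite-dimensional members, so Heine-Borel has
  to come from the finite spanning set. By Cauchy-Schwarz a ball about 0 lies in a cube of
  orthonormal coordinates. The cube is an iterated sum of compact segments, and the ball is closed
  in it.\<close>

lemma compact_cball_finite_dim: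
  fixes y :: "'a::real_inner"
  assumes "\<exists>B. finite B \<and> span B = (UNIV :: 'a set)"
  shows "compact (cball y r)"
proof -
  obtain B :: "'a set" where B: "finite B" "span B = UNIV" "\<And>b. b \<in> B \<Longrightarrow> norm b = 1"
    "\<And>b c. b \<in> B \<Longrightarrow> c \<in> B \<Longrightarrow> b \<noteq> c \<Longrightarrow> inner b c = 0"
    using assms orthonormal_spanning_set by metis
  have "compact {\<Sum>b\<in>C. u b *\<^sub>R b | u. \<forall>b\<in>C. u b \<in> {-r..r}}" if "finite C" for C :: "'a set"
    using that
  proof (induction C)
    case empty
    have "{\<Sum>b\<in>{}. u b *\<^sub>R b | u. \<forall>b\<in>{}. u b \<in> {-r..r}} = {0::'a}" by auto
    then show ?case by simp
  next
    case (insert c C)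
    let ?K = "\<lambda>C. {\<Sum>b\<in>C. u b *\<^sub>R b | u. \<forall>b\<in>C. u b \<in> {-r..r}}"
    have "compact ((\<lambda>t. t *\<^sub>R c) ` {-r..r})"
      by (intro compact_continuous_image continuous_intros) auto
    then have "compact {x + y |x y. x \<in> (\<lambda>t. t *\<^sub>R c) ` {-r..r} \<and> y \<in> ?K C}"
      using insert.IH by (rule compact_sums)
    also have "{x + y |x y. x \<in> (\<lambda>t. t *\<^sub>R c) ` {-r..r} \<and> y \<in> ?K C} = ?K (insert c C)"
    proof (intro set_eqI iffI)
      fix z assume "z \<in> {x + y |x y. x \<in> (\<lambda>t. t *\<^sub>R c) ` {-r..r} \<and> y \<in> ?K C}"
      then obtain t u where tu: "t \<in> {-r..r}" "\<forall>b\<in>C. u b \<in> {-r..r}" "z = t *\<^sub>R c + (\<Sum>b\<in>C. u b *\<^sub>R b)"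
        by auto
      have "(\<Sum>b\<in>C. (u(c := t)) b *\<^sub>R b) = (\<Sum>b\<in>C. u b *\<^sub>R b)"
        using insert.hyps by (intro sum.cong) auto
      then have "z = (\<Sum>b\<in>insert c C. (u(c := t)) b *\<^sub>R b)" using tu insert.hyps by simp
      moreover have "\<forall>b\<in>insert c C. (u(c := t)) b \<in> {-r..r}" using tu by simp
      ultimately show "z \<in> ?K (insert c C)" by blast
    next
      fix z assume "z \<in> ?K (insert c C)"
      then show "z \<in> {x + y |x y. x \<in> (\<lambda>t. t *\<^sub>R c) ` {-r..r} \<and> y \<in> ?K C}"
        using insert.hyps by fastforce
    qed
    finally show ?case .
  qed
  note K = this[OF B(1)]
  have "cball 0 r \<subseteq> {\<Sum>b\<in>B. u b *\<^sub>R b | u. \<forall>b\<in>B. u b \<in> {-r..r}}"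
  proof
    fix x :: 'a assume x: "x \<in> cball 0 r"
    have "x \<in> span B" using B(2) by simp
    then obtain u where u: "x = (\<Sum>b\<in>B. u b *\<^sub>R b)"
      using span_finite[OF B(1)] by auto
    have "u c = inner x c" if "c \<in> B" for c
    proof -
      have "inner x c = (\<Sum>b\<in>B. if b = c then u c else 0)"
        unfolding u inner_sum_left
      proof (rule sum.cong[OF refl])
        fix b assume "b \<in> B"
        then show "inner (u b *\<^sub>R b) c = (if b = c then u c else 0)"
          using B(3)[OF \<open>b \<in> B\<close>] B(4)[OF _ \<open>c \<in> B\<close>] by (auto simp: dot_square_norm)
      qed
      then show ?thesis using that B(1) by simp
    qed
    then have "\<bar>u c\<bar> \<le> r" if "c \<in> B" for c
      using Cauchy_Schwarz_ineq2[of x c] B(3)[OF that] x that by simp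
    then show "x \<in> {\<Sum>b\<in>B. u b *\<^sub>R b | u. \<forall>b\<in>B. u b \<in> {-r..r}}"
      using u by (auto simp: abs_le_iff intro!: exI[of _ u]) (metis minus_le_iff)
  qed
  then have "{\<Sum>b\<in>B. u b *\<^sub>R b | u. \<forall>b\<in>B. u b \<in> {-r..r}} \<inter> cball 0 r = cball 0 r"
    by (rule inf_absorb2)
  with compact_Int_closed[OF K closed_cball[of 0 r]] have "compact (cball (0::'a) r)"
    by (simp only:)
  then have "compact ((+) y ` cball 0 r)" by (rule compact_translation)
  moreover have "(+) y ` cball 0 r = cball y r" by simp
  ultimately show ?thesis by metis
qed

section \<open>Smooth maps and bump functions on a manifold\<close>

context smooth_manifold
begin

lemma chart_at:
  obtains U \<phi> where "(U, \<phi>) \<in> atlas" "q \<in> U"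
proof -
  have "q \<in> (\<Union>(U, \<phi>)\<in>atlas. U)" unfolding chart_cover by (rule UNIV_I)
  then show thesis using that by auto
qed

lemma chart_image_open:
  assumes "(U, \<phi>) \<in> atlas" "open W"
  shows "open (\<phi> ` (U \<inter> W))"
proof -
  have h: "homeomorphism U (\<phi> ` U) \<phi> (inv_into U \<phi>)" "open U" "open (\<phi> ` U)"
    using chart[OF assms(1)] by auto
  have "openin (top_of_set (\<phi> ` U)) (\<phi> ` (U \<inter> W))"
    by (rule homeomorphism_imp_open_map[OF h(1)]) (use assms(2) in auto)
  then show ?thesis using h(3) openin_open_trans by blast
qed

lemma chart_inv: "(U, \<phi>) \<in> atlas \<Longrightarrow> q \<in> U \<Longrightarrow> inv_into U \<phi> (\<phi> q) = q"
  using chart[of U \<phi>] by (auto simp: homeomorphism_def)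

lemma smooth_map_on_cong:
  assumes "open W" "\<And>q. q \<in> W \<Longrightarrow> f q = h q" "smooth_map_on W f"
  shows "smooth_map_on W h"
  unfolding smooth_map_on_def
proof clarify
  fix U \<phi> assume c: "(U, \<phi>) \<in> atlas"
  show "smooth_on (\<phi> ` (U \<inter> W)) (h \<circ> inv_into U \<phi>)"
    by (rule smooth_on_cong[OF chart_image_open[OF c assms(1)], of "f \<circ> inv_into U \<phi>"])
      (use assms c in \<open>auto simp: chart_inv smooth_map_on_def\<close>)
qed

lemma smooth_map_on_subset: "smooth_map_on W f \<Longrightarrow> W' \<subseteq> W \<Longrightarrow> smooth_map_on W' f"
  unfolding smooth_map_on_def by (blast intro: smooth_on_subset)

lemma smooth_map_on_const: "open W \<Longrightarrow> smooth_map_on W (\<lambda>q. c)"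
  unfolding smooth_map_on_def comp_def by (auto intro!: smooth_on_const chart_image_open)

lemma smooth_map_on_add:
  "open W \<Longrightarrow> smooth_map_on W f \<Longrightarrow> smooth_map_on W h \<Longrightarrow> smooth_map_on W (\<lambda>q. f q + h q)"
  unfolding smooth_map_on_def comp_def by (auto intro!: smooth_on_add chart_image_open)

lemma smooth_map_on_bilinear:
  "bounded_bilinear B \<Longrightarrow> open W \<Longrightarrow> smooth_map_on W f \<Longrightarrow> smooth_map_on W h
    \<Longrightarrow> smooth_map_on W (\<lambda>q. B (f q) (h q))"
  unfolding smooth_map_on_def comp_def
  by (auto intro!: bounded_bilinear.smooth_on[of B] chart_image_open)

lemma smooth_map_on_real_compose:
  fixes f :: "'m \<Rightarrow> real" and h :: "real \<Rightarrow> real"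
  assumes "open W" "open S" "smooth_map_on W f" "smooth_on S h" "f ` W \<subseteq> S"
  shows "smooth_map_on W (\<lambda>q. h (f q))"
  unfolding smooth_map_on_def comp_def
proof clarify
  fix U \<phi> assume c: "(U, \<phi>) \<in> atlas"
  show "smooth_on (\<phi> ` (U \<inter> W)) (\<lambda>x. h (f (inv_into U \<phi> x)))"
    by (rule smooth_on_real_compose[OF chart_image_open[OF c assms(1)] assms(2)])
      (use assms c in \<open>auto simp: chart_inv smooth_map_on_def comp_def\<close>)
qed

lemma smooth_map_on_open_cover:
  assumes "open W" "\<And>q. q \<in> W \<Longrightarrow> \<exists>N. open N \<and> q \<in> N \<and> smooth_map_on (W \<inter> N) f"
  shows "smooth_map_on W f"
  unfolding smooth_map_on_def smooth_on_def
proof clarify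
  fix U \<phi> k assume c: "(U, \<phi>) \<in> atlas"
  show "ck_on k (\<phi> ` (U \<inter> W)) (f \<circ> inv_into U \<phi>)"
  proof (rule ck_on_open_cover[OF _ chart_image_open[OF c assms(1)]])
    fix x assume "x \<in> \<phi> ` (U \<inter> W)"
    then obtain q where q: "q \<in> U" "q \<in> W" "x = \<phi> q" by blast
    obtain N where N: "open N" "q \<in> N" "smooth_map_on (W \<inter> N) f" using assms(2) q by blast
    \<comment> \<open>Charts are injective, so an intersection of images comes from the intersection
      of the domains.\<close>
    have sub: "\<phi> ` (U \<inter> W) \<inter> \<phi> ` (U \<inter> N) \<subseteq> \<phi> ` (U \<inter> (W \<inter> N))"
    proof
      fix z assume "z \<in> \<phi> ` (U \<inter> W) \<inter> \<phi> ` (U \<inter> N)"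
      then obtain a b where ab: "a \<in> U" "a \<in> W" "z = \<phi> a" "b \<in> U" "b \<in> N" "z = \<phi> b" by auto
      then have "a = b" using chart_inv[OF c] by metis
      then show "z \<in> \<phi> ` (U \<inter> (W \<inter> N))" using ab by auto
    qed
    have "ck_on k (\<phi> ` (U \<inter> (W \<inter> N))) (f \<circ> inv_into U \<phi>)"
      using N(3) c unfolding smooth_map_on_def smooth_on_def by blast
    from ck_on_subset[OF this sub]
    show "\<exists>V. open V \<and> x \<in> V \<and> ck_on k (\<phi> ` (U \<inter> W) \<inter> V) (f \<circ> inv_into U \<phi>)"
      using chart_image_open[OF c N(1)] q N(2) by blast
  qed
qed

text \<open>Read in another chart, a chart is a transition map.\<close>

lemma smooth_map_on_chart: "(U, \<phi>) \<in> atlas \<Longrightarrow> smooth_map_on U \<phi>"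
  using chart_change unfolding smooth_map_on_def by (auto simp: Int_commute)

lemma smooth_functions_continuous:
  assumes "f \<in> smooth_functions"
  shows "continuous_on UNIV f"
proof -
  have "isCont f q" for q
  proof -
    obtain U \<phi> where c: "(U, \<phi>) \<in> atlas" "q \<in> U" by (rule chart_at)
    have "smooth_on (\<phi> ` U) (f \<circ> inv_into U \<phi>)"
      using assms c by (auto simp: smooth_functions_def smooth_map_on_def)
    then have 1: "continuous_on (\<phi> ` U) (f \<circ> inv_into U \<phi>)"
      unfolding smooth_on_def by (metis ck_on.simps(1))
    have "continuous_on U \<phi>" using chart[OF c(1)] by (auto simp: homeomorphism_def)
    from continuous_on_compose[OF this 1] have "continuous_on U f"
      by (rule continuous_on_eq) (auto simp: chart_inv[OF c(1)])
    then show ?thesis using chart[OF c(1)] c(2) continuous_on_eq_continuous_at by blast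
  qed
  then show ?thesis by (auto intro: continuous_at_imp_continuous_on)
qed

text \<open>In a chart around \<open>p\<close>, compose \<open>flat 0\<close> with the radius
  squared minus the squared distance. The result vanishes off the preimage \<open>K\<close> of a
  closed ball. \<open>K\<close> is compact, hence closed because the manifold is Hausdorff. The
  extension by zero is smooth on the open sets \<open>U\<close> and \<open>- K\<close>, which cover
  the manifold since \<open>K\<close> lies in \<open>U\<close>.\<close>

lemma bump_function:
  assumes "open W" "p \<in> W"
  obtains \<beta> K where "\<beta> \<in> smooth_functions" "\<beta> p = 1" "closed K" "K \<subseteq> W" "\<And>q. q \<notin> K \<Longrightarrow> \<beta> q = 0"
proof -
  obtain U \<phi> where c: "(U, \<phi>) \<in> atlas" "p \<in> U" by (rule chart_at)
  obtain r where r: "r > 0" "cball (\<phi> p) r \<subseteq> \<phi> ` (U \<inter> W)"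
    using chart_image_open[OF c(1) assms(1)] c(2) assms(2) open_contains_cball by blast
  define K where "K = inv_into U \<phi> ` cball (\<phi> p) r"
  have "continuous_on (cball (\<phi> p) r) (inv_into U \<phi>)"
    using chart[OF c(1)] r(2) by (auto simp: homeomorphism_def intro: continuous_on_subset)
  then have "compact K"
    unfolding K_def by (intro compact_continuous_image compact_cball_finite_dim model_finite_dim)
  then have K: "closed K" by (rule compact_imp_closed)
  have KU: "K \<subseteq> U \<inter> W" unfolding K_def using r(2) chart_inv[OF c(1)] by force
  define w where "w q = r\<^sup>2 + (- inner (\<phi> q - \<phi> p) (\<phi> q - \<phi> p))" for q
  define h where "h q = (if q \<in> U then flat 0 (w q) else 0)" for q
  have h0: "h q = 0" if "q \<notin> K" for q
  proof (cases "q \<in> U")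
    case True
    have "\<phi> q \<notin> cball (\<phi> p) r"
    proof
      assume "\<phi> q \<in> cball (\<phi> p) r"
      then have "inv_into U \<phi> (\<phi> q) \<in> K" unfolding K_def by (rule imageI)
      then show False using that chart_inv[OF c(1) True] by simp
    qed
    then have "norm (\<phi> q - \<phi> p) > r" by (simp add: dist_norm norm_minus_commute)
    then have "r\<^sup>2 < (norm (\<phi> q - \<phi> p))\<^sup>2" using r(1) by (intro power_strict_mono) auto
    then show ?thesis by (simp add: h_def w_def flat_def dot_square_norm)
  qed (simp add: h_def)
  have U: "open U" using chart[OF c(1)] by simp
  have "smooth_map_on U (\<lambda>q. \<phi> q + (- \<phi> p))"
    by (intro smooth_map_on_add smooth_map_on_const smooth_map_on_chart c U)
  then have "smooth_map_on U (\<lambda>q. inner (\<phi> q - \<phi> p) (\<phi> q - \<phi> p))"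
    by (intro smooth_map_on_bilinear[OF bounded_bilinear_inner] U) auto
  then have "smooth_map_on U (\<lambda>q. (-1) * inner (\<phi> q - \<phi> p) (\<phi> q - \<phi> p))"
    by (intro smooth_map_on_bilinear[OF bounded_bilinear_mult] smooth_map_on_const U)
  then have "smooth_map_on U w" unfolding w_def
    by (intro smooth_map_on_add smooth_map_on_const U) simp
  then have "smooth_map_on U (\<lambda>q. flat 0 (w q))"
    by (rule smooth_map_on_real_compose[OF U open_UNIV _ smooth_on_flat]) simp
  then have hU: "smooth_map_on U h"
    by (rule smooth_map_on_cong[OF U, rotated]) (simp add: h_def)
  have hK: "smooth_map_on (- K) h"
    by (rule smooth_map_on_cong[of _ "\<lambda>_. 0"]) (use K h0 in \<open>auto intro: smooth_map_on_const\<close>)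
  have h: "smooth_map_on UNIV h"
  proof (rule smooth_map_on_open_cover[OF open_UNIV])
    fix q
    show "\<exists>N. open N \<and> q \<in> N \<and> smooth_map_on (UNIV \<inter> N) h"
    proof (cases "q \<in> U")
      case True
      then show ?thesis using U hU by auto
    next
      case False
      then show ?thesis using K KU hK by (intro exI[of _ "- K"]) auto
    qed
  qed
  have hp: "h p \<noteq> 0" using c(2) r(1) by (simp add: h_def w_def flat_def)
  show thesis
  proof
    \<comment> \<open>Division by h(p) = exp(-1/r^2) normalizes the value at \<open>p\<close> to
      1.\<close>
    show "(\<lambda>q. inverse (h p) * h q) \<in> smooth_functions"
      unfolding smooth_functions_def
      using smooth_map_on_bilinear[OF bounded_bilinear_mult open_UNIV smooth_map_on_const[OF open_UNIV] h]
      by simp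
  qed (use K KU h0 hp in auto)
qed

lemma smooth_functions_mult:
  "f \<in> smooth_functions \<Longrightarrow> h \<in> smooth_functions \<Longrightarrow> (\<lambda>q. f q * h q) \<in> smooth_functions"
  unfolding smooth_functions_def by (simp add: smooth_map_on_bilinear[OF bounded_bilinear_mult])

lemma subspace_smooth_functions: "subspace smooth_functions"
proof (rule subspaceI)
  show "0 \<in> smooth_functions"
    using smooth_map_on_const[OF open_UNIV, of 0] by (simp add: smooth_functions_def zero_fun_def)
  show "f + h \<in> smooth_functions" if "f \<in> smooth_functions" "h \<in> smooth_functions" for f h
    using smooth_map_on_add[OF open_UNIV] that by (simp add: smooth_functions_def plus_fun_def)
  show "r *\<^sub>R f \<in> smooth_functions" if "f \<in> smooth_functions" for r f
    using smooth_map_on_bilinear[OF bounded_bilinear_mult open_UNIV smooth_map_on_const[OF open_UNIV]] that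
    by (simp add: smooth_functions_def scaleR_fun_def)
qed

end

section \<open>Linearity on a subspace\<close>

lemma lin_on_add: "lin_on S f \<Longrightarrow> x \<in> S \<Longrightarrow> y \<in> S \<Longrightarrow> f (x + y) = f x + f y"
  unfolding lin_on_def by (metis scaleR_one)

lemma lin_on_scaleR: "lin_on S f \<Longrightarrow> x \<in> S \<Longrightarrow> f (a *\<^sub>R x) = a *\<^sub>R f x"
  unfolding lin_on_def by (metis scaleR_zero_left add.right_neutral)

lemma lin_on_0: "lin_on S f \<Longrightarrow> x \<in> S \<Longrightarrow> f 0 = 0"
  using lin_on_scaleR[of S f x 0] by simp

lemma lin_on_uminus: "lin_on S f \<Longrightarrow> x \<in> S \<Longrightarrow> f (- x) = - f x"
  using lin_on_scaleR[of S f x "-1"] by simp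

lemma lin_on_diff: "lin_on S f \<Longrightarrow> x \<in> S \<Longrightarrow> y \<in> S \<Longrightarrow> f (x - y) = f x - f y"
proof -
  assume "lin_on S f" "x \<in> S" "y \<in> S"
  then have "f (1 *\<^sub>R x + (-1) *\<^sub>R y) = 1 *\<^sub>R f x + (-1) *\<^sub>R f y" unfolding lin_on_def by blast
  then show ?thesis by simp
qed

lemma lin_onI:
  "(\<And>x y. x \<in> S \<Longrightarrow> y \<in> S \<Longrightarrow> f (x + y) = f x + f y) \<Longrightarrow> (\<And>a x. x \<in> S \<Longrightarrow> f (a *\<^sub>R x) = a *\<^sub>R f x)
    \<Longrightarrow> subspace S \<Longrightarrow> lin_on S f"
  unfolding lin_on_def by (simp add: subspace_scale)

section \<open>Sections of a vector bundle\<close>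

context vector_bundle
begin

lemma triv_at:
  obtains U \<Phi> where "(U, \<Phi>) \<in> trivs" "p \<in> U"
proof -
  have "p \<in> (\<Union>(U, \<Phi>)\<in>trivs. U)" unfolding triv_cover by (rule UNIV_I)
  then show thesis using that by auto
qed

lemma sections_scale:
  assumes "f \<in> smooth_functions" "s \<in> sections"
  shows "(\<lambda>q. f q *\<^sub>R s q) \<in> sections"
  unfolding sections_def
proof (clarify, intro conjI allI ballI, goal_cases)
  case (1 p)
  then show ?case using assms fibre_subspace by (auto simp: sections_def subspace_scale)
next
  case (2 t)
  obtain U \<Phi> where t: "t = (U, \<Phi>)" by fastforce
  have c: "(U, \<Phi>) \<in> trivs" using 2 t by simp
  have U: "open U" using triv[OF c] by simp
  have "smooth_map_on U (\<lambda>q. f q *\<^sub>R \<Phi> q (s q))"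
    using assms c U
    by (intro smooth_map_on_bilinear[OF bounded_bilinear_scaleR])
      (auto simp: sections_def smooth_functions_def intro: smooth_map_on_subset)
  then have "smooth_map_on U (\<lambda>q. \<Phi> q (f q *\<^sub>R s q))"
    by (rule smooth_map_on_cong[OF U, rotated])
      (use triv[OF c] assms in \<open>auto simp: sections_def lin_on_scaleR\<close>)
  then show ?case by (simp add: t)
qed

lemma sections_add:
  assumes "s \<in> sections" "t \<in> sections"
  shows "s + t \<in> sections"
  unfolding sections_def
proof (clarify, intro conjI allI ballI, goal_cases)
  case (1 p)
  then show ?case using assms fibre_subspace by (auto simp: sections_def subspace_add)
next
  case (2 z)
  obtain U \<Phi> where z: "z = (U, \<Phi>)" by fastforce
  have c: "(U, \<Phi>) \<in> trivs" using 2 z by simp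
  have U: "open U" using triv[OF c] by simp
  have "smooth_map_on U (\<lambda>q. \<Phi> q (s q) + \<Phi> q (t q))"
    using assms c U by (intro smooth_map_on_add) (auto simp: sections_def)
  then have "smooth_map_on U (\<lambda>q. \<Phi> q ((s + t) q))"
    by (rule smooth_map_on_cong[OF U, rotated])
      (use triv[OF c] assms in \<open>auto simp: sections_def lin_on_add\<close>)
  then show ?case by (simp add: z)
qed

text \<open>Take the local section whose coordinate in one trivialization is the constant
  \<open>w\<close>, and cut it off by a bump function. In another trivialization it is smooth on the
  overlap by \<open>triv_change\<close>, and it is zero off \<open>K\<close>.\<close>

lemma section_through:
  assumes "v \<in> E p"
  obtains s where "s \<in> sections" "s p = v"
proof -
  obtain U \<Phi> where c: "(U, \<Phi>) \<in> trivs" "p \<in> U" by (rule triv_at)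
  have U: "open U" using triv[OF c(1)] by simp
  have bij: "bij_betw (\<Phi> q) (E q) UNIV" if "q \<in> U" for q using triv[OF c(1)] that by simp
  obtain \<beta> K where \<beta>: "\<beta> \<in> smooth_functions" "\<beta> p = 1" "closed K" "K \<subseteq> U" "\<And>q. q \<notin> K \<Longrightarrow> \<beta> q = 0"
    using bump_function[OF U c(2)] by metis
  define w where "w = \<Phi> p v"
  define t where "t q = inv_into (E q) (\<Phi> q) w" for q
  define s where "s q = (if q \<in> U then \<beta> q *\<^sub>R t q else 0)" for q
  have tE: "t q \<in> E q" if "q \<in> U" for q
    unfolding t_def using bij[OF that] by (metis bij_betw_def UNIV_I inv_into_into)
  have sE: "s q \<in> E q" for q
    using tE fibre_subspace by (simp add: s_def subspace_scale subspace_0)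
  have s0: "s q = 0" if "q \<notin> K" for q using \<beta>(5)[OF that] by (simp add: s_def)
  have "smooth_map_on V (\<lambda>q. \<Psi> q (s q))" if c': "(V, \<Psi>) \<in> trivs" for V \<Psi>
  proof (rule smooth_map_on_open_cover)
    show V: "open V" using triv[OF c'] by simp
    have lin: "lin_on (E q) (\<Psi> q)" if "q \<in> V" for q using triv[OF c'] that by simp
    fix q assume "q \<in> V"
    show "\<exists>N. open N \<and> q \<in> N \<and> smooth_map_on (V \<inter> N) (\<lambda>q. \<Psi> q (s q))"
    proof (cases "q \<in> U")
      case True
      have O: "open (V \<inter> U)" using U V by auto
      have "smooth_map_on (V \<inter> U) (\<lambda>q. \<Psi> q (t q))"
        using triv_change[OF c(1) c', of w] by (simp add: t_def Int_commute)
      then have "smooth_map_on (V \<inter> U) (\<lambda>q. \<beta> q *\<^sub>R \<Psi> q (t q))"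
        using \<beta>(1) by (intro smooth_map_on_bilinear[OF bounded_bilinear_scaleR O])
          (auto simp: smooth_functions_def intro: smooth_map_on_subset)
      then have "smooth_map_on (V \<inter> U) (\<lambda>q. \<Psi> q (s q))"
        by (rule smooth_map_on_cong[OF O, rotated]) (auto simp: s_def lin_on_scaleR[OF lin tE])
      then show ?thesis using True U by blast
    next
      case False
      have O: "open (V \<inter> - K)" using \<beta>(3) V by auto
      have "smooth_map_on (V \<inter> - K) (\<lambda>q. \<Psi> q (s q))"
        by (rule smooth_map_on_cong[OF O _ smooth_map_on_const[OF O, of 0]])
          (auto simp: s0 lin_on_0[OF lin sE])
      then show ?thesis using False \<beta>(3,4) by (intro exI[of _ "- K"]) auto
    qed
  qed
  then have "s \<in> sections" using sE by (auto simp: sections_def)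
  moreover have "s p = v"
    using c \<beta>(2) bij[OF c(2)] assms
    by (simp add: s_def t_def w_def bij_betw_def inv_into_f_f)
  ultimately show thesis using that by blast
qed

lemma subspace_sections: "subspace sections"
proof (rule subspaceI)
  show scale: "r *\<^sub>R s \<in> sections" if "s \<in> sections" for r s
    using sections_scale[OF _ that, of "\<lambda>_. r"] smooth_map_on_const[OF open_UNIV, of r]
    by (simp add: smooth_functions_def scaleR_fun_def)
  \<comment> \<open>Types are inhabited, so there is a point and hence some section; the zero
    section is 0 times that one.\<close>
  obtain p :: 'm where True by simp
  obtain s where "s \<in> sections" using section_through[of 0 p] fibre_subspace subspace_0 by metis
  from scale[OF this, of 0] show "0 \<in> sections" by simp
qed (rule sections_add)

end

section \<open>The gradient of a function\<close>

context courant_data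
begin

lemma section_fibre [simp]: "s \<in> sections \<Longrightarrow> s p \<in> E p"
  by (auto simp: sections_def)

lemma fibre_closed [simp]:
  "v \<in> E p \<Longrightarrow> w \<in> E p \<Longrightarrow> v + w \<in> E p"
  "v \<in> E p \<Longrightarrow> w \<in> E p \<Longrightarrow> v - w \<in> E p"
  "v \<in> E p \<Longrightarrow> - v \<in> E p"
  "v \<in> E p \<Longrightarrow> a *\<^sub>R v \<in> E p"
  "0 \<in> E p"
  using fibre_subspace[of p] subspace_add subspace_diff subspace_neg subspace_scale subspace_0 by blast+

lemma sections_closed [simp]:
  "s \<in> sections \<Longrightarrow> t \<in> sections \<Longrightarrow> s + t \<in> sections"
  "s \<in> sections \<Longrightarrow> t \<in> sections \<Longrightarrow> s - t \<in> sections"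
  "s \<in> sections \<Longrightarrow> - s \<in> sections"
  "s \<in> sections \<Longrightarrow> a *\<^sub>R s \<in> sections"
  "0 \<in> sections"
  using subspace_sections subspace_add subspace_diff subspace_neg subspace_scale subspace_0 by blast+

lemma smooth_functions_closed [simp]:
  "f \<in> smooth_functions \<Longrightarrow> h \<in> smooth_functions \<Longrightarrow> f + h \<in> smooth_functions"
  "f \<in> smooth_functions \<Longrightarrow> h \<in> smooth_functions \<Longrightarrow> f - h \<in> smooth_functions"
  "f \<in> smooth_functions \<Longrightarrow> - f \<in> smooth_functions"
  "f \<in> smooth_functions \<Longrightarrow> a *\<^sub>R f \<in> smooth_functions"
  "0 \<in> smooth_functions"
  using subspace_smooth_functions subspace_add subspace_diff subspace_neg subspace_scale subspace_0 by blast+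

lemma form_add_right: "v \<in> E p \<Longrightarrow> w \<in> E p \<Longrightarrow> u \<in> E p \<Longrightarrow> g p v (w + u) = g p v w + g p v u"
  using lin_on_add[OF form_linear] by blast

lemma form_scale_right: "v \<in> E p \<Longrightarrow> w \<in> E p \<Longrightarrow> g p v (a *\<^sub>R w) = a * g p v w"
  using lin_on_scaleR[OF form_linear] by fastforce

lemma form_diff_right: "v \<in> E p \<Longrightarrow> w \<in> E p \<Longrightarrow> u \<in> E p \<Longrightarrow> g p v (w - u) = g p v w - g p v u"
  using lin_on_diff[OF form_linear] by blast

lemma form_minus_right: "v \<in> E p \<Longrightarrow> w \<in> E p \<Longrightarrow> g p v (- w) = - g p v w"
  using lin_on_uminus[OF form_linear] by blast

lemma form_zero_right: "v \<in> E p \<Longrightarrow> g p v 0 = 0"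
  using lin_on_0[OF form_linear] by blast

lemma form_add_left: "v \<in> E p \<Longrightarrow> w \<in> E p \<Longrightarrow> u \<in> E p \<Longrightarrow> g p (w + u) v = g p w v + g p u v"
  using form_add_right[of v p w u] by (simp add: form_sym[of v])

lemma form_scale_left: "v \<in> E p \<Longrightarrow> w \<in> E p \<Longrightarrow> g p (a *\<^sub>R w) v = a * g p w v"
  using form_scale_right[of v p w a] by (simp add: form_sym[of v])

lemma form_diff_left: "v \<in> E p \<Longrightarrow> w \<in> E p \<Longrightarrow> u \<in> E p \<Longrightarrow> g p (w - u) v = g p w v - g p u v"
  using form_diff_right[of v p w u] by (simp add: form_sym[of v])

lemma form_minus_left: "v \<in> E p \<Longrightarrow> w \<in> E p \<Longrightarrow> g p (- w) v = - g p w v"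
  using form_minus_right[of v p w] by (simp add: form_sym[of v])

lemma form_zero_left: "v \<in> E p \<Longrightarrow> g p 0 v = 0"
  using form_zero_right[of v p] by (simp add: form_sym[of v])

lemmas form_simps = form_add_right form_scale_right form_diff_right form_minus_right form_zero_right
  form_add_left form_scale_left form_diff_left form_minus_left form_zero_left

lemma pair_apply: "pair s t p = g p (s p) (t p)"
  by (simp add: pair_def)

lemma pair_smooth [simp]: "s \<in> sections \<Longrightarrow> t \<in> sections \<Longrightarrow> pair s t \<in> smooth_functions"
  unfolding pair_def by (rule form_smooth)

lemma act_smooth [simp]: "s \<in> sections \<Longrightarrow> f \<in> smooth_functions \<Longrightarrow> act s f \<in> smooth_functions"
  using anchor_smooth[of s] by (auto simp: vector_fields_def act_def anchor_def)

lemma pair_commute: "s \<in> sections \<Longrightarrow> t \<in> sections \<Longrightarrow> pair s t = pair t s"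
  by (auto simp: pair_def form_sym)

lemma pair_simps [simp]:
  "s \<in> sections \<Longrightarrow> t \<in> sections \<Longrightarrow> u \<in> sections \<Longrightarrow> pair s (t + u) = pair s t + pair s u"
  "s \<in> sections \<Longrightarrow> t \<in> sections \<Longrightarrow> u \<in> sections \<Longrightarrow> pair (s + t) u = pair s u + pair t u"
  "s \<in> sections \<Longrightarrow> t \<in> sections \<Longrightarrow> u \<in> sections \<Longrightarrow> pair s (t - u) = pair s t - pair s u"
  "s \<in> sections \<Longrightarrow> t \<in> sections \<Longrightarrow> u \<in> sections \<Longrightarrow> pair (s - t) u = pair s u - pair t u"
  "s \<in> sections \<Longrightarrow> t \<in> sections \<Longrightarrow> pair s (- t) = - pair s t"
  "s \<in> sections \<Longrightarrow> t \<in> sections \<Longrightarrow> pair (- s) t = - pair s t"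
  "s \<in> sections \<Longrightarrow> t \<in> sections \<Longrightarrow> pair s (a *\<^sub>R t) = a *\<^sub>R pair s t"
  "s \<in> sections \<Longrightarrow> t \<in> sections \<Longrightarrow> pair (a *\<^sub>R s) t = a *\<^sub>R pair s t"
  "s \<in> sections \<Longrightarrow> pair s 0 = 0"
  "s \<in> sections \<Longrightarrow> pair 0 s = 0"
  by (auto simp: pair_def fun_eq_iff form_simps scaleR_fun_def)

lemma anchor_zero: "\<rho> p 0 = 0"
  using lin_on_0[OF anchor_linear fibre_closed(5)] .

lemma act_simps [simp]:
  "s \<in> sections \<Longrightarrow> f \<in> smooth_functions \<Longrightarrow> h \<in> smooth_functions \<Longrightarrow> act s (f + h) = act s f + act s h"
  "s \<in> sections \<Longrightarrow> f \<in> smooth_functions \<Longrightarrow> h \<in> smooth_functions \<Longrightarrow> act s (f - h) = act s f - act s h"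
  "s \<in> sections \<Longrightarrow> f \<in> smooth_functions \<Longrightarrow> act s (- f) = - act s f"
  "s \<in> sections \<Longrightarrow> f \<in> smooth_functions \<Longrightarrow> act s (a *\<^sub>R f) = a *\<^sub>R act s f"
  "s \<in> sections \<Longrightarrow> act s 0 = 0"
proof -
  have lin: "lin_on smooth_functions (anchor s p)" if "s \<in> sections" for p
    using anchor_fibre[of "s p" p] that by (auto simp: tangent_space_def anchor_def)
  show "s \<in> sections \<Longrightarrow> f \<in> smooth_functions \<Longrightarrow> h \<in> smooth_functions \<Longrightarrow> act s (f + h) = act s f + act s h"
    "s \<in> sections \<Longrightarrow> f \<in> smooth_functions \<Longrightarrow> h \<in> smooth_functions \<Longrightarrow> act s (f - h) = act s f - act s h"
    "s \<in> sections \<Longrightarrow> f \<in> smooth_functions \<Longrightarrow> act s (- f) = - act s f"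
    "s \<in> sections \<Longrightarrow> f \<in> smooth_functions \<Longrightarrow> act s (a *\<^sub>R f) = a *\<^sub>R act s f"
    "s \<in> sections \<Longrightarrow> act s 0 = 0"
    using lin_on_add[OF lin] lin_on_diff[OF lin] lin_on_uminus[OF lin] lin_on_scaleR[OF lin]
      lin_on_0[OF lin smooth_functions_closed(5)]
    by (auto simp: act_def fun_eq_iff scaleR_fun_def)
qed

lemma act_mult:
  assumes "s \<in> sections" "f \<in> smooth_functions" "h \<in> smooth_functions"
  shows "act s (\<lambda>q. f q * h q) p = act s f p * h p + f p * act s h p"
  using anchor_fibre[of "s p" p] assms by (auto simp: tangent_space_def act_def anchor_def)

lemma act_scale:
  assumes "s \<in> sections"
  shows "act (\<lambda>q. f q *\<^sub>R s q) h p = f p * act s h p"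
  using lin_on_scaleR[OF anchor_linear, of "s p" p "f p"] assms by (auto simp: act_def anchor_def scaleR_fun_def)

lemma section_eqI:
  assumes "s \<in> sections" "t \<in> sections" "\<And>e. e \<in> sections \<Longrightarrow> pair s e = pair t e"
  shows "s = t"
proof
  fix p
  have "s p - t p = 0"
  proof (rule form_nondegenerate)
    show "s p - t p \<in> E p" using assms by simp
    fix w assume w: "w \<in> E p"
    then obtain e where e: "e \<in> sections" "e p = w" by (rule section_through)
    from fun_cong[OF assms(3)[OF e(1)], of p] e w assms
    show "g p (s p - t p) w = 0" by (simp add: pair_def form_simps)
  qed
  then show "s p = t p" by simp
qed

lemma \<D>_eqI:
  assumes "s \<in> sections" "\<And>e. e \<in> sections \<Longrightarrow> pair s e = (1/2) *\<^sub>R act e f"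
  shows "\<D> f = s"
  unfolding \<D>_def
proof (rule the_equality)
  show "t = s" if "t \<in> sections \<and> (\<forall>e\<in>sections. pair t e = (1/2) *\<^sub>R act e f)" for t
    by (rule section_eqI) (use that assms in auto)
qed (use assms in auto)

lemma nonzero_pairing:
  assumes "v \<in> E p" "v \<noteq> 0"
  obtains e where "e \<in> sections" "g p v (e p) \<noteq> 0"
proof -
  obtain w where w: "w \<in> E p" "g p v w \<noteq> 0" using form_nondegenerate assms by blast
  then show thesis using section_through[OF w(1)] that by metis
qed

text \<open>All fibres are in bijection with the one model space \<open>'f\<close>, so a single zero
  fibre makes the whole bundle zero. The case split on rank zero can therefore be made
  globally.\<close>

lemma trivial_fibres:
  assumes "E p = {0}"
  shows "E q = {0}"
proof -
  obtain U \<Phi> where U: "(U, \<Phi>) \<in> trivs" "p \<in> U" by (rule triv_at)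
  obtain V \<Psi> where V: "(V, \<Psi>) \<in> trivs" "q \<in> V" by (rule triv_at)
  have "bij_betw (\<Phi> p) (E p) UNIV" using triv[OF U(1)] U(2) by blast
  then have univ: "(UNIV :: 'f set) = {\<Phi> p 0}" using assms by (simp add: bij_betw_def)
  have "bij_betw (\<Psi> q) (E q) UNIV" using triv[OF V(1)] V(2) by blast
  then have inj: "inj_on (\<Psi> q) (E q)" by (simp add: bij_betw_def)
  have "v = 0" if "v \<in> E q" for v
  proof -
    have "\<Psi> q v = \<Psi> q 0" using univ by (metis UNIV_I singletonD)
    then show ?thesis using inj that by (simp add: inj_on_def)
  qed
  then show ?thesis using fibre_closed(5)[of q] by blast
qed

end

section \<open>The axioms force \<open>\<D> f\<close> to be the gradient\<close>

context courant_algebroid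
begin

lemma br_section [simp]: "e1 \<in> sections \<Longrightarrow> e2 \<in> sections \<Longrightarrow> br e1 e2 \<in> sections"
  by (rule br_closed)

text \<open>Smoothness is local, so near each point it is enough to write \<open>\<D> f\<close> as a
  smooth function times a section. The pair \<open>e1\<close>, \<open>e2\<close> has to depend on
  the point, since \<open>pair e1 e2\<close> may vanish elsewhere.\<close>

lemma \<D>_section_aux:
  assumes nz: "\<And>p. E p \<noteq> {0}" and f: "f \<in> smooth_functions"
  shows "\<D> f \<in> sections"
proof -
  have *: "\<exists>N u S. open N \<and> p \<in> N \<and> smooth_map_on N u \<and> S \<in> sections \<and> (\<forall>q\<in>N. \<D> f q = u q *\<^sub>R S q)" for p
  proof -
    obtain v where v: "v \<in> E p" "v \<noteq> 0" using nz[of p] fibre_closed(5)[of p] by blast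
    obtain e1 where e1: "e1 \<in> sections" "e1 p = v" using section_through[OF v(1)] by blast
    obtain e2 where e2: "e2 \<in> sections" "g p v (e2 p) \<noteq> 0" using nonzero_pairing[OF v] by blast
    define w where "w = pair e1 e2"
    have w: "w \<in> smooth_functions" using e1 e2 by (simp add: w_def)
    \<comment> \<open>This is the Leibniz rule solved for the term that contains
      \<open>\<D> f\<close>; all its other terms are visibly sections.\<close>
    define S where "S = (\<lambda>q. f q *\<^sub>R br e1 e2 q) + (\<lambda>q. act e1 f q *\<^sub>R e2 q) - br e1 (\<lambda>q. f q *\<^sub>R e2 q)"
    have S: "S \<in> sections"
      unfolding S_def using e1 e2 f by (simp add: sections_scale)
    have SD: "S q = w q *\<^sub>R \<D> f q" for q
      using leibniz[OF e1(1) e2(1) f] by (simp add: S_def w_def)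
    define N where "N = w -` (- {0})"
    have N: "open N" unfolding N_def
      using smooth_functions_continuous[OF w] by (intro open_vimage) auto
    have wN: "smooth_map_on N w" using w smooth_map_on_subset[of UNIV w N] by (simp add: smooth_functions_def)
    have "smooth_map_on N (\<lambda>q. inverse (w q))"
      by (rule smooth_map_on_real_compose[OF N _ wN smooth_on_inverse]) (auto simp: N_def)
    moreover have "p \<in> N" using e1 e2 by (simp add: N_def w_def pair_def)
    moreover have "\<forall>q\<in>N. \<D> f q = inverse (w q) *\<^sub>R S q" by (simp add: SD N_def)
    ultimately show ?thesis using N S by (intro exI[of _ N] exI[of _ "\<lambda>q. inverse (w q)"] exI[of _ S]) simp
  qed
  have fib: "\<D> f p \<in> E p" for p
  proof -
    obtain N u S where "S \<in> sections" "p \<in> N" "\<forall>q\<in>N. \<D> f q = u q *\<^sub>R S q"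
      using *[of p] by (elim exE conjE) (rule that)
    then show ?thesis by simp
  qed
  have "smooth_map_on U (\<lambda>q. \<Phi> q (\<D> f q))" if c: "(U, \<Phi>) \<in> trivs" for U \<Phi>
  proof (rule smooth_map_on_open_cover)
    show U: "open U" using triv[OF c] by simp
    have lin: "lin_on (E q) (\<Phi> q)" if "q \<in> U" for q using triv[OF c] that by simp
    fix p assume "p \<in> U"
    obtain N u S where N: "open N" "p \<in> N" "smooth_map_on N u" "S \<in> sections"
      "\<forall>q\<in>N. \<D> f q = u q *\<^sub>R S q" using *[of p] by (elim exE conjE) (rule that)
    have O: "open (U \<inter> N)" using U N(1) by auto
    have "smooth_map_on U (\<lambda>q. \<Phi> q (S q))"
      using N(4) c by (auto simp: sections_def simp del: section_fibre)
    then have "smooth_map_on (U \<inter> N) (\<lambda>q. u q *\<^sub>R \<Phi> q (S q))"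
      by (intro smooth_map_on_bilinear[OF bounded_bilinear_scaleR O])
        (auto intro: smooth_map_on_subset[OF N(3)] smooth_map_on_subset)
    then have "smooth_map_on (U \<inter> N) (\<lambda>q. \<Phi> q (\<D> f q))"
      by (rule smooth_map_on_cong[OF O, rotated])
        (use N(4,5) in \<open>auto simp: lin_on_scaleR[OF lin]\<close>)
    then show "\<exists>N. open N \<and> p \<in> N \<and> smooth_map_on (U \<inter> N) (\<lambda>q. \<Phi> q (\<D> f q))"
      using N(1,2) by (intro exI[of _ N]) simp
  qed
  then show ?thesis using fib by (auto simp: sections_def simp del: section_fibre)
qed

text \<open>Put fh for h in axiom 5 and subtract f times the original. The term
  (\<rho>(e)f)\<langle>h,k\<rangle> from differentiating the pairing cancels against the same term
  of the Leibniz rule, and the pairings with k of the two sides are left. This gives the product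
  rule for f and a function of the form \<langle>e,h\<rangle>, the case needed next.\<close>

lemma \<D>_derivation_aux:
  assumes sec: "\<And>f. f \<in> smooth_functions \<Longrightarrow> \<D> f \<in> sections"
    and f: "f \<in> smooth_functions" and e: "e \<in> sections" and h: "h \<in> sections"
  shows "\<D> (\<lambda>q. f q * pair e h q) = (\<lambda>q. f q *\<^sub>R \<D> (pair e h) q) + (\<lambda>q. pair e h q *\<^sub>R \<D> f q)"
proof (rule section_eqI)
  have fu: "(\<lambda>q. f q * pair e h q) \<in> smooth_functions" using f e h by (simp add: smooth_functions_mult)
  then show "\<D> (\<lambda>q. f q * pair e h q) \<in> sections" by (rule sec)
  show "(\<lambda>q. f q *\<^sub>R \<D> (pair e h) q) + (\<lambda>q. pair e h q *\<^sub>R \<D> f q) \<in> sections"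
    using f e h by (simp add: sections_scale sec)
  fix k assume k: "k \<in> sections"
  have fh: "(\<lambda>q. f q *\<^sub>R h q) \<in> sections" using f h by (simp add: sections_scale)
  have p1: "pair e (\<lambda>q. f q *\<^sub>R h q) = (\<lambda>q. f q * pair e h q)"
    using e h by (simp add: pair_def form_simps)
  have p2: "pair (\<lambda>q. f q *\<^sub>R h q) k = (\<lambda>q. f q * pair h k q)"
    using k h by (simp add: pair_def form_simps)
  show "pair (\<D> (\<lambda>q. f q * pair e h q)) k
      = pair ((\<lambda>q. f q *\<^sub>R \<D> (pair e h) q) + (\<lambda>q. pair e h q *\<^sub>R \<D> f q)) k"
  proof
    fix p
    have mem: "\<D> (\<lambda>q. f q * pair e h q) p \<in> E p" "\<D> f p \<in> E p" "\<D> (pair e h) p \<in> E p"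
      "\<D> (pair e k) p \<in> E p" "br e h p \<in> E p" "br e k p \<in> E p" "h p \<in> E p" "k p \<in> E p"
      using sec fu f e h k by auto
    from fun_cong[OF form_invariant[OF e fh k], of p] fun_cong[OF form_invariant[OF e h k], of p] mem
    show "pair (\<D> (\<lambda>q. f q * pair e h q)) k p
      = pair ((\<lambda>q. f q *\<^sub>R \<D> (pair e h) q) + (\<lambda>q. pair e h q *\<^sub>R \<D> f q)) k p"
      using f e h k unfolding p1 p2 leibniz[OF e h f]
      by (simp add: act_mult) (simp add: pair_apply form_simps algebra_simps)
  qed
qed

text \<open>Put fe for e in the formula for \<rho>(e)\<langle>h,h\<rangle> and subtract f times the
  original. The term \<langle>e,h\<rangle>\<langle>\<D>f,h\<rangle> arises from [fe,h] and again
  from \<D>(f\<langle>e,h\<rangle>), while (\<rho>(h)f)\<langle>e,h\<rangle> arises only from the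
  bracket. Both slots of the pairing hold h, which doubles everything: hence 4 against 2. Then
  \<langle>e,h\<rangle>, nonzero at \<open>p\<close>, is cancelled.\<close>

lemma pair_\<D>_aux:
  assumes sec: "\<And>f. f \<in> smooth_functions \<Longrightarrow> \<D> f \<in> sections"
    and f: "f \<in> smooth_functions" and h: "h \<in> sections"
  shows "pair (\<D> f) h = (1/2) *\<^sub>R act h f"
proof
  fix p
  show "pair (\<D> f) h p = ((1/2) *\<^sub>R act h f) p"
  proof (cases "h p = 0")
    case True
    then show ?thesis using sec[OF f] by (simp add: pair_def act_def anchor_def anchor_zero form_simps scaleR_fun_def)
  next
    case False
    obtain e where e: "e \<in> sections" "g p (h p) (e p) \<noteq> 0"
      using nonzero_pairing[of "h p" p] h False by auto
    have fe: "(\<lambda>q. f q *\<^sub>R e q) \<in> sections" using f e by (simp add: sections_scale)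
    have p1: "pair (\<lambda>q. f q *\<^sub>R e q) h = (\<lambda>q. f q * pair e h q)"
      using e h by (simp add: pair_def form_simps)
    \<comment> \<open>The Leibniz rule multiplies the second argument by f, so the bracket is
      reversed first.\<close>
    have b: "br (\<lambda>q. f q *\<^sub>R e q) h
        = (\<lambda>p. - (f p *\<^sub>R br h e p + act h f p *\<^sub>R e p - pair h e p *\<^sub>R \<D> f p))"
      using br_skew[OF fe h] leibniz[OF h e(1) f] by (simp add: fun_eq_iff)
    have mem: "\<D> f p \<in> E p" "\<D> (pair e h) p \<in> E p" "br e h p \<in> E p" "h p \<in> E p" "e p \<in> E p" "br h e p \<in> E p"
      using sec f e h by auto
    have s: "g p (e p) (h p) = g p (h p) (e p)" "g p (h p) (\<D> f p) = g p (\<D> f p) (h p)"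
      "g p (h p) (\<D> (pair e h) p) = g p (\<D> (pair e h) p) (h p)"
      "g p (h p) (br h e p) = g p (br h e p) (h p)"
      using mem form_sym by auto
    have eh: "br e h p = - br h e p" using br_skew[OF e(1) h] by simp
    have der: "\<D> (\<lambda>q. f q * pair e h q) = (\<lambda>q. f q *\<^sub>R \<D> (pair e h) q) + (\<lambda>q. pair e h q *\<^sub>R \<D> f q)"
      using sec f e(1) h by (rule \<D>_derivation_aux)
    from fun_cong[OF form_invariant[OF fe h h], of p] fun_cong[OF form_invariant[OF e(1) h h], of p]
    have "4 * (g p (h p) (e p) * g p (\<D> f p) (h p)) = 2 * (g p (h p) (e p) * act h f p)"
      unfolding p1 b der
      using mem e(1) h by (simp add: act_scale) (auto simp: pair_apply form_simps s eh algebra_simps)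
    then have "g p (h p) (e p) * (2 * g p (\<D> f p) (h p) - act h f p) = 0" by (simp add: algebra_simps)
    then show ?thesis using e(2) by (simp add: pair_def scaleR_fun_def)
  qed
qed

lemma \<D>_section_and_pair:
  assumes f: "f \<in> smooth_functions"
  shows "\<D> f \<in> sections \<and> (\<forall>e\<in>sections. pair (\<D> f) e = (1/2) *\<^sub>R act e f)"
proof (cases "\<exists>p. E p = {0}")
  case True
  then have "E p = {0}" for p using trivial_fibres by blast
  then have "e p = 0" if "e \<in> sections" for e p using section_fibre[OF that, of p] by simp
  note sec0 = this
  have act0: "act e f = 0" if "e \<in> sections" for e
    by (simp add: act_def anchor_def fun_eq_iff sec0[OF that] anchor_zero)
  \<comment> \<open>In rank zero the zero section satisfies the defining equation, because the
    anchor kills the zero vector.\<close>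
  have "\<D> f = 0" by (rule \<D>_eqI) (simp_all add: act0)
  then show ?thesis by (simp add: act0)
next
  case False
  have nz: "E p \<noteq> {0}" for p using False by auto
  have sec: "\<D> h \<in> sections" if "h \<in> smooth_functions" for h using nz that by (rule \<D>_section_aux)
  have "pair (\<D> f) e = (1/2) *\<^sub>R act e f" if "e \<in> sections" for e
    using sec f that by (rule pair_\<D>_aux)
  then show ?thesis using sec f by blast
qed

lemma \<D>_section [simp]: "f \<in> smooth_functions \<Longrightarrow> \<D> f \<in> sections"
  and pair_\<D>_left: "f \<in> smooth_functions \<Longrightarrow> e \<in> sections \<Longrightarrow> pair (\<D> f) e = (1/2) *\<^sub>R act e f"
  using \<D>_section_and_pair by blast+

lemma pair_\<D>_right: "f \<in> smooth_functions \<Longrightarrow> e \<in> sections \<Longrightarrow> pair e (\<D> f) = (1/2) *\<^sub>R act e f"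
  using pair_\<D>_left pair_commute by simp

end

section \<open>Identities of Courant algebroids\<close>

lemma scaleR_fun_apply: "(a *\<^sub>R f) x = a *\<^sub>R f x"
  by (simp add: scaleR_fun_def)

context courant_algebroid
begin

lemma act_br:
  "e1 \<in> sections \<Longrightarrow> e2 \<in> sections \<Longrightarrow> act (br e1 e2) f = act e1 (act e2 f) - act e2 (act e1 f)"
  by (simp add: act_def anchor_br lie_bracket_def fun_eq_iff)

lemma act_\<D> [simp]: "f \<in> smooth_functions \<Longrightarrow> act (\<D> f) h = 0"
  by (simp add: act_def anchor_\<D> fun_eq_iff)

lemma \<D>_simps [simp]:
  "f \<in> smooth_functions \<Longrightarrow> h \<in> smooth_functions \<Longrightarrow> \<D> (f + h) = \<D> f + \<D> h"
  "f \<in> smooth_functions \<Longrightarrow> \<D> (a *\<^sub>R f) = a *\<^sub>R \<D> f"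
  "f \<in> smooth_functions \<Longrightarrow> \<D> (- f) = - \<D> f"
  "\<D> 0 = 0"
  by (rule \<D>_eqI; simp add: pair_\<D>_left algebra_simps)+

lemma br_simps [simp]:
  "e \<in> sections \<Longrightarrow> s \<in> sections \<Longrightarrow> t \<in> sections \<Longrightarrow> br e (s + t) = br e s + br e t"
  "e \<in> sections \<Longrightarrow> s \<in> sections \<Longrightarrow> br e (a *\<^sub>R s) = a *\<^sub>R br e s"
  "e \<in> sections \<Longrightarrow> s \<in> sections \<Longrightarrow> br e (- s) = - br e s"
  "e \<in> sections \<Longrightarrow> br e 0 = 0"
  using lin_on_add[OF br_linear] lin_on_scaleR[OF br_linear] lin_on_uminus[OF br_linear]
    lin_on_0[OF br_linear sections_closed(5)] by blast+

lemma br_simps_left [simp]: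
  "e \<in> sections \<Longrightarrow> s \<in> sections \<Longrightarrow> t \<in> sections \<Longrightarrow> br (s + t) e = br s e + br t e"
  "e \<in> sections \<Longrightarrow> s \<in> sections \<Longrightarrow> br (a *\<^sub>R s) e = a *\<^sub>R br s e"
  "e \<in> sections \<Longrightarrow> s \<in> sections \<Longrightarrow> br (- s) e = - br s e"
  "e \<in> sections \<Longrightarrow> br 0 e = 0"
  using br_skew[of _ e] by simp_all

text \<open>Apply axiom 5 to \<rho>(e)\<langle>\<D>f,h\<rangle>, where
  \<langle>\<D>f,\<D>\<langle>e,h\<rangle>\<rangle> = 0. Both sides then pair with h to
  \<rho>(h)\<rho>(e)f / 4.\<close>

lemma br_\<D>:
  assumes "f \<in> smooth_functions" "e \<in> sections"
  shows "br e (\<D> f) = \<D> (pair e (\<D> f))"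
proof (rule section_eqI)
  fix h assume h: "h \<in> sections"
  have "act e (pair (\<D> f) h)
      = pair (br e (\<D> f) + \<D> (pair e (\<D> f))) h + pair (\<D> f) (br e h + \<D> (pair e h))"
    using assms h by (intro form_invariant) auto
  then show "pair (br e (\<D> f)) h = pair (\<D> (pair e (\<D> f))) h"
    using assms h by (simp add: pair_\<D>_left pair_\<D>_right act_br fun_eq_iff scaleR_fun_apply algebra_simps)
qed (use assms in auto)

section \<open>The function \<open>T\<close> and its cocycle identity\<close>

lemma T_smooth [simp]:
  "e1 \<in> sections \<Longrightarrow> e2 \<in> sections \<Longrightarrow> e3 \<in> sections \<Longrightarrow> T e1 e2 e3 \<in> smooth_functions"
  by (simp add: T_def)

lemma T_cyclic: "T e1 e2 e3 = T e2 e3 e1"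
  by (simp add: T_def algebra_simps)

lemma T_skew12:
  assumes "e1 \<in> sections" "e2 \<in> sections" "e3 \<in> sections"
  shows "T e2 e1 e3 = - T e1 e2 e3"
  using assms br_skew[of e2 e1] br_skew[of e3 e1] br_skew[of e3 e2]
  by (simp add: T_def algebra_simps)

lemma T_skew23:
  assumes "e1 \<in> sections" "e2 \<in> sections" "e3 \<in> sections"
  shows "T e1 e3 e2 = - T e1 e2 e3"
  using T_skew12[of e2 e3 e1] T_cyclic assms by metis

lemma T_zero [simp]:
  "e2 \<in> sections \<Longrightarrow> e3 \<in> sections \<Longrightarrow> T 0 e2 e3 = 0"
  "e1 \<in> sections \<Longrightarrow> e3 \<in> sections \<Longrightarrow> T e1 0 e3 = 0"
  "e1 \<in> sections \<Longrightarrow> e2 \<in> sections \<Longrightarrow> T e1 e2 0 = 0"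
  by (simp_all add: T_def)

text \<open>By \<open>br_\<D>\<close> the two brackets with \<D>f together contribute
  \<rho>([e1,e2])f / 4, and \<langle>[e1,e2],\<D>f\<rangle> contributes \<rho>([e1,e2])f / 2. One
  third of 3/4 is 1/4.\<close>

lemma T_\<D>:
  assumes "f \<in> smooth_functions" "e1 \<in> sections" "e2 \<in> sections"
  shows "T (\<D> f) e1 e2 = (1/4) *\<^sub>R act (br e1 e2) f"
  using assms br_skew[of "\<D> f" e1] br_\<D>[of f e1] br_\<D>[of f e2]
  by (simp add: T_def pair_\<D>_left pair_\<D>_right act_br) (simp add: fun_eq_iff scaleR_fun_apply algebra_simps)

text \<open>Axiom 5 with [a,b] in one slot, its gradients turned into half derivatives. The cocycle
  identity uses it twice, with c and e exchanged.\<close>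

lemma invariance_br:
  assumes "a \<in> sections" "b \<in> sections" "c \<in> sections" "e \<in> sections"
  shows "act e (pair (br a b) c) p = - pair (br (br a b) e) c p + 1/2 * act c (pair (br a b) e) p
    + pair (br a b) (br e c) p + 1/2 * act (br a b) (pair e c) p"
proof -
  have "act e (pair (br a b) c)
      = pair (br e (br a b) + \<D> (pair e (br a b))) c + pair (br a b) (br e c + \<D> (pair e c))"
    using assms by (intro form_invariant) auto
  from fun_cong[OF this, of p] show ?thesis
    using assms pair_commute[of e "br a b"] br_skew[of e "br a b"]
    by (simp add: pair_\<D>_left pair_\<D>_right scaleR_fun_apply)
qed

text \<open>The constant 1/6 is the 1/2 of the gradient times the 1/3 in \<open>T\<close>. The
  bracket [c,a] is replaced by -[a,c] so that, for increasing indices, every bracket occurs in one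
  order only and linear arithmetic can treat the pairings as atoms.\<close>

lemma jacobi_pair:
  assumes "a \<in> sections" "b \<in> sections" "c \<in> sections" "e \<in> sections"
  shows "pair (br (br a b) c) e p + pair (br (br b c) a) e p - pair (br (br a c) b) e p
    = 1/6 * (act e (pair (br a b) c) p + act e (pair (br b c) a) p - act e (pair (br a c) b) p)"
proof -
  have "pair (jacobiator a b c) e = (1/2) *\<^sub>R act e (T a b c)"
    using assms by (simp add: jacobi pair_\<D>_left)
  from fun_cong[OF this, of p] show ?thesis
    using assms br_skew[of c a] by (simp add: jacobiator_def T_def scaleR_fun_apply)
qed

lemma T_br_expand:
  assumes "a \<in> sections" "b \<in> sections" "c \<in> sections" "e \<in> sections"
  shows "T (br a b) c e p = 1/3 * (pair (br (br a b) c) e p + pair (br a b) (br c e) p - pair (br (br a b) e) c p)"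
  using assms br_skew[of e "br a b"] pair_commute[of "br c e" "br a b"]
  by (simp add: T_def scaleR_fun_apply)

lemma act_T_expand:
  assumes "a \<in> sections" "b \<in> sections" "c \<in> sections" "e \<in> sections"
  shows "act e (T a b c) p
    = 1/3 * (act e (pair (br a b) c) p + act e (pair (br b c) a) p - act e (pair (br a c) b) p)"
  using assms br_skew[of c a] by (simp add: T_def scaleR_fun_apply)

text \<open>Let P, Q and A be the alternating sums, with the signs of this statement, of the terms
  \<langle>[[a,b],c],k\<rangle>, \<langle>[a,b],[c,k]\<rangle> and
  \<rho>(k)\<langle>[a,b],c\<rangle>. The left side is (P + Q)/3 + A/6. Summing the six instances of
  \<open>i\<close> gives A = 2P/3 - 4Q/3, and the four Jacobi identities give P = A/6. Hence A =
  -3Q/2 and P = -Q/4, and the left side is Q/4 - Q/4.\<close>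

lemma T_cocycle:
  assumes e: "e1 \<in> sections" "e2 \<in> sections" "e3 \<in> sections" "e4 \<in> sections"
  shows "T (br e1 e2) e3 e4 - T (br e1 e3) e2 e4 + T (br e1 e4) e2 e3
    + T (br e2 e3) e1 e4 - T (br e2 e4) e1 e3 + T (br e3 e4) e1 e2
    + (1/2) *\<^sub>R (act e4 (T e1 e2 e3) - act e3 (T e1 e2 e4) + act e2 (T e1 e3 e4) - act e1 (T e2 e3 e4)) = 0"
proof
  fix p
  have s: "pair (br a b) (br c k) p = - pair (br a b) (br k c) p"
    if "a \<in> sections" "b \<in> sections" "c \<in> sections" "k \<in> sections" for a b c k
    using that br_skew[of c k] by simp
  have c: "pair (br a b) (br c k) p = pair (br c k) (br a b) p"
    if "a \<in> sections" "b \<in> sections" "c \<in> sections" "k \<in> sections" for a b c k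
    using that pair_commute[of "br a b" "br c k"] by simp
  \<comment> \<open>Subtracting two instances of \<open>invariance_br\<close> removes the derivative
    along [a,b]. Half of the difference reappears on the right with opposite sign, so 3/2 of it
    stands on the left; dividing by 3/2 produces the constants.\<close>
  have i: "act k (pair (br a b) c) p - act c (pair (br a b) k) p
      = 2/3 * (pair (br (br a b) c) k p - pair (br (br a b) k) c p) - 4/3 * pair (br a b) (br c k) p"
    if "a \<in> sections" "b \<in> sections" "c \<in> sections" "k \<in> sections" for a b c k
  proof -
    have "act (br a b) (pair k c) p = act (br a b) (pair c k) p"
      using that pair_commute[of c k] by simp
    with invariance_br[OF that, of p] invariance_br[OF that(1,2,4,3), of p] s[OF that(1,2,4,3)]
    show ?thesis by argo
  qed
  note E = i[OF e(1,2,3,4)] i[OF e(1,3,2,4)] i[OF e(1,4,2,3)] i[OF e(2,3,1,4)] i[OF e(2,4,1,3)] i[OF e(3,4,1,2)]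
    jacobi_pair[OF e(1,2,3,4), of p] jacobi_pair[OF e(1,2,4,3), of p]
    jacobi_pair[OF e(1,3,4,2), of p] jacobi_pair[OF e(2,3,4,1), of p]
    c[OF e(3,4,1,2)] c[OF e(2,4,1,3)] c[OF e(2,3,1,4)]
  show "(T (br e1 e2) e3 e4 - T (br e1 e3) e2 e4 + T (br e1 e4) e2 e3
    + T (br e2 e3) e1 e4 - T (br e2 e4) e1 e3 + T (br e3 e4) e1 e2
    + (1/2) *\<^sub>R (act e4 (T e1 e2 e3) - act e3 (T e1 e2 e4) + act e2 (T e1 e3 e4) - act e1 (T e2 e3 e4))) p
    = 0 p"
    using E unfolding plus_fun_apply minus_apply scaleR_fun_apply zero_fun_apply real_scaleR_def
      T_br_expand[OF e(1,2,3,4)] T_br_expand[OF e(1,3,2,4)] T_br_expand[OF e(1,4,2,3)]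
      T_br_expand[OF e(2,3,1,4)] T_br_expand[OF e(2,4,1,3)] T_br_expand[OF e(3,4,1,2)]
      act_T_expand[OF e(1,2,3,4)] act_T_expand[OF e(1,2,4,3)] act_T_expand[OF e(1,3,4,2)] act_T_expand[OF e(2,3,4,1)]
    by argo
qed

end

section \<open>Linear maps on exterior powers\<close>

lemma coset_eqI:
  assumes "subspace S" "x - y \<in> S"
  shows "coset S x = coset S y"
proof -
  have "z - x \<in> S \<longleftrightarrow> z - y \<in> S" for z
    using subspace_add[OF assms(1) _ assms(2), of "z - x"] subspace_diff[OF assms(1) _ assms(2), of "z - y"]
    by (auto simp: algebra_simps)
  then show ?thesis by (simp add: coset_def)
qed

lemma coset_eq_iff: "subspace S \<Longrightarrow> coset S x = coset S y \<longleftrightarrow> x - y \<in> S"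
proof
  assume "subspace S" "coset S x = coset S y"
  moreover have "x \<in> coset S x" using \<open>subspace S\<close> by (simp add: coset_def subspace_0)
  ultimately show "x - y \<in> S" by (simp add: coset_def)
qed (rule coset_eqI)

lemma subspace_ext_relations: "subspace (ext_relations V)"
  unfolding ext_relations_def by simp

lemma subspace_total: "subspace (total V)"
  unfolding total_def by simp

lemma homogeneous_total: "x \<in> V k \<Longrightarrow> x \<in> total V"
  unfolding total_def by (blast intro: span_base)

lemma homogeneous_list_total: "list_all2 (\<lambda>x d. x \<in> V d) xs ds \<Longrightarrow> set xs \<subseteq> total V"
  by (induction rule: list_all2_induct) (auto intro: homogeneous_total)

lemma word_tensor_words: "length xs = k \<Longrightarrow> set xs \<subseteq> total V \<Longrightarrow> word xs \<in> tensor_words V k"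
  unfolding tensor_words_def by (blast intro: span_base)

lemma subspace_tensor_words: "subspace (tensor_words V k)"
  unfolding tensor_words_def by simp

lemma wedge_skew:
  assumes "ext_linear V k L" "length us + length vs + 2 = k" "set us \<subseteq> total V" "set vs \<subseteq> total V"
    and "v \<in> V i" "w \<in> V j"
  shows "L (wedge V (us @ [v, w] @ vs)) = - ((-1) powi (i * j)) *\<^sub>R L (wedge V (us @ [w, v] @ vs))"
proof -
  let ?c = "(-1) powi (i * j) :: real"
  have "word (us @ [v, w] @ vs) + ?c *\<^sub>R word (us @ [w, v] @ vs) \<in> ext_relations V"
    unfolding ext_relations_def using assms by (intro span_base UnI2) blast
  then have "wedge V (us @ [v, w] @ vs) = coset (ext_relations V) ((- ?c) *\<^sub>R word (us @ [w, v] @ vs))"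
    unfolding wedge_def by (intro coset_eqI subspace_ext_relations) (simp add: algebra_simps)
  moreover have "word (us @ [w, v] @ vs) \<in> tensor_words V k"
    using assms homogeneous_total[of v V i] homogeneous_total[of w V j] by (auto intro!: word_tensor_words)
  moreover have "lin_on (tensor_words V k) (\<lambda>x. L (coset (ext_relations V) x))"
    using assms(1) by (simp add: ext_linear_def)
  ultimately show ?thesis
    using lin_on_scaleR[of "tensor_words V k" "\<lambda>x. L (coset (ext_relations V) x)" _ "- ?c"]
    by (simp add: wedge_def)
qed

text \<open>The tensors that \<open>L\<close> sends into \<open>S\<close> form a subspace, so
  spanning words suffice. Later \<open>S\<close> is the zero space, to show that a map vanishes, or
  a homogeneous component, to compute a degree.\<close>

lemma ext_linear_span:
  assumes "ext_linear V k L" "A \<subseteq> tensor_words V k" "subspace S"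
    and "\<And>x. x \<in> A \<Longrightarrow> L (coset (ext_relations V) x) \<in> S" and "x \<in> span A"
  shows "L (coset (ext_relations V) x) \<in> S"
proof -
  let ?L = "\<lambda>x. L (coset (ext_relations V) x)"
  have lin: "lin_on (tensor_words V k) ?L" using assms(1) by (simp add: ext_linear_def)
  have "subspace {x \<in> tensor_words V k. ?L x \<in> S}"
    using subspace_tensor_words[of V k] assms(3)
    by (auto intro!: subspaceI simp: lin_on_add[OF lin] lin_on_scaleR[OF lin]
        lin_on_0[OF lin subspace_0[OF subspace_tensor_words]]
        subspace_add subspace_scale subspace_0)
  then have "span A \<subseteq> {x \<in> tensor_words V k. ?L x \<in> S}"
    using assms(2,4) by (intro span_minimal) auto
  then show ?thesis using assms(5) by blast
qed

lemma ext_linear_power_deg: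
  assumes "ext_linear V k L" "subspace S"
    and "\<And>xs ds. length xs = k \<Longrightarrow> list_all2 (\<lambda>x d. x \<in> V d) xs ds \<Longrightarrow> sum_list ds = m \<Longrightarrow> L (wedge V xs) \<in> S"
    and "w \<in> ext_power_deg V k m"
  shows "L w \<in> S"
proof -
  obtain x where x: "w = coset (ext_relations V) x"
    "x \<in> span {word xs | xs ds. length xs = k \<and> list_all2 (\<lambda>x d. x \<in> V d) xs ds \<and> sum_list ds = m}"
    using assms(4) unfolding ext_power_deg_def by blast
  show ?thesis unfolding x(1)
  proof (rule ext_linear_span[OF assms(1) _ assms(2) _ x(2)])
    show "{word xs | xs ds. length xs = k \<and> list_all2 (\<lambda>x d. x \<in> V d) xs ds \<and> sum_list ds = m}
        \<subseteq> tensor_words V k"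
      using homogeneous_list_total by (blast intro: word_tensor_words)
    show "L (coset (ext_relations V) y) \<in> S"
      if "y \<in> {word xs | xs ds. length xs = k \<and> list_all2 (\<lambda>x d. x \<in> V d) xs ds \<and> sum_list ds = m}" for y
      using that assms(3) by (auto simp: wedge_def)
  qed
qed

lemma ext_linear_power:
  assumes "ext_linear V k L" "subspace S"
    and "\<And>xs. length xs = k \<Longrightarrow> set xs \<subseteq> total V \<Longrightarrow> L (wedge V xs) \<in> S"
    and "w \<in> ext_power V k"
  shows "L w \<in> S"
proof -
  obtain x where x: "w = coset (ext_relations V) x" "x \<in> span {word xs | xs. length xs = k \<and> set xs \<subseteq> total V}"
    using assms(4) unfolding ext_power_def tensor_words_def by blast
  show ?thesis unfolding x(1)
    by (rule ext_linear_span[OF assms(1) _ assms(2) _ x(2)])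
      (use assms(3) in \<open>auto simp: wedge_def intro: word_tensor_words\<close>)
qed

lemma wedge_ext_power: "length xs = k \<Longrightarrow> set xs \<subseteq> total V \<Longrightarrow> wedge V xs \<in> ext_power V k"
  unfolding wedge_def ext_power_def by (blast intro: word_tensor_words)

lemma wedge_ext_power_deg:
  "length xs = k \<Longrightarrow> list_all2 (\<lambda>x d. x \<in> V d) xs ds \<Longrightarrow> sum_list ds = m \<Longrightarrow> wedge V xs \<in> ext_power_deg V k m"
  unfolding wedge_def ext_power_deg_def by (blast intro: span_base)

section \<open>The universal property of the exterior powers\<close>

lemma inj_word: "inj word"
  by (rule injI) (metis word_def zero_neq_one)

text \<open>Evaluating a combination of words at the list \<open>xs\<close> isolates the coefficient
  of \<open>word xs\<close>.\<close>

lemma independent_words: "independent (range (word :: 'x list \<Rightarrow> 'x list \<Rightarrow> real))"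
proof -
  have "u w = 0" if S: "finite S" "S \<subseteq> range word" "(\<Sum>v\<in>S. u v *\<^sub>R v) = 0" "w \<in> S"
    for S :: "('x list \<Rightarrow> real) set" and u w
  proof -
    obtain xs where w: "w = word xs" using S by blast
    have app: "(\<Sum>v\<in>A. u v *\<^sub>R v) xs = (\<Sum>v\<in>A. u v * v xs)" if "finite A" for A
      using that by (induction A) (auto simp: scaleR_fun_apply)
    have "(\<Sum>v\<in>S. u v * v xs) = (\<Sum>v\<in>S. if v = w then u v else 0)"
    proof (rule sum.cong[OF refl])
      fix v assume "v \<in> S"
      then obtain ys where "v = word ys" using S(2) by blast
      then show "u v * v xs = (if v = w then u v else 0)"
        using inj_word w by (simp add: inj_eq) (simp add: word_def)
    qed
    then show ?thesis using app[OF S(1)] S by simp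
  qed
  then show ?thesis
    unfolding dependent_explicit by blast
qed

text \<open>Words are independent, so \<open>m\<close> extends linearly from words to a map
  \<open>F\<close>. The assumptions on \<open>m\<close> say that \<open>F\<close> kills the
  generating relations, so it descends to cosets.\<close>

lemma ext_linear_exists:
  fixes V :: "int \<Rightarrow> 'x::real_vector set" and m :: "'x list \<Rightarrow> 'x"
  assumes closed: "\<And>xs. length xs = k \<Longrightarrow> set xs \<subseteq> total V \<Longrightarrow> m xs \<in> total V"
    and lin: "\<And>us vs x y a b. length us + length vs + 1 = k \<Longrightarrow> set us \<subseteq> total V \<Longrightarrow> set vs \<subseteq> total V
      \<Longrightarrow> x \<in> total V \<Longrightarrow> y \<in> total V \<Longrightarrow> m (us @ [a *\<^sub>R x + b *\<^sub>R y] @ vs)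
        = a *\<^sub>R m (us @ [x] @ vs) + b *\<^sub>R m (us @ [y] @ vs)"
    and skew: "\<And>us vs v w i j. length us + length vs + 2 = k \<Longrightarrow> set us \<subseteq> total V \<Longrightarrow> set vs \<subseteq> total V
      \<Longrightarrow> v \<in> V i \<Longrightarrow> w \<in> V j \<Longrightarrow> m (us @ [v, w] @ vs) + ((-1) powi (i * j)) *\<^sub>R m (us @ [w, v] @ vs) = 0"
  shows "\<exists>L. ext_linear V k L \<and> (\<forall>xs. length xs = k \<longrightarrow> L (wedge V xs) = m xs)"
proof -
  \<comment> \<open>The relations involve words of all lengths, while \<open>m\<close> is controlled
    at length \<open>k\<close> only. The words in one relation all have the same length, so the
    value 0 at other lengths is consistent with every relation.\<close>
  define m' where "m' xs = (if length xs = k then m xs else 0)" for xs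
  obtain F :: "('x list \<Rightarrow> real) \<Rightarrow> 'x" where F: "linear F" "\<forall>w\<in>range word. F w = m' (inv word w)"
    using linear_independent_extend[OF independent_words, where f="\<lambda>w. m' (inv word w)"]
    by (elim exE conjE) (rule that)
  have Fw: "F (word xs) = m' xs" for xs using F(2) by (simp add: inv_f_f[OF inj_word])
  note Fs = linear_add[OF F(1)] linear_diff[OF F(1)] linear_cmul[OF F(1)] Fw
  have FR: "F r = 0" if "r \<in> ext_relations V" for r
  proof (rule linear_eq_0_on_span[OF F(1) _ that[unfolded ext_relations_def]])
    fix z assume "z \<in> {word (us @ [a *\<^sub>R x + b *\<^sub>R y] @ vs) - a *\<^sub>R word (us @ [x] @ vs) - b *\<^sub>R word (us @ [y] @ vs)
       | us vs x y a b. set us \<subseteq> total V \<and> set vs \<subseteq> total V \<and> x \<in> total V \<and> y \<in> total V}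
     \<union> {word (us @ [v, w] @ vs) + ((-1) powi (i * j)) *\<^sub>R word (us @ [w, v] @ vs)
       | us vs v w i j. set us \<subseteq> total V \<and> set vs \<subseteq> total V \<and> v \<in> V i \<and> w \<in> V j}"
    then show "F z = 0"
    proof (elim UnE)
      assume "z \<in> {word (us @ [a *\<^sub>R x + b *\<^sub>R y] @ vs) - a *\<^sub>R word (us @ [x] @ vs) - b *\<^sub>R word (us @ [y] @ vs)
       | us vs x y a b. set us \<subseteq> total V \<and> set vs \<subseteq> total V \<and> x \<in> total V \<and> y \<in> total V}"
      then obtain us vs x y a b where
        z: "z = word (us @ [a *\<^sub>R x + b *\<^sub>R y] @ vs) - a *\<^sub>R word (us @ [x] @ vs) - b *\<^sub>R word (us @ [y] @ vs)"
        "set us \<subseteq> total V" "set vs \<subseteq> total V" "x \<in> total V" "y \<in> total V"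
        by (elim CollectE exE conjE) (rule that)
      show ?thesis
        using lin[of us vs x y a b] z(2-) unfolding z(1) Fs m'_def by simp
    next
      assume "z \<in> {word (us @ [v, w] @ vs) + ((-1) powi (i * j)) *\<^sub>R word (us @ [w, v] @ vs)
       | us vs v w i j. set us \<subseteq> total V \<and> set vs \<subseteq> total V \<and> v \<in> V i \<and> w \<in> V j}"
      then obtain us vs v w i j where
        z: "z = word (us @ [v, w] @ vs) + ((-1) powi (i * j)) *\<^sub>R word (us @ [w, v] @ vs)"
        "set us \<subseteq> total V" "set vs \<subseteq> total V" "v \<in> V i" "w \<in> V j" by blast
      show ?thesis
        using skew[of us vs v i w j] z(2-) unfolding z(1) Fs m'_def by simp
    qed
  qed
  \<comment> \<open>Any representative may be chosen: two of them differ by a relation, which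
    \<open>F\<close> kills.\<close>
  define L where "L C = F (SOME x. x \<in> C)" for C
  have L: "L (coset (ext_relations V) x) = F x" for x
  proof -
    let ?y = "SOME y. y \<in> coset (ext_relations V) x"
    have "x \<in> coset (ext_relations V) x"
      using subspace_0[OF subspace_ext_relations] by (simp add: coset_def)
    then have "?y \<in> coset (ext_relations V) x"
      by (rule someI[where P="\<lambda>y. y \<in> coset (ext_relations V) x"])
    then have "F (?y - x) = 0" by (intro FR) (simp add: coset_def)
    then show ?thesis unfolding L_def linear_diff[OF F(1)] by simp
  qed
  have "F x \<in> total V" if "x \<in> tensor_words V k" for x
  proof -
    have "F ` tensor_words V k = span (F ` {word xs | xs. length xs = k \<and> set xs \<subseteq> total V})"
      unfolding tensor_words_def using linear_span_image[OF F(1)] by simp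
    also have "\<dots> \<subseteq> total V"
      using closed by (intro span_minimal subspace_total) (auto simp: Fw m'_def)
    finally show ?thesis using that by blast
  qed
  then have "ext_linear V k L"
    unfolding ext_linear_def ext_power_def lin_on_def by (auto simp: L Fs)
  moreover have "L (wedge V xs) = m xs" if "length xs = k" for xs
    using that by (simp add: wedge_def L Fw m'_def)
  ultimately show ?thesis by blast
qed

section \<open>Unshuffles and Koszul signs\<close>

text \<open>Turns the two monotone blocks of an unshuffle into conditions on lists of values, which
  can be evaluated for concrete sizes.\<close>

lemma strict_mono_on_iff_sorted: "strict_mono_on {a..b} \<sigma> \<longleftrightarrow> sorted_wrt (<) (map \<sigma> [a..<b+1])"
  for a b :: nat and \<sigma> :: "nat \<Rightarrow> nat"
proof
  assume m: "strict_mono_on {a..b} \<sigma>"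
  show "sorted_wrt (<) (map \<sigma> [a..<b+1])"
    unfolding sorted_wrt_iff_nth_less
  proof (intro allI impI)
    fix i j assume ij: "i < j" "j < length (map \<sigma> [a..<b+1])"
    then have "\<sigma> (a + i) < \<sigma> (a + j)"
      by (intro strict_mono_onD[OF m]) (auto simp del: upt_Suc)
    then show "map \<sigma> [a..<b+1] ! i < map \<sigma> [a..<b+1] ! j" using ij by (simp del: upt_Suc)
  qed
next
  assume s: "sorted_wrt (<) (map \<sigma> [a..<b+1])"
  show "strict_mono_on {a..b} \<sigma>"
  proof (rule strict_mono_onI)
    fix r t assume rt: "r \<in> {a..b}" "t \<in> {a..b}" "r < t"
    then have "map \<sigma> [a..<b+1] ! (r - a) < map \<sigma> [a..<b+1] ! (t - a)"
      by (intro s[unfolded sorted_wrt_iff_nth_less, rule_format]) (auto simp del: upt_Suc)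
    then show "\<sigma> r < \<sigma> t" using rt by (simp del: upt_Suc)
  qed
qed

lemma unshuffles_iff:
  "\<sigma> \<in> unshuffles i n \<longleftrightarrow> \<sigma> permutes {1..n}
    \<and> sorted_wrt (<) (map \<sigma> [1..<i+1]) \<and> sorted_wrt (<) (map \<sigma> [i+1..<n+1])"
  unfolding unshuffles_def strict_mono_on_iff_sorted by simp

lemma permutes_eqI:
  assumes "\<sigma> permutes S" "\<tau> permutes S" "\<And>m. m \<in> S \<Longrightarrow> \<sigma> m = \<tau> m"
  shows "\<sigma> = \<tau>"
  using assms unfolding permutes_def by (metis ext)

text \<open>A permutation of {1..n} is determined by its list of values, so an enumeration is
  verified by comparing such lists.\<close>

lemma sum_unshuffles:
  assumes "distinct (map (\<lambda>\<sigma>. map \<sigma> [1..<n+1]) ss)" "set ss \<subseteq> unshuffles i n"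
    and "\<And>\<sigma>. \<sigma> \<in> unshuffles i n \<Longrightarrow> \<exists>\<tau>\<in>set ss. map \<sigma> [1..<n+1] = map \<tau> [1..<n+1]"
  shows "sum F (unshuffles i n) = sum_list (map F ss)"
proof -
  have "unshuffles i n \<subseteq> set ss"
  proof
    fix \<sigma> assume \<sigma>: "\<sigma> \<in> unshuffles i n"
    then obtain \<tau> where \<tau>: "\<tau> \<in> set ss" "map \<sigma> [1..<n+1] = map \<tau> [1..<n+1]" using assms(3) by blast
    have "\<sigma> m = \<tau> m" if "m \<in> {1..n}" for m
      using \<tau>(2) that by (auto simp del: upt_Suc)
    then have "\<sigma> = \<tau>"
      using \<sigma> \<tau>(1) assms(2) by (intro permutes_eqI[of \<sigma> "{1..n}"]) (auto simp: unshuffles_iff)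
    then show "\<sigma> \<in> set ss" using \<tau> by simp
  qed
  then have "unshuffles i n = set ss" using assms(2) by blast
  moreover have "distinct ss" using assms(1) by (simp add: distinct_map)
  ultimately show ?thesis by (simp add: sum_list_distinct_conv_sum_set)
qed

lemma transpose_apply: "Transposition.transpose a b c = (if c = a then b else if c = b then a else c)"
  by (simp add: transpose_def)

lemma permutes_values:
  fixes \<sigma> :: "nat \<Rightarrow> nat"
  assumes "\<sigma> permutes {1..n}" "1 \<le> m" "m \<le> n"
  shows "1 \<le> \<sigma> m" "\<sigma> m \<le> n" "\<sigma> m = \<sigma> m' \<longleftrightarrow> m = m'"
  using permutes_in_image[OF assms(1), of m] assms(2,3) permutes_inj[OF assms(1)]
  by (auto simp: inj_eq)

lemmas permutes_transpose = permutes_compose permutes_swap_id permutes_id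

lemma upt_values: "[Suc 0..<2] = [1::nat]" "[Suc 0..<3] = [1, 2::nat]" "[Suc 0..<4] = [1, 2, 3::nat]"
  "[Suc 0..<5] = [1, 2, 3, 4::nat]" "[Suc (Suc 0)..<3] = [2::nat]" "[Suc (Suc 0)..<4] = [2, 3::nat]"
  "[2..<3] = [2::nat]" "[2..<4] = [2, 3::nat]" "[3..<4] = [3::nat]" "[3..<5] = [3, 4::nat]" "[4..<5] = [4::nat]"
  by (simp_all add: upt_rec)

section \<open>Explicit unshuffles of two, three and four elements\<close>

lemma permutes_2_cases:
  assumes "\<sigma> permutes {1..2::nat}"
  shows "[\<sigma> 1, \<sigma> 2] \<in> {[1,2],[2,1]}"
proof -
  have "\<sigma> 1 \<in> {1,2}" "\<sigma> 2 \<in> {1,2}" "\<sigma> 1 \<noteq> \<sigma> 2"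
    using permutes_values[OF assms, of 1] permutes_values[OF assms, of 2] by auto
  then show ?thesis by (elim insertE emptyE) simp_all
qed

text \<open>Here and below the unshuffles are products of adjacent transpositions, which makes their
  signs computable.\<close>

lemma sum_unshuffles_1_2:
  "sum F (unshuffles 1 2) = F id + F (Transposition.transpose 1 2)"
proof -
  let ?ss = "[id, Transposition.transpose 1 2] :: (nat \<Rightarrow> nat) list"
  have "sum F (unshuffles 1 2) = sum_list (map F ?ss)"
  proof (rule sum_unshuffles)
    show "set ?ss \<subseteq> unshuffles 1 2"
      by (auto simp: unshuffles_iff upt_values transpose_apply intro!: permutes_transpose)
    show "\<exists>\<tau>\<in>set ?ss. map \<sigma> [1..<2+1] = map \<tau> [1..<2+1]" if "\<sigma> \<in> unshuffles 1 2" for \<sigma>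
      using that permutes_2_cases[of \<sigma>]
      by (auto simp: unshuffles_iff upt_values transpose_apply)
  qed (simp add: upt_values transpose_apply)
  then show ?thesis by simp
qed

lemma sum_unshuffles_2_2: "sum F (unshuffles 2 2) = F id"
proof -
  let ?ss = "[id] :: (nat \<Rightarrow> nat) list"
  have "sum F (unshuffles 2 2) = sum_list (map F ?ss)"
  proof (rule sum_unshuffles)
    show "set ?ss \<subseteq> unshuffles 2 2"
      by (auto simp: unshuffles_iff upt_values intro!: permutes_transpose)
    show "\<exists>\<tau>\<in>set ?ss. map \<sigma> [1..<2+1] = map \<tau> [1..<2+1]" if "\<sigma> \<in> unshuffles 2 2" for \<sigma>
      using that permutes_2_cases[of \<sigma>]
      by (auto simp: unshuffles_iff upt_values)
  qed (simp add: upt_values)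
  then show ?thesis by simp
qed

lemma permutes_3_cases:
  assumes "\<sigma> permutes {1..3::nat}"
  shows "[\<sigma> 1, \<sigma> 2, \<sigma> 3] \<in> {[1,2,3],[1,3,2],[2,1,3],[2,3,1],[3,1,2],[3,2,1]}"
proof -
  have "\<sigma> m \<in> {1,2,3}" if "m \<in> {1,2,3}" for m
    using permutes_values(1,2)[OF assms, of m] that by auto
  then have "\<sigma> 1 \<in> {1,2,3}" "\<sigma> 2 \<in> {1,2,3}" "\<sigma> 3 \<in> {1,2,3}" by blast+
  moreover have "\<sigma> 1 \<noteq> \<sigma> 2" "\<sigma> 1 \<noteq> \<sigma> 3" "\<sigma> 2 \<noteq> \<sigma> 3"
    using permutes_values(3)[OF assms] by simp_all
  ultimately show ?thesis by (elim insertE emptyE) simp_all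
qed

text \<open>The lists of values are 123, 213, 312.\<close>

lemma sum_unshuffles_1_3:
  "sum F (unshuffles 1 3) = F id + F (Transposition.transpose 1 2)
    + F (Transposition.transpose 2 3 \<circ> Transposition.transpose 1 2)"
proof -
  let ?ss = "[id, Transposition.transpose 1 2, Transposition.transpose 2 3 \<circ> Transposition.transpose 1 2]
    :: (nat \<Rightarrow> nat) list"
  have "sum F (unshuffles 1 3) = sum_list (map F ?ss)"
  proof (rule sum_unshuffles)
    show "set ?ss \<subseteq> unshuffles 1 3"
      by (auto simp: unshuffles_iff upt_values transpose_apply intro!: permutes_transpose)
    show "\<exists>\<tau>\<in>set ?ss. map \<sigma> [1..<3+1] = map \<tau> [1..<3+1]" if "\<sigma> \<in> unshuffles 1 3" for \<sigma>
      using that permutes_3_cases[of \<sigma>]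
      by (auto simp: unshuffles_iff upt_values transpose_apply)
  qed (simp add: upt_values transpose_apply)
  then show ?thesis by (simp add: add.assoc)
qed

text \<open>The lists of values are 123, 132, 231.\<close>

lemma sum_unshuffles_2_3:
  "sum F (unshuffles 2 3) = F id + F (Transposition.transpose 2 3)
    + F (Transposition.transpose 1 2 \<circ> Transposition.transpose 2 3)"
proof -
  let ?ss = "[id, Transposition.transpose 2 3, Transposition.transpose 1 2 \<circ> Transposition.transpose 2 3]
    :: (nat \<Rightarrow> nat) list"
  have "sum F (unshuffles 2 3) = sum_list (map F ?ss)"
  proof (rule sum_unshuffles)
    show "set ?ss \<subseteq> unshuffles 2 3"
      by (auto simp: unshuffles_iff upt_values transpose_apply intro!: permutes_transpose)
    show "\<exists>\<tau>\<in>set ?ss. map \<sigma> [1..<3+1] = map \<tau> [1..<3+1]" if "\<sigma> \<in> unshuffles 2 3" for \<sigma>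
      using that permutes_3_cases[of \<sigma>]
      by (auto simp: unshuffles_iff upt_values transpose_apply)
  qed (simp add: upt_values transpose_apply)
  then show ?thesis by (simp add: add.assoc)
qed

lemma sum_unshuffles_3_3: "sum F (unshuffles 3 3) = F id"
proof -
  let ?ss = "[id] :: (nat \<Rightarrow> nat) list"
  have "sum F (unshuffles 3 3) = sum_list (map F ?ss)"
  proof (rule sum_unshuffles)
    show "set ?ss \<subseteq> unshuffles 3 3"
      by (auto simp: unshuffles_iff upt_values intro!: permutes_transpose)
    show "\<exists>\<tau>\<in>set ?ss. map \<sigma> [1..<3+1] = map \<tau> [1..<3+1]" if "\<sigma> \<in> unshuffles 3 3" for \<sigma>
      using that permutes_3_cases[of \<sigma>]
      by (auto simp: unshuffles_iff upt_values)
  qed (simp add: upt_values)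
  then show ?thesis by simp
qed

lemma permutes_4_values:
  assumes "\<sigma> permutes {1..4::nat}"
  shows "\<sigma> 1 \<in> {1,2,3,4}" "\<sigma> 2 \<in> {1,2,3,4}" "\<sigma> 3 \<in> {1,2,3,4}" "\<sigma> 4 \<in> {1,2,3,4}"
    "distinct [\<sigma> 1, \<sigma> 2, \<sigma> 3, \<sigma> 4]"
proof -
  have "\<sigma> m \<in> {1,2,3,4}" if "m \<in> {1,2,3,4}" for m
    using permutes_values(1,2)[OF assms, of m] that by auto
  then show "\<sigma> 1 \<in> {1,2,3,4}" "\<sigma> 2 \<in> {1,2,3,4}" "\<sigma> 3 \<in> {1,2,3,4}" "\<sigma> 4 \<in> {1,2,3,4}" by blast+
  show "distinct [\<sigma> 1, \<sigma> 2, \<sigma> 3, \<sigma> 4]"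
    using permutes_values(3)[OF assms] by simp
qed

text \<open>The lists of values are 1234, 1324, 1423, 2314, 2413, 3412. Each permutation after the
  first is an earlier one followed by an adjacent transposition.\<close>

lemma sum_unshuffles_2_4:
  "sum F (unshuffles 2 4) = F id + F (Transposition.transpose 2 3)
    + F (Transposition.transpose 3 4 \<circ> Transposition.transpose 2 3)
    + F (Transposition.transpose 1 2 \<circ> Transposition.transpose 2 3)
    + F (Transposition.transpose 3 4 \<circ> (Transposition.transpose 1 2 \<circ> Transposition.transpose 2 3))
    + F (Transposition.transpose 2 3 \<circ> (Transposition.transpose 3 4 \<circ> (Transposition.transpose 1 2 \<circ> Transposition.transpose 2 3)))"
proof -
  let ?ss = "[id, Transposition.transpose 2 3, Transposition.transpose 3 4 \<circ> Transposition.transpose 2 3,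
      Transposition.transpose 1 2 \<circ> Transposition.transpose 2 3,
      Transposition.transpose 3 4 \<circ> (Transposition.transpose 1 2 \<circ> Transposition.transpose 2 3),
      Transposition.transpose 2 3 \<circ> (Transposition.transpose 3 4 \<circ> (Transposition.transpose 1 2 \<circ> Transposition.transpose 2 3))]
    :: (nat \<Rightarrow> nat) list"
  have "sum F (unshuffles 2 4) = sum_list (map F ?ss)"
  proof (rule sum_unshuffles)
    show "set ?ss \<subseteq> unshuffles 2 4"
      by (auto simp: unshuffles_iff upt_values transpose_apply intro!: permutes_transpose)
    show "\<exists>\<tau>\<in>set ?ss. map \<sigma> [1..<4+1] = map \<tau> [1..<4+1]" if "\<sigma> \<in> unshuffles 2 4" for \<sigma>
    proof -
      have \<sigma>: "\<sigma> permutes {1..4}" "\<sigma> 1 < \<sigma> 2" "\<sigma> 3 < \<sigma> 4"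
        using that by (auto simp: unshuffles_iff upt_values)
      have "[\<sigma> 1, \<sigma> 2, \<sigma> 3, \<sigma> 4]
          \<in> {[1,2,3,4], [1,3,2,4], [1,4,2,3], [2,3,1,4], [2,4,1,3], [3,4,1,2]}"
        using \<sigma>(2,3) permutes_4_values[OF \<sigma>(1)] by (elim insertE emptyE) simp_all
      then show ?thesis by (auto simp: upt_values transpose_apply)
    qed
  qed (simp add: upt_values transpose_apply)
  then show ?thesis by (simp add: add.assoc)
qed

text \<open>The lists of values are 1234, 1243, 1342, 2341.\<close>

lemma sum_unshuffles_3_4:
  "sum F (unshuffles 3 4) = F id + F (Transposition.transpose 3 4)
    + F (Transposition.transpose 2 3 \<circ> Transposition.transpose 3 4)
    + F (Transposition.transpose 1 2 \<circ> (Transposition.transpose 2 3 \<circ> Transposition.transpose 3 4))"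
proof -
  let ?ss = "[id, Transposition.transpose 3 4, Transposition.transpose 2 3 \<circ> Transposition.transpose 3 4,
      Transposition.transpose 1 2 \<circ> (Transposition.transpose 2 3 \<circ> Transposition.transpose 3 4)]
    :: (nat \<Rightarrow> nat) list"
  have "sum F (unshuffles 3 4) = sum_list (map F ?ss)"
  proof (rule sum_unshuffles)
    show "set ?ss \<subseteq> unshuffles 3 4"
      by (auto simp: unshuffles_iff upt_values transpose_apply intro!: permutes_transpose)
    show "\<exists>\<tau>\<in>set ?ss. map \<sigma> [1..<4+1] = map \<tau> [1..<4+1]" if "\<sigma> \<in> unshuffles 3 4" for \<sigma>
    proof -
      have \<sigma>: "\<sigma> permutes {1..4}" "\<sigma> 1 < \<sigma> 2" "\<sigma> 2 < \<sigma> 3"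
        using that by (auto simp: unshuffles_iff upt_values)
      have "[\<sigma> 1, \<sigma> 2, \<sigma> 3, \<sigma> 4] \<in> {[1,2,3,4], [1,2,4,3], [1,3,4,2], [2,3,4,1]}"
        using \<sigma>(2,3) permutes_4_values[OF \<sigma>(1)] by (elim insertE emptyE) simp_all
      then show ?thesis by (auto simp: upt_values transpose_apply)
    qed
  qed (simp add: upt_values transpose_apply)
  then show ?thesis by (simp add: add.assoc)
qed

section \<open>Koszul signs\<close>

lemma koszul_id: "koszul d n id = 1"
  unfolding koszul_def by (rule prod.neutral) auto

lemma koszul_transpose_1_2:
  "koszul d 2 (Transposition.transpose 1 2) = (if odd (d 1) \<and> odd (d 2) then -1 else 1)"
proof -
  have "{(a, b). 1 \<le> a \<and> a < b \<and> b \<le> 2 \<and> Transposition.transpose 1 2 b < Transposition.transpose 1 (2::nat) a}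
      = {(1, 2)}"
    by (auto simp: transpose_apply split: if_splits)
  then show ?thesis unfolding koszul_def by (simp only:) (simp add: transpose_apply conj_commute)
qed

text \<open>A factor -1 needs two different odd arguments.\<close>

lemma koszul_at_most_one_odd:
  assumes "\<sigma> permutes {1..n}" "\<And>m. m \<in> {1..n} \<Longrightarrow> odd (d m) \<Longrightarrow> m = k"
  shows "koszul d n \<sigma> = 1"
  unfolding koszul_def
proof (rule prod.neutral, clarify)
  fix a b assume ab: "1 \<le> a" "a < b" "b \<le> n" "\<sigma> b < \<sigma> a"
  then have "\<sigma> a \<in> {1..n}" "\<sigma> b \<in> {1..n}"
    using permutes_in_image[OF assms(1), of a] permutes_in_image[OF assms(1), of b] by simp_all
  then have "\<not> (odd (d (\<sigma> a)) \<and> odd (d (\<sigma> b)))"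
    using assms(2)[of "\<sigma> a"] assms(2)[of "\<sigma> b"] ab(4) by (metis less_irrefl)
  then show "(if odd (d (\<sigma> a)) \<and> odd (d (\<sigma> b)) then - 1 else 1) = (1::real)" by simp
qed

section \<open>The structure maps\<close>

lemma sum_eq_single:
  assumes "finite K" "\<And>j. j \<in> K \<Longrightarrow> j \<noteq> a \<Longrightarrow> f j = 0"
  shows "sum f K = (if a \<in> K then f a else 0)"
proof (cases "a \<in> K")
  case True
  have "sum f (K - {a}) = 0" by (rule sum.neutral) (use assms(2) in blast)
  then show ?thesis using sum.remove[OF assms(1) True, of f] True by simp
next
  case False
  have "sum f K = 0" by (rule sum.neutral) (use assms(2) False in blast)
  then show ?thesis using False by simp
qed

section \<open>The graded space and its resolution\<close>

context courant_algebroid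
begin

lemma ker_\<D>_simps [simp]: "c \<in> ker_\<D> \<Longrightarrow> c \<in> smooth_functions" "c \<in> ker_\<D> \<Longrightarrow> \<D> c = 0"
  by (auto simp: ker_\<D>_def)

lemma subspace_ker_\<D>: "subspace ker_\<D>"
  by (rule subspaceI) (simp_all add: ker_\<D>_def del: ker_\<D>_simps)

lemmas X_incl_defs = X0_def X1_def X2_def

text \<open>The alternative \<open>x = 0\<close> is compatible with every \<open>k\<close>,
  including those outside 0, 1, 2.\<close>

lemma X_pieces:
  assumes "x \<in> X k"
  shows "(k = 0 \<and> (\<exists>e\<in>sections. x = X0 e)) \<or> (k = 1 \<and> (\<exists>f\<in>smooth_functions. x = X1 f))
    \<or> (k = 2 \<and> (\<exists>c\<in>ker_\<D>. x = X2 c)) \<or> x = 0"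
  using assms by (auto simp: X_def split: if_splits)

lemma X_zero [simp]: "0 \<in> X k"
proof -
  have "X0 0 = 0" "X1 0 = 0" "X2 0 = 0" by (simp_all add: X_incl_defs zero_prod_def)
  then show ?thesis
    using subspace_0[OF subspace_ker_\<D>] unfolding X_def
    by (auto simp: image_iff intro: bexI[of _ 0])
qed

lemma X0_in [simp]: "e \<in> sections \<Longrightarrow> X0 e \<in> X 0"
  and X1_in [simp]: "f \<in> smooth_functions \<Longrightarrow> X1 f \<in> X 1"
  and X2_in [simp]: "c \<in> ker_\<D> \<Longrightarrow> X2 c \<in> X 2"
  by (simp_all add: X_def)

lemma X_linear:
  "X0 (e + e') = X0 e + X0 e'" "X0 (a *\<^sub>R e) = a *\<^sub>R X0 e"
  "X1 (f + f') = X1 f + X1 f'" "X1 (a *\<^sub>R f) = a *\<^sub>R X1 f"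
  "X2 (f + f') = X2 f + X2 f'" "X2 (a *\<^sub>R f) = a *\<^sub>R X2 f"
  "X0 0 = 0" "X1 0 = 0" "X2 0 = 0"
  by (simp_all add: X_incl_defs zero_prod_def)

lemma subspace_X: "subspace (X k)"
proof -
  have im: "subspace (I ` S)" if "\<And>x y. I (x + y) = I x + I y" "\<And>a x. I (a *\<^sub>R x) = a *\<^sub>R I x" "subspace S"
    for I :: "'c::real_vector \<Rightarrow> 'd::real_vector" and S
    using that linear_subspace_image[of I S] by (simp add: linear_iff)
  show ?thesis
    unfolding X_def using subspace_sections subspace_smooth_functions subspace_ker_\<D>
    by (auto intro!: im simp: X_linear)
qed

lemma total_X: "total X = sections \<times> smooth_functions \<times> ker_\<D>"
proof
  show "total X \<subseteq> sections \<times> smooth_functions \<times> ker_\<D>"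
    unfolding total_def
  proof (rule span_minimal)
    show "\<Union> (range X) \<subseteq> sections \<times> smooth_functions \<times> ker_\<D>"
      using subspace_0[OF subspace_ker_\<D>] by (auto dest!: X_pieces simp: X_incl_defs zero_prod_def)
    show "subspace (sections \<times> smooth_functions \<times> ker_\<D>)"
      by (intro subspace_Times subspace_sections subspace_smooth_functions subspace_ker_\<D>)
  qed
  show "sections \<times> smooth_functions \<times> ker_\<D> \<subseteq> total X"
  proof clarify
    fix e f c assume efc: "e \<in> sections" "f \<in> smooth_functions" "c \<in> ker_\<D>"
    have "(e, f, c) = X0 e + (X1 f + X2 c)" by (simp add: X_incl_defs)
    also have "\<dots> \<in> total X"
      using homogeneous_total[of _ X] efc by (intro subspace_add[OF subspace_total]) (meson X0_in X1_in X2_in)+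
    finally show "(e, f, c) \<in> total X" .
  qed
qed

text \<open>Each of the three coordinates is fed by a single degree, so a vanishing sum vanishes
  degree by degree.\<close>

lemma graded_X: "graded_space X"
  unfolding graded_space_def
proof (intro conjI allI impI ballI subspace_X)
  fix K :: "int set" and x k
  assume "finite K \<and> (\<forall>k\<in>K. x k \<in> X k) \<and> (\<Sum>k\<in>K. x k) = 0" and k: "k \<in> K"
  then have K: "finite K" "\<And>k. k \<in> K \<Longrightarrow> x k \<in> X k" "(\<Sum>k\<in>K. x k) = 0" by auto
  have "fst (x j) = 0" if "j \<in> K" "j \<noteq> 0" for j
    using X_pieces[OF K(2)[OF that(1)]] that by (auto simp: X_incl_defs)
  moreover have "fst (snd (x j)) = 0" if "j \<in> K" "j \<noteq> 1" for j
    using X_pieces[OF K(2)[OF that(1)]] that by (auto simp: X_incl_defs)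
  moreover have "snd (snd (x j)) = 0" if "j \<in> K" "j \<noteq> 2" for j
    using X_pieces[OF K(2)[OF that(1)]] that by (auto simp: X_incl_defs)
  ultimately have "fst (\<Sum>k\<in>K. x k) = (if 0 \<in> K then fst (x 0) else 0)"
    "fst (snd (\<Sum>k\<in>K. x k)) = (if 1 \<in> K then fst (snd (x 1)) else 0)"
    "snd (snd (\<Sum>k\<in>K. x k)) = (if 2 \<in> K then snd (snd (x 2)) else 0)"
    unfolding fst_sum snd_sum by (intro sum_eq_single K(1); blast)+
  then show "x k = 0"
    using K(3) k X_pieces[OF K(2)[OF k]] by (auto simp: X_incl_defs zero_prod_def)
qed

lemma d_alt: "d x = (\<D> (fst (snd x)), snd (snd x), 0)"
  by (simp add: d_def split_beta)

text \<open>Exactness in degree 1 is the definition of \<open>ker_\<D>\<close>, in degree 2 it is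
  injectivity of the inclusion, and in degree 0 the augmentation \<open>fst\<close> identifies
  \<open>X 0\<close> with the sections.\<close>

lemma resolution_X: "resolution_of_quotient X d fst sections (\<D> ` smooth_functions)"
proof -
  have S: "subspace (\<D> ` smooth_functions)"
  proof (rule subspaceI)
    show "0 \<in> \<D> ` smooth_functions" by (rule image_eqI[of _ _ 0]) simp_all
  next
    fix s t assume "s \<in> \<D> ` smooth_functions" "t \<in> \<D> ` smooth_functions"
    then obtain f h where fh: "f \<in> smooth_functions" "h \<in> smooth_functions" "s = \<D> f" "t = \<D> h" by blast
    then show "s + t \<in> \<D> ` smooth_functions" by (intro image_eqI[of _ _ "f + h"]) simp_all
  next
    fix a s assume "s \<in> \<D> ` smooth_functions"
    then obtain f where f: "f \<in> smooth_functions" "s = \<D> f" by blast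
    then show "a *\<^sub>R s \<in> \<D> ` smooth_functions" by (intro image_eqI[of _ _ "a *\<^sub>R f"]) simp_all
  qed
  have lin: "lin_on (X k) d" for k
  proof (rule lin_onI[OF _ _ subspace_X])
    have sm: "fst (snd x) \<in> smooth_functions" if "x \<in> X k" for x
      using homogeneous_total[of x X k] that by (auto simp: total_X)
    show "d (x + y) = d x + d y" if "x \<in> X k" "y \<in> X k" for x y
      using sm that by (simp add: d_alt)
    show "d (a *\<^sub>R x) = a *\<^sub>R d x" if "x \<in> X k" for a x
      using sm that by (simp add: d_alt)
  qed
  have im: "d ` X k \<subseteq> X (k - 1)" for k
  proof (rule image_subsetI)
    fix x assume "x \<in> X k"
    from X_pieces[OF this] show "d x \<in> X (k - 1)"
      using X_zero[of "k - 1"] X1_in[of "snd (snd x)"] X0_in[of "\<D> (fst (snd x))"]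
      by (auto simp: d_alt X_incl_defs zero_prod_def)
  qed
  have exact: "{x \<in> X k. d x = 0} = d ` X (k + 1)" if "k > 0" for k
  proof -
    consider "k = 1" | "k = 2" | "k > 2" using \<open>k > 0\<close> by linarith
    then show ?thesis
    proof cases
      case 1
      then show ?thesis
        by (auto simp: X_def X_incl_defs d_alt zero_prod_def ker_\<D>_def image_iff simp del: ker_\<D>_simps)
    next
      case 2
      then show ?thesis
        using subspace_0[OF subspace_ker_\<D>] by (auto simp: X_def X_incl_defs d_alt zero_prod_def image_iff)
    next
      case 3
      then show ?thesis by (auto simp: X_def d_alt zero_prod_def)
    qed
  qed
  show ?thesis
    unfolding resolution_of_quotient_def
  proof (intro conjI)
    show "{x \<in> X 0. coset (\<D> ` smooth_functions) (fst x) = coset (\<D> ` smooth_functions) 0} = d ` X 1"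
      unfolding coset_eq_iff[OF S] by (auto simp: X_def X_incl_defs d_alt image_iff)
    show "(\<lambda>x. coset (\<D> ` smooth_functions) (fst x)) ` X 0 = coset (\<D> ` smooth_functions) ` sections"
      by (auto simp: X_def X_incl_defs image_iff)
  qed (use graded_X S lin im exact subspace_sections in \<open>auto simp: X_def lin_on_def X_incl_defs\<close>)
qed

section \<open>The structure maps as one function on lists\<close>

text \<open>A single formula on the total space replaces the case list by degree. The subtracted
  pairing is forced by graded skew-symmetry: l2(f,e) = -l2(e,f) in degrees 1 and 0. Arguments of
  higher degree have no section component, which makes the remaining prescribed values
  vanish.\<close>

definition cmap :: "('m, 'v) complex_space list \<Rightarrow> ('m, 'v) complex_space" where
  "cmap xs = (case xs of
      [x] \<Rightarrow> d x
    | [x, y] \<Rightarrow> (br (fst x) (fst y),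
        pair (fst x) (\<D> (fst (snd y))) - pair (fst y) (\<D> (fst (snd x))), 0)
    | [x, y, z] \<Rightarrow> X1 (- T (fst x) (fst y) (fst z))
    | _ \<Rightarrow> 0)"

lemma cmap_simps [simp]:
  "cmap [] = 0"
  "cmap [x] = d x"
  "cmap [x, y] = (br (fst x) (fst y), pair (fst x) (\<D> (fst (snd y))) - pair (fst y) (\<D> (fst (snd x))), 0)"
  "cmap [x, y, z] = X1 (- T (fst x) (fst y) (fst z))"
  by (simp_all add: cmap_def)

lemma cmap_long: "length xs > 3 \<Longrightarrow> cmap xs = 0"
  by (auto simp: cmap_def split: list.splits)

lemma total_X_simps:
  "x \<in> total X \<Longrightarrow> fst x \<in> sections" "x \<in> total X \<Longrightarrow> fst (snd x) \<in> smooth_functions"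
  "x \<in> total X \<Longrightarrow> snd (snd x) \<in> ker_\<D>"
  by (auto simp: total_X)

lemma T_linear:
  assumes "x \<in> sections" "y \<in> sections" "e1 \<in> sections" "e2 \<in> sections"
  shows "T (a *\<^sub>R x + b *\<^sub>R y) e1 e2 = a *\<^sub>R T x e1 e2 + b *\<^sub>R T y e1 e2"
    "T e1 (a *\<^sub>R x + b *\<^sub>R y) e2 = a *\<^sub>R T e1 x e2 + b *\<^sub>R T e1 y e2"
    "T e1 e2 (a *\<^sub>R x + b *\<^sub>R y) = a *\<^sub>R T e1 e2 x + b *\<^sub>R T e1 e2 y"
  using assms by (simp_all add: T_def algebra_simps)

text \<open>Lists of more than three entries are sent to 0 by \<open>cmap\<close>, so only these
  surroundings of a marked entry need computation.\<close>

lemma list_pair_cases: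
  obtains "length us + length vs > 2" | "us = []" "vs = []" | v where "us = []" "vs = [v]"
    | v v' where "us = []" "vs = [v, v']" | u where "us = [u]" "vs = []"
    | u v where "us = [u]" "vs = [v]" | u u' where "us = [u, u']" "vs = []"
proof (cases "length us + length vs > 2")
  case False
  then have "length us = 0 \<and> length vs = 0 \<or> length us = 0 \<and> length vs = 1 \<or> length us = 0 \<and> length vs = 2
    \<or> length us = 1 \<and> length vs = 0 \<or> length us = 1 \<and> length vs = 1 \<or> length us = 2 \<and> length vs = 0"
    by linarith
  then show thesis using that by (auto simp: length_Suc_conv numeral_2_eq_2)
qed

lemma cmap_multilinear:
  assumes "set us \<subseteq> total X" "set vs \<subseteq> total X" "x \<in> total X" "y \<in> total X"
  shows "cmap (us @ [a *\<^sub>R x + b *\<^sub>R y] @ vs) = a *\<^sub>R cmap (us @ [x] @ vs) + b *\<^sub>R cmap (us @ [y] @ vs)"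
  by (rule list_pair_cases[of us vs])
    (use assms in \<open>simp_all add: cmap_long d_alt total_X_simps T_linear prod_eq_iff X1_def algebra_simps\<close>)

lemma odd_fst: "x \<in> X k \<Longrightarrow> odd k \<Longrightarrow> fst x = 0"
  by (auto dest!: X_pieces simp: X_incl_defs)

text \<open>If both degrees are odd, the relation asks for symmetry in v and w, and both terms
  vanish because odd elements have no section component. Otherwise it asks for ordinary
  antisymmetry, which the bracket, the difference of pairings and \<open>T\<close> have.\<close>

lemma cmap_skew:
  assumes "set us \<subseteq> total X" "set vs \<subseteq> total X" "v \<in> X i" "w \<in> X j"
  shows "cmap (us @ [v, w] @ vs) + ((-1) powi (i * j)) *\<^sub>R cmap (us @ [w, v] @ vs) = 0"
proof -
  have tot: "v \<in> total X" "w \<in> total X" using assms(3,4) by (auto intro: homogeneous_total)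
  have c: "((-1) powi (i * j) :: real) = (if odd i \<and> odd j then -1 else 1)"
    by (simp add: power_int_minus_left)
  have z: "fst v = 0 \<and> fst w = 0" if "odd i \<and> odd j" using odd_fst assms(3,4) that by blast
  note br = br_skew[of "fst w" "fst v"] T_skew12[of "fst w" "fst v"] T_skew23[of _ "fst w" "fst v"]
  consider "length us + length vs > 1" | "us = []" "vs = []" | u where "us = []" "vs = [u]" | u where "us = [u]" "vs = []"
    by (rule list_pair_cases[of us vs]) auto
  then show ?thesis
    by cases (use assms(1,2) tot z br in
      \<open>auto simp: cmap_long c total_X_simps prod_eq_iff X1_def algebra_simps\<close>)
qed

lemma cmap_closed: "set xs \<subseteq> total X \<Longrightarrow> cmap xs \<in> total X"
  by (auto simp: cmap_def d_alt total_X X1_def zero_prod_def subspace_0[OF subspace_ker_\<D>] split: list.splits)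

lemma cmap_zero:
  assumes "0 \<in> set xs" "set xs \<subseteq> total X"
  shows "cmap xs = 0"
proof -
  obtain us vs where xs: "xs = us @ 0 # vs" using assms(1) by (meson split_list)
  show ?thesis
    using cmap_multilinear[of us vs 0 0 0 0] assms(2) by (simp add: xs)
qed

lemma cmap_degree:
  assumes "list_all2 (\<lambda>x d. x \<in> X d) xs ds" "xs \<noteq> []"
  shows "cmap xs \<in> X (sum_list ds + int (length xs) - 2)"
proof (cases "0 \<in> set xs \<or> length xs > 3")
  \<comment> \<open>A zero entry may carry any degree in \<open>ds\<close>, so it is settled before
    degrees are read off from components.\<close>
  case True
  then show ?thesis using cmap_zero homogeneous_list_total[OF assms(1)] cmap_long by force
next
  case False
  have X1': "(0, f, 0) \<in> X 1" if "f \<in> smooth_functions" for f using X1_in[OF that] by (simp add: X1_def)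
  have X0': "(e, 0, 0) \<in> X 0" if "e \<in> sections" for e using X0_in[OF that] by (simp add: X0_def)
  have X00: "(0, 0, 0) \<in> X k" for k using X_zero[of k] by (simp add: zero_prod_def)
  from False assms(2) consider x where "xs = [x]" | x y where "xs = [x, y]" | x y z where "xs = [x, y, z]"
    by (cases xs; cases "tl xs"; cases "tl (tl xs)"; cases "tl (tl (tl xs))") auto
  then show ?thesis
  proof cases
    case (1 x)
    with assms(1) obtain i where "ds = [i]" "x \<in> X i" by (auto simp: list_all2_Cons1)
    then show ?thesis using 1 False X_pieces[of x i] by (auto simp: d_alt X_incl_defs X0' X1' X00)
  next
    case (2 x y)
    with assms(1) obtain i j where "ds = [i, j]" "x \<in> X i" "y \<in> X j" by (auto simp: list_all2_Cons1)
    then show ?thesis using 2 False X_pieces[of x i] X_pieces[of y j]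
      by (auto simp: X_incl_defs X0' X1' X00)
  next
    case (3 x y z)
    with assms(1) obtain i j k where "ds = [i, j, k]" "x \<in> X i" "y \<in> X j" "z \<in> X k"
      by (auto simp: list_all2_Cons1)
    then show ?thesis using 3 False X_pieces[of x i] X_pieces[of y j] X_pieces[of z k]
      by (auto simp: X_incl_defs X0' X1' X00)
  qed
qed

section \<open>Existence and uniqueness of the structure maps\<close>

lemma courant_maps_exists: "\<exists>l. courant_maps l"
proof -
  have "\<exists>L. ext_linear X k L \<and> (\<forall>xs. length xs = k \<longrightarrow> L (wedge X xs) = cmap xs)" for k
    by (rule ext_linear_exists) (use cmap_closed cmap_multilinear cmap_skew in auto)
  then obtain l where l: "\<And>k. ext_linear X k (l k)" "\<And>k xs. length xs = k \<Longrightarrow> l k (wedge X xs) = cmap xs"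
    by metis
  have deg: "l k w = 0" if w: "w \<in> ext_power_deg X k m"
    and *: "\<And>xs ds. length xs = k \<Longrightarrow> list_all2 (\<lambda>x d. x \<in> X d) xs ds \<Longrightarrow> sum_list ds = m \<Longrightarrow> cmap xs = 0" for k m w
  proof -
    have "l k w \<in> {0}"
      by (rule ext_linear_power_deg[OF l(1) subspace_single_0 _ w]) (use l(2) * in auto)
    then show ?thesis by simp
  qed
  have 2: "l 2 w = 0" if "m > 1" "w \<in> ext_power_deg X 2 m" for m w
  proof (rule deg[OF that(2)])
    fix xs ds assume xs: "length xs = 2" "list_all2 (\<lambda>x d. x \<in> X d) xs ds" "sum_list ds = m"
    then obtain x y i j where "xs = [x, y]" "ds = [i, j]" "x \<in> X i" "y \<in> X j"
      by (auto simp: length_Suc_conv numeral_2_eq_2 list_all2_Cons1)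
    then show "cmap xs = 0"
      using X_pieces[of x i] X_pieces[of y j] xs(3) \<open>m > 1\<close> by (auto simp: X_incl_defs zero_prod_def)
  qed
  have 3: "l 3 w = 0" if "m > 0" "w \<in> ext_power_deg X 3 m" for m w
  proof (rule deg[OF that(2)])
    fix xs ds assume xs: "length xs = 3" "list_all2 (\<lambda>x d. x \<in> X d) xs ds" "sum_list ds = m"
    then obtain x y z i j k where "xs = [x, y, z]" "ds = [i, j, k]" "x \<in> X i" "y \<in> X j" "z \<in> X k"
      by (auto simp: length_Suc_conv numeral_3_eq_3 list_all2_Cons1)
    then show "cmap xs = 0"
      using X_pieces[of x i] X_pieces[of y j] X_pieces[of z k] xs(3) \<open>m > 0\<close>
      by (auto simp: X_incl_defs zero_prod_def)
  qed
  have 4: "l n w = 0" if "n > 3" "w \<in> ext_power X n" for n w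
  proof -
    have "l n w \<in> {0}"
      by (rule ext_linear_power[OF l(1) subspace_single_0 _ that(2)]) (use l(2) cmap_long that(1) in auto)
    then show ?thesis by simp
  qed
  have "courant_maps l"
    unfolding courant_maps_def using 2 3 4 by (simp add: l d_alt X_incl_defs zero_prod_def)
  then show ?thesis by blast
qed

text \<open>The prescribed values determine the maps on homogeneous words, so the identities for an
  arbitrary \<open>l\<close> become computations with \<open>cmap\<close>.\<close>

lemma courant_maps_value:
  assumes l: "courant_maps l" and xs: "list_all2 (\<lambda>x d. x \<in> X d) xs ds" "xs \<noteq> []"
  shows "l (length xs) (wedge X xs) = cmap xs"
proof -
  \<comment> \<open>Zero is absorbed as \<open>X0 0\<close>, which leaves three shapes.\<close>
  have hom: "(\<exists>e\<in>sections. x = X0 e) \<or> (\<exists>f\<in>smooth_functions. x = X1 f) \<or> (\<exists>c\<in>ker_\<D>. x = X2 c)"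
    if "x \<in> X k" for x k
    using X_pieces[OF that] X_linear(7) sections_closed(5) by metis
  have lin: "ext_linear X k (l k)" if "k \<ge> 1" for k using l that by (simp add: courant_maps_def)
  have z2: "l 2 (wedge X [x, y]) = 0" if "x \<in> X i" "y \<in> X j" "i + j > 1" for x y i j
    using l that wedge_ext_power_deg[of "[x, y]" 2 X "[i, j]" "i + j"] by (simp add: courant_maps_def)
  have z3: "l 3 (wedge X [x, y, z]) = 0" if "x \<in> X i" "y \<in> X j" "z \<in> X k" "i + j + k > 0" for x y z i j k
    using l that wedge_ext_power_deg[of "[x, y, z]" 3 X "[i, j, k]" "i + j + k"]
    by (simp add: courant_maps_def add.assoc)
  show ?thesis
  proof (cases "length xs > 3")
    case True
    then have "l (length xs) (wedge X xs) = 0"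
      using l wedge_ext_power[of xs "length xs" X] homogeneous_list_total[OF xs(1)]
      by (simp add: courant_maps_def)
    then show ?thesis using True cmap_long by simp
  next
    case False
    with xs(2) consider x where "xs = [x]" | x y where "xs = [x, y]" | x y z where "xs = [x, y, z]"
      by (cases xs; cases "tl xs"; cases "tl (tl xs)"; cases "tl (tl (tl xs))") auto
    then show ?thesis
    proof cases
      case (1 x)
      with xs(1) obtain i where "x \<in> X i" by (auto simp: list_all2_Cons1)
      moreover have "l 1 (wedge X [x]) = d x"
        using hom[OF \<open>x \<in> X i\<close>] l unfolding courant_maps_def
        by (elim disjE bexE) (simp_all add: d_alt X_incl_defs zero_prod_def)
      ultimately show ?thesis using 1 by simp
    next
      case (2 x y)
      with xs(1) obtain i j where ij: "x \<in> X i" "y \<in> X j" by (auto simp: list_all2_Cons1)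
      have e: "l 2 (wedge X [X0 e, X1 f]) = X1 (pair e (\<D> f))" if "e \<in> sections" "f \<in> smooth_functions" for e f
        using l that by (simp add: courant_maps_def)
      \<comment> \<open>Graded skew-symmetry supplies the order of arguments that the prescription
        omits.\<close>
      have s: "l 2 (wedge X [X1 f, X0 e]) = - X1 (pair e (\<D> f))" if "e \<in> sections" "f \<in> smooth_functions" for e f
        using wedge_skew[OF lin[of 2], of "[]" "[]" "X1 f" 1 "X0 e" 0] e that by simp
      have b: "l 2 (wedge X [X0 e, X0 e']) = X0 (br e e')" if "e \<in> sections" "e' \<in> sections" for e e'
        using l that by (simp add: courant_maps_def)
      have "l 2 (wedge X [x, y]) = cmap [x, y]"
        using hom[OF ij(1)] hom[OF ij(2)]
        by (elim disjE bexE; simp add: b e s z2[OF X0_in X2_in] z2[OF X1_in X1_in] z2[OF X1_in X2_in]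
            z2[OF X2_in X0_in] z2[OF X2_in X1_in] z2[OF X2_in X2_in])
          (simp_all add: X_incl_defs zero_prod_def)
      then show ?thesis using 2 by (simp add: numeral_2_eq_2)
    next
      case (3 x y z)
      with xs(1) obtain i j k where ijk: "x \<in> X i" "y \<in> X j" "z \<in> X k" by (auto simp: list_all2_Cons1)
      have t: "l 3 (wedge X [X0 e1, X0 e2, X0 e3]) = X1 (- T e1 e2 e3)"
        if "e1 \<in> sections" "e2 \<in> sections" "e3 \<in> sections" for e1 e2 e3
        using l that by (simp add: courant_maps_def)
      have "l 3 (wedge X [x, y, z]) = cmap [x, y, z]"
      proof (cases "(\<exists>e\<in>sections. x = X0 e) \<and> (\<exists>e\<in>sections. y = X0 e) \<and> (\<exists>e\<in>sections. z = X0 e)")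
        case True
        then show ?thesis using t by (auto simp: X0_def)
      next
        case False
        \<comment> \<open>The given degrees may be arbitrary, even negative, for zero entries. Each
          entry is assigned the degree 0, 1 or 2 of its shape instead, so the total is positive
          unless all three are sections.\<close>
        have h: "\<exists>a\<ge>0. x \<in> X a \<and> (if a = 0 then \<exists>e\<in>sections. x = X0 e else fst x = 0)"
          if "x \<in> X i" for x i
          using hom[OF that]
        proof (elim disjE bexE)
          fix e assume "e \<in> sections" "x = X0 e"
          then show ?thesis by (intro exI[of _ 0]) auto
        next
          fix f assume "f \<in> smooth_functions" "x = X1 f"
          then show ?thesis by (intro exI[of _ 1]) (auto simp: X1_def[symmetric], simp add: X1_def)
        next
          fix c assume "c \<in> ker_\<D>" "x = X2 c"
          then show ?thesis by (intro exI[of _ 2]) (auto simp: X2_def[symmetric], simp add: X2_def)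
        qed
        obtain a where a: "a \<ge> 0" "x \<in> X a" "if a = 0 then \<exists>e\<in>sections. x = X0 e else fst x = 0"
          using h[OF ijk(1)] by blast
        obtain b where b: "b \<ge> 0" "y \<in> X b" "if b = 0 then \<exists>e\<in>sections. y = X0 e else fst y = 0"
          using h[OF ijk(2)] by blast
        obtain c where c: "c \<ge> 0" "z \<in> X c" "if c = 0 then \<exists>e\<in>sections. z = X0 e else fst z = 0"
          using h[OF ijk(3)] by blast
        have abc: "a \<noteq> 0 \<or> b \<noteq> 0 \<or> c \<noteq> 0" using False a(3) b(3) c(3) by auto
        have sec: "fst x \<in> sections" "fst y \<in> sections" "fst z \<in> sections"
          using total_X_simps(1) homogeneous_total[of x X i] homogeneous_total[of y X j]
            homogeneous_total[of z X k] ijk by blast+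
        have "fst x = 0 \<or> fst y = 0 \<or> fst z = 0" using abc a(3) b(3) c(3) by metis
        then have "cmap [x, y, z] = 0" using sec by (auto simp: X1_def zero_prod_def)
        moreover have "l 3 (wedge X [x, y, z]) = 0"
          using abc a(1) b(1) c(1) by (intro z3[OF a(2) b(2) c(2)]) linarith
        ultimately show ?thesis by simp
      qed
      then show ?thesis using 3 by (simp add: numeral_3_eq_3)
    qed
  qed
qed

section \<open>The homotopy Jacobi expressions for two, three and four arguments\<close>

lemma X_fst_cases:
  assumes "x \<in> X k"
  obtains "fst x = 0" | e where "k = 0" "e \<in> sections" "x = X0 e"
  using X_pieces[OF assms] by (auto simp: X_incl_defs)

lemma act_zero [simp]: "act 0 f = 0"
  by (simp add: act_def anchor_def anchor_zero fun_eq_iff)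

text \<open>For two functions each term pairs two gradients, which gives 0 by axiom 4. For a section
  and a function the claim is [\<D>f,e] = -\<D>\<langle>e,\<D>f\<rangle>, and for a section and an
  element of the kernel it is \<D>c = 0. The outer minus is (-1)^(1*1); the inner one is the sign of
  the transposition.\<close>

lemma identity_2:
  assumes x: "x \<in> X i" and y: "y \<in> X j"
  shows "- (cmap [cmap [x], y] - (if odd i \<and> odd j then -1 else 1) *\<^sub>R cmap [cmap [y], x]) + cmap [cmap [x, y]] = 0"
proof -
  have skew: "br (\<D> f) e = - \<D> ((1/2) *\<^sub>R act e f)" if "e \<in> sections" "f \<in> smooth_functions" for e f
    using br_skew[of "\<D> f" e] br_\<D>[of f e] that by (simp add: pair_\<D>_right)
  have tx: "fst x \<in> sections" "fst (snd x) \<in> smooth_functions" "snd (snd x) \<in> ker_\<D>"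
    and ty: "fst y \<in> sections" "fst (snd y) \<in> smooth_functions" "snd (snd y) \<in> ker_\<D>"
    using total_X_simps homogeneous_total[of x X i] homogeneous_total[of y X j] x y by blast+
  show ?thesis
  proof (cases "odd i \<and> odd j")
    case True
    then have "fst x = 0" "fst y = 0" using x y odd_fst by blast+
    then show ?thesis using tx ty True
      by (simp add: d_alt pair_\<D>_right zero_prod_def)
  next
    case False
    have "fst x = 0 \<or> i = 0 \<and> fst (snd x) = 0" "fst y = 0 \<or> j = 0 \<and> fst (snd y) = 0"
      using X_pieces[OF x] X_pieces[OF y] by (auto simp: X_incl_defs)
    moreover have "fst x \<noteq> 0 \<or> fst y \<noteq> 0 \<or> fst (snd x) = 0 \<or> fst (snd y) = 0"
      using X_pieces[OF x] X_pieces[OF y] False by (auto simp: X_incl_defs)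
    ultimately show ?thesis using tx ty
      by (simp add: d_alt skew pair_\<D>_right if_not_P[OF False]) (auto simp: zero_prod_def)
  qed
qed

text \<open>A nested bracket of three arguments needs section components in at least two of them;
  the bracket through d uses \<open>\<D> f\<close> in place of the third.\<close>

lemma identity_3_zero:
  assumes "x \<in> total X" "y \<in> total X" "z \<in> total X"
    and "fst x = 0 \<and> fst y = 0 \<or> fst x = 0 \<and> fst z = 0 \<or> fst y = 0 \<and> fst z = 0"
  shows "cmap [cmap [x], y, z] = 0" "cmap [cmap [x, y], z] = 0" "cmap [cmap [x, y, z]] = 0"
  using assms by (auto simp: d_alt X1_def total_X_simps zero_prod_def)

text \<open>The third argument may be inhomogeneous. Its section component s gives J(e1,e2,s) =
  \<D>T(e1,e2,s). Its function component f gives T(\<D>f,e1,e2) = \<rho>([e1,e2])f / 4, the value of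
  the three l2-terms. Its component in the kernel enters no term.\<close>

lemma identity_3_one:
  assumes e: "e1 \<in> sections" "e2 \<in> sections" and x: "x \<in> total X"
  shows "cmap [cmap [X0 e1], X0 e2, x] - cmap [cmap [X0 e2], X0 e1, x] + cmap [cmap [x], X0 e1, X0 e2]
    + (cmap [cmap [X0 e1, X0 e2], x] - cmap [cmap [X0 e1, x], X0 e2] + cmap [cmap [X0 e2, x], X0 e1])
    + cmap [cmap [X0 e1, X0 e2, x]] = 0"
proof -
  have tx: "fst x \<in> sections" "fst (snd x) \<in> smooth_functions" using x by (simp_all add: total_X_simps)
  define s f where "s = fst x" and "f = fst (snd x)"
  have sf: "s \<in> sections" "f \<in> smooth_functions" using tx by (simp_all add: s_def f_def)
  have J: "br (br e1 e2) s - br (br e1 s) e2 + br (br e2 s) e1 = \<D> (T e1 e2 s)"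
    using jacobi[OF e sf(1)] br_skew[of s e1] e sf by (simp add: jacobiator_def algebra_simps)
  have "br (br e1 e2) s - br (br e1 s) e2 + br (br e2 s) e1 - \<D> (T e1 e2 s) = 0" using J by simp
  moreover have "- T (\<D> f) e1 e2 + (pair (br e1 e2) (\<D> f) + pair e2 (\<D> (pair e1 (\<D> f)))
      - pair e1 (\<D> (pair e2 (\<D> f)))) = 0"
    using e sf by (simp add: T_\<D> pair_\<D>_right act_br fun_eq_iff scaleR_fun_apply field_simps)
  ultimately show ?thesis
    using e sf by (simp add: d_alt X_incl_defs s_def[symmetric] f_def[symmetric] zero_prod_def algebra_simps)
qed

lemma identity_4_zero:
  assumes "w \<in> total X" "x \<in> total X" "y \<in> total X" "z \<in> total X"
    and "fst w = 0 \<or> fst x = 0 \<or> fst y = 0 \<or> fst z = 0"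
  shows "cmap [cmap [w, x], y, z] = 0" "cmap [cmap [w, x, y], z] = 0"
  using assms by (auto simp: X1_def total_X_simps zero_prod_def)

text \<open>Each outer l2-term is \<langle>e,\<D>T\<rangle> = \<rho>(e)T / 2, which explains the
  factor 1/2 in \<open>T_cocycle\<close>. The minus before the second group is (-1)^(3*1).\<close>

lemma identity_4:
  assumes e: "e1 \<in> sections" "e2 \<in> sections" "e3 \<in> sections" "e4 \<in> sections"
  shows "cmap [cmap [X0 e1, X0 e2], X0 e3, X0 e4] - cmap [cmap [X0 e1, X0 e3], X0 e2, X0 e4]
    + cmap [cmap [X0 e1, X0 e4], X0 e2, X0 e3] + cmap [cmap [X0 e2, X0 e3], X0 e1, X0 e4]
    - cmap [cmap [X0 e2, X0 e4], X0 e1, X0 e3] + cmap [cmap [X0 e3, X0 e4], X0 e1, X0 e2]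
    - (cmap [cmap [X0 e1, X0 e2, X0 e3], X0 e4] - cmap [cmap [X0 e1, X0 e2, X0 e4], X0 e3]
      + cmap [cmap [X0 e1, X0 e3, X0 e4], X0 e2] - cmap [cmap [X0 e2, X0 e3, X0 e4], X0 e1]) = 0"
  using T_cocycle[OF e] e
  by (simp add: X_incl_defs pair_\<D>_right zero_prod_def algebra_simps)

end

section \<open>The homotopy Jacobi identities\<close>

lemma length_2_obtain: "length xs = 2 \<Longrightarrow> \<exists>a b. xs = [a, b]"
  by (simp add: length_Suc_conv numeral_2_eq_2) blast

lemma length_3_obtain: "length xs = 3 \<Longrightarrow> \<exists>a b c. xs = [a, b, c]"
  by (simp add: length_Suc_conv numeral_3_eq_3) blast

context courant_algebroid
begin

section \<open>Reduction to the position of the sections\<close>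

text \<open>No sign from the degrees is needed: for two odd arguments, where it would change the
  rule, both sides vanish.\<close>

lemma cmap2_skew: "x \<in> total X \<Longrightarrow> y \<in> total X \<Longrightarrow> cmap [y, x] = - cmap [x, y]"
  using br_skew[of "fst y" "fst x"] by (simp add: total_X_simps)

lemma cmap3_skew12: "x \<in> total X \<Longrightarrow> y \<in> total X \<Longrightarrow> z \<in> total X \<Longrightarrow> cmap [y, x, z] = - cmap [x, y, z]"
  using T_skew12[of "fst x" "fst y" "fst z"] by (simp add: total_X_simps X1_def)

lemma cmap3_skew23: "x \<in> total X \<Longrightarrow> y \<in> total X \<Longrightarrow> z \<in> total X \<Longrightarrow> cmap [x, z, y] = - cmap [x, y, z]"
  using T_skew23[of "fst x" "fst y" "fst z"] by (simp add: total_X_simps X1_def)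

lemma cmap1_minus: "x \<in> total X \<Longrightarrow> cmap [- x] = - cmap [x]"
  using cmap_multilinear[of "[]" "[]" x x "-1" 0] by simp

lemma cmap2_minus: "x \<in> total X \<Longrightarrow> y \<in> total X \<Longrightarrow> cmap [- x, y] = - cmap [x, y]"
  using cmap_multilinear[of "[]" "[y]" x x "-1" 0] by simp

text \<open>The left side of the identity for three arguments when at most one of them is odd, so
  that every Koszul sign is 1.\<close>

definition jac3 where
  "jac3 x y z = cmap [cmap [x], y, z] - cmap [cmap [y], x, z] + cmap [cmap [z], x, y]
    + (cmap [cmap [x, y], z] - cmap [cmap [x, z], y] + cmap [cmap [y, z], x])
    + cmap [cmap [x, y, z]]"

text \<open>An adjacent swap permutes the terms up to sign. Consequently
  \<open>identity_3_one\<close>, where the two sections come first, covers all positions.\<close>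

lemma jac3_skew:
  assumes "x \<in> total X" "y \<in> total X" "z \<in> total X"
  shows "jac3 y x z = - jac3 x y z" "jac3 x z y = - jac3 x y z"
proof -
  have t: "cmap [u] \<in> total X" "cmap [u, v] \<in> total X" "cmap [u, v, w] \<in> total X"
    if "u \<in> total X" "v \<in> total X" "w \<in> total X" for u v w
    using that by (auto intro!: cmap_closed simp del: cmap_simps)
  note t' = t[OF assms]
  show "jac3 y x z = - jac3 x y z"
    unfolding jac3_def cmap2_skew[OF assms(1,2)] cmap3_skew12[OF assms]
      cmap3_skew23[OF t(1)[OF assms(3) assms(3) assms(3)] assms(1,2)]
      cmap2_minus[OF t(2)[OF assms] assms(3)] cmap1_minus[OF t(3)[OF assms]]
    by simp
  show "jac3 x z y = - jac3 x y z"
    unfolding jac3_def cmap2_skew[OF assms(2,3)] cmap3_skew23[OF assms]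
      cmap3_skew23[OF t(1)[OF assms(1) assms(1) assms(1)] assms(2,3)]
      cmap2_minus[OF t(2)[OF assms(2,3,3)] assms(1)] cmap1_minus[OF t(3)[OF assms]]
    by simp
qed

lemma jac3_zero:
  assumes "x \<in> total X" "y \<in> total X" "z \<in> total X"
    and "e1 \<in> sections" "e2 \<in> sections"
    and "x = X0 e1 \<and> y = X0 e2 \<or> x = X0 e1 \<and> z = X0 e2 \<or> y = X0 e1 \<and> z = X0 e2"
  shows "jac3 x y z = 0"
proof -
  have t: "X0 e1 \<in> total X" "X0 e2 \<in> total X"
    using homogeneous_total[of _ X 0] assms(4,5) by simp_all
  have *: "jac3 (X0 e1) (X0 e2) u = 0" if "u \<in> total X" for u
    unfolding jac3_def using assms(4,5) that by (rule identity_3_one)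
  have **: "jac3 (X0 e1) u (X0 e2) = 0" if "u \<in> total X" for u
    using jac3_skew(2)[OF t that] *[OF that] by simp
  have "jac3 u (X0 e1) (X0 e2) = 0" if "u \<in> total X" for u
    using jac3_skew(1)[OF t(1) that t(2)] **[OF that] by simp
  with * ** show ?thesis using assms by blast
qed

text \<open>The i-th summand of the homotopy Jacobi identity, with \<open>cmap\<close> for the maps.
  The outer map has j = n + 1 - i arguments, so the exponent i(j - 1) becomes i(n - i).\<close>

definition jac :: "(nat \<Rightarrow> ('m, 'v) complex_space) \<Rightarrow> (nat \<Rightarrow> int) \<Rightarrow> nat \<Rightarrow> nat \<Rightarrow> ('m, 'v) complex_space" where
  "jac x \<delta> n i = (-1) ^ (i * (n - i)) *\<^sub>R
    (\<Sum>\<sigma>\<in>unshuffles i n. (of_int (sign \<sigma>) * koszul \<delta> n \<sigma>) *\<^sub>R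
      cmap (cmap (map (\<lambda>m. x (\<sigma> m)) [1..<i+1]) # map (\<lambda>m. x (\<sigma> m)) [i+1..<n+1]))"

lemma jac_zeroI:
  assumes "\<And>\<sigma>. \<sigma> permutes {1..n} \<Longrightarrow>
    cmap (cmap (map (\<lambda>m. x (\<sigma> m)) [1..<i+1]) # map (\<lambda>m. x (\<sigma> m)) [i+1..<n+1]) = 0"
  shows "jac x \<delta> n i = 0"
  unfolding jac_def using assms by (simp add: unshuffles_iff sum.neutral)

lemma sign_transposes:
  "sign (Transposition.transpose 1 2 :: nat \<Rightarrow> nat) = -1"
  "sign (Transposition.transpose 2 3 :: nat \<Rightarrow> nat) = -1"
  "sign (Transposition.transpose 3 4 :: nat \<Rightarrow> nat) = -1"
  "permutation \<tau> \<Longrightarrow> sign (Transposition.transpose a b \<circ> \<tau>) = sign (Transposition.transpose a b) * sign \<tau>"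
  for a b :: nat
  by (simp_all add: sign_swap_id sign_compose permutation_swap_id)

section \<open>The identities for every number of arguments\<close>

lemma cmap_identity:
  assumes n: "n \<ge> 1" and x: "\<And>m. m \<in> {1..n} \<Longrightarrow> x m \<in> X (\<delta> m)"
  shows "(\<Sum>i=1..n. jac x \<delta> n i) = 0"
proof -
  have tot: "x m \<in> total X" if "m \<in> {1..n}" for m
    using homogeneous_total[of "x m" X] x[OF that] by blast
  have perm: "\<sigma> m \<in> {1..n}" if "\<sigma> permutes {1..n}" "m \<in> {1..n}" for \<sigma> m
    using permutes_in_image[OF that(1)] that(2) by blast
  have tl: "set (map (\<lambda>m. x (\<sigma> m)) [a..<b]) \<subseteq> total X"
    if "\<sigma> permutes {1..n}" "1 \<le> a" "b \<le> n + 1" for \<sigma> a b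
    using tot perm[OF that(1)] that(2,3) by auto
  consider "n = 1" | "n = 2" | "n = 3" | "n = 4" | "n \<ge> 5" using n by linarith
  then show ?thesis
  proof cases
    case 1
    have "d (d y) = 0" if "y \<in> total X" for y
      using total_X_simps[OF that] by (simp add: d_alt zero_prod_def)
    then have "jac x \<delta> n 1 = 0"
      by (intro jac_zeroI) (use tot perm 1 in simp)
    then show ?thesis using 1 by simp
  next
    case 2
    have *: "{1..n} = {1, 2}" using 2 by auto
    have "jac x \<delta> n 1 = - (cmap [cmap [x 1], x 2]
        - (if odd (\<delta> 1) \<and> odd (\<delta> 2) then -1 else 1) *\<^sub>R cmap [cmap [x 2], x 1])"
      unfolding jac_def 2 sum_unshuffles_1_2 koszul_id koszul_transpose_1_2 sign_transposes(1) sign_id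
      by (simp add: upt_values transpose_apply del: cmap_simps)
    moreover have "jac x \<delta> n 2 = cmap [cmap [x 1, x 2]]"
      unfolding jac_def 2 sum_unshuffles_2_2 koszul_id sign_id
      by (simp add: upt_values del: cmap_simps)
    ultimately show ?thesis
      using identity_2[OF x[of 1] x[of 2]] unfolding * by simp
  next
    case 3
    have *: "{1..n} = {1, 2, 3}" using 3 by auto
    have c: "fst (x m) = 0 \<or> \<delta> m = 0 \<and> (\<exists>e\<in>sections. x m = X0 e)" if "m \<in> {1,2,3}" for m
      using X_fst_cases[of "x m" "\<delta> m"] x[of m] that unfolding * by metis
    let ?zero = "\<lambda>a b c. fst (x a) = 0 \<and> fst (x b) = 0 \<or> fst (x a) = 0 \<and> fst (x c) = 0
      \<or> fst (x b) = 0 \<and> fst (x c) = 0"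
    show ?thesis
    proof (cases "?zero 1 2 3")
      case True
      \<comment> \<open>The condition that at most one argument has a section component is symmetric
        in the arguments, so every unshuffled term vanishes separately.\<close>
      have z: "?zero (\<sigma> 1) (\<sigma> 2) (\<sigma> 3)" if "\<sigma> permutes {1..n}" for \<sigma>
      proof -
        have "[\<sigma> 1, \<sigma> 2, \<sigma> 3] \<in> {[1,2,3],[1,3,2],[2,1,3],[2,3,1],[3,1,2],[3,2,1]}"
          using permutes_3_cases[of \<sigma>] that unfolding 3 by blast
        then show ?thesis using True by (elim insertE emptyE) auto
      qed
      have t: "x (\<sigma> 1) \<in> total X" "x (\<sigma> 2) \<in> total X" "x (\<sigma> 3) \<in> total X" if "\<sigma> permutes {1..n}" for \<sigma>
        using tot perm[OF that] unfolding * by blast+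
      have id_3: "cmap [cmap [x (\<sigma> 1)], x (\<sigma> 2), x (\<sigma> 3)] = 0"
        "cmap [cmap [x (\<sigma> 1), x (\<sigma> 2)], x (\<sigma> 3)] = 0"
        "cmap [cmap [x (\<sigma> 1), x (\<sigma> 2), x (\<sigma> 3)]] = 0" if "\<sigma> permutes {1..n}" for \<sigma>
        using identity_3_zero[OF t[OF that] z[OF that]] .
      have "jac x \<delta> n 1 = 0"
        by (rule jac_zeroI) (drule id_3(1), simp add: 3 upt_values del: cmap_simps)
      moreover have "jac x \<delta> n 2 = 0"
        by (rule jac_zeroI) (drule id_3(2), simp add: 3 upt_values del: cmap_simps)
      moreover have "jac x \<delta> n 3 = 0"
        by (rule jac_zeroI) (drule id_3(3), simp add: 3 upt_values del: cmap_simps)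
      ultimately show ?thesis unfolding * by simp
    next
      case False
      \<comment> \<open>At least two section components are nonzero, which pins two degrees to 0.
        Only the remaining index, chosen as \<open>k\<close> below, can be odd.\<close>
      then have two: "(\<delta> 1 = 0 \<and> \<delta> 2 = 0 \<or> \<delta> 1 = 0 \<and> \<delta> 3 = 0 \<or> \<delta> 2 = 0 \<and> \<delta> 3 = 0)
        \<and> (\<exists>e1\<in>sections. \<exists>e2\<in>sections. x 1 = X0 e1 \<and> x 2 = X0 e2 \<or> x 1 = X0 e1 \<and> x 3 = X0 e2 \<or> x 2 = X0 e1 \<and> x 3 = X0 e2)"
        using c[of 1] c[of 2] c[of 3] by auto
      then obtain k where k: "\<And>m. m \<in> {1..n} \<Longrightarrow> odd (\<delta> m) \<Longrightarrow> m = k"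
      proof (elim conjE disjE)
        assume "\<delta> 1 = 0" "\<delta> 2 = 0"
        then show thesis by (intro that[of 3]; unfold *; auto)
      next
        assume "\<delta> 1 = 0" "\<delta> 3 = 0"
        then show thesis by (intro that[of 2]; unfold *; auto)
      next
        assume "\<delta> 2 = 0" "\<delta> 3 = 0"
        then show thesis by (intro that[of 1]; unfold *; auto)
      qed
      have kz: "koszul \<delta> 3 \<sigma> = 1" if "\<sigma> permutes {1..3}" for \<sigma>
        using koszul_at_most_one_odd[of \<sigma> 3 \<delta> k] that k unfolding 3 by blast
      have p: "id permutes {1..3::nat}" "Transposition.transpose 1 2 permutes {1..3::nat}"
        "Transposition.transpose 2 3 permutes {1..3::nat}"
        by (auto intro!: permutes_transpose)
      have j: "jac x \<delta> n 1 + jac x \<delta> n 2 + jac x \<delta> n 3 = jac3 (x 1) (x 2) (x 3)"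
        unfolding jac_def 3 sum_unshuffles_1_3 sum_unshuffles_2_3 sum_unshuffles_3_3
          kz[OF p(1)] kz[OF p(2)] kz[OF p(3)] kz[OF permutes_compose[OF p(2,3)]] kz[OF permutes_compose[OF p(3,2)]]
          sign_transposes(1,2) sign_transposes(4)[OF permutation_swap_id] sign_id jac3_def
        by (simp add: upt_values transpose_apply del: cmap_simps)
      have "jac3 (x 1) (x 2) (x 3) = 0"
        using two jac3_zero[of "x 1" "x 2" "x 3"] tot unfolding * by blast
      then show ?thesis using j unfolding * by (simp add: add.assoc)
    qed
  next
    case 4
    have *: "{1..n} = {1, 2, 3, 4}" using 4 by auto
    have t: "x (\<sigma> 1) \<in> total X" "x (\<sigma> 2) \<in> total X" "x (\<sigma> 3) \<in> total X" "x (\<sigma> 4) \<in> total X"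
      if "\<sigma> permutes {1..n}" for \<sigma>
      using tot perm[OF that] unfolding * by blast+
    \<comment> \<open>For i = 1 the outer map has four arguments; for i = 4 the inner one
      has.\<close>
    have j1: "jac x \<delta> n 1 = 0"
      by (rule jac_zeroI) (simp add: 4 upt_values cmap_long del: cmap_simps)
    have j4: "jac x \<delta> n 4 = 0"
      by (rule jac_zeroI) (simp add: 4 upt_values cmap_long d_alt zero_prod_def)
    show ?thesis
    proof (cases "\<exists>m\<in>{1..n}. fst (x m) = 0")
      case True
      have z: "fst (x (\<sigma> 1)) = 0 \<or> fst (x (\<sigma> 2)) = 0 \<or> fst (x (\<sigma> 3)) = 0 \<or> fst (x (\<sigma> 4)) = 0"
        if "\<sigma> permutes {1..n}" for \<sigma>
      proof -
        obtain m where m: "m \<in> {1..n}" "fst (x m) = 0" using True by blast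
        then obtain k where "k \<in> {1..n}" "m = \<sigma> k" using permutes_image[OF \<open>\<sigma> permutes {1..n}\<close>] by blast
        then show ?thesis using m(2) unfolding * by blast
      qed
      have id_4: "cmap [cmap [x (\<sigma> 1), x (\<sigma> 2)], x (\<sigma> 3), x (\<sigma> 4)] = 0"
        "cmap [cmap [x (\<sigma> 1), x (\<sigma> 2), x (\<sigma> 3)], x (\<sigma> 4)] = 0" if "\<sigma> permutes {1..n}" for \<sigma>
        using identity_4_zero[OF t[OF that] z[OF that]] .
      have "jac x \<delta> n 2 = 0"
        by (rule jac_zeroI) (drule id_4(1), simp add: 4 upt_values del: cmap_simps)
      moreover have "jac x \<delta> n 3 = 0"
        by (rule jac_zeroI) (drule id_4(2), simp add: 4 upt_values del: cmap_simps)
      ultimately show ?thesis using j1 j4 unfolding * by simp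
    next
      case False
      then have c: "\<delta> m = 0 \<and> (\<exists>e\<in>sections. x m = X0 e)" if "m \<in> {1..n}" for m
        using X_fst_cases[of "x m" "\<delta> m"] x[OF that] that by metis
      \<comment> \<open>All degrees are 0, so no index is odd and the exceptional index can be any
        number, here 0.\<close>
      have kz: "koszul \<delta> 4 \<sigma> = 1" if "\<sigma> permutes {1..4}" for \<sigma>
        using koszul_at_most_one_odd[of \<sigma> 4 \<delta> 0] that c unfolding 4 by force
      obtain e1 e2 e3 e4 where e: "e1 \<in> sections" "e2 \<in> sections" "e3 \<in> sections" "e4 \<in> sections"
        "x 1 = X0 e1" "x 2 = X0 e2" "x 3 = X0 e3" "x 4 = X0 e4"
        using c[of 1] c[of 2] c[of 3] c[of 4] unfolding * by blast
      have p: "id permutes {1..4::nat}" "Transposition.transpose 1 2 permutes {1..4::nat}"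
        "Transposition.transpose 2 3 permutes {1..4::nat}" "Transposition.transpose 3 4 permutes {1..4::nat}"
        by (auto intro!: permutes_transpose)
      note k = kz[OF p(1)] kz[OF p(3)] kz[OF p(4)]
        kz[OF permutes_compose[OF p(3,4)]] kz[OF permutes_compose[OF p(3,2)]]
        kz[OF permutes_compose[OF permutes_compose[OF p(3,2)] p(4)]]
        kz[OF permutes_compose[OF permutes_compose[OF permutes_compose[OF p(3,2)] p(4)] p(3)]]
        kz[OF permutes_compose[OF p(4,3)]] kz[OF permutes_compose[OF permutes_compose[OF p(4,3)] p(2)]]
      note sgn = sign_id sign_transposes(1-3) sign_transposes(4)[OF permutation_swap_id]
        sign_transposes(4)[OF permutation_compose[OF permutation_swap_id permutation_swap_id]]
        sign_transposes(4)[OF permutation_compose[OF permutation_swap_id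
          permutation_compose[OF permutation_swap_id permutation_swap_id]]]
      have g2: "jac x \<delta> n 2 = cmap [cmap [x 1, x 2], x 3, x 4] - cmap [cmap [x 1, x 3], x 2, x 4]
          + cmap [cmap [x 1, x 4], x 2, x 3] + cmap [cmap [x 2, x 3], x 1, x 4]
          - cmap [cmap [x 2, x 4], x 1, x 3] + cmap [cmap [x 3, x 4], x 1, x 2]"
        unfolding jac_def 4 sum_unshuffles_2_4 k sgn
        by (simp add: upt_values transpose_apply del: cmap_simps)
      have g3: "jac x \<delta> n 3 = - (cmap [cmap [x 1, x 2, x 3], x 4] - cmap [cmap [x 1, x 2, x 4], x 3]
          + cmap [cmap [x 1, x 3, x 4], x 2] - cmap [cmap [x 2, x 3, x 4], x 1])"
        unfolding jac_def 4 sum_unshuffles_3_4 k sgn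
        by (simp add: upt_values transpose_apply del: cmap_simps)
      have "jac x \<delta> n 2 + jac x \<delta> n 3 = 0"
        unfolding g2 g3 e(5-8) using identity_4[OF e(1-4)]
        by (simp del: cmap_simps)
      then show ?thesis using j1 j4 unfolding * by simp
    qed
  next
    case 5
    have "jac x \<delta> n i = 0" if i: "i \<in> {1..n}" for i
    proof (rule jac_zeroI)
      fix \<sigma> assume \<sigma>: "\<sigma> permutes {1..n}"
      let ?a = "map (\<lambda>m. x (\<sigma> m)) [1..<i+1]" and ?b = "map (\<lambda>m. x (\<sigma> m)) [i+1..<n+1]"
      have t: "set ?a \<subseteq> total X" "set ?b \<subseteq> total X"
        using tl[OF \<sigma>, of 1 "i+1"] tl[OF \<sigma>, of "i+1" "n+1"] i by (auto simp del: upt_Suc)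
      have len: "length ?a = i" "length ?b = n - i" by (simp_all del: upt_Suc)
      \<comment> \<open>Both maps have at most three arguments only if n = 5 and i = 3. Then
        \<open>T\<close> is applied to a value of the inner \<open>T\<close>-bracket, whose section
        component is 0.\<close>
      consider "i > 3" | "n - i > 2" | "i = 3" "n - i = 2" using 5 by linarith
      then show "cmap (cmap ?a # ?b) = 0"
      proof cases
        case 1
        then have "cmap ?a = 0" using len by (intro cmap_long) simp
        moreover have "0 \<in> total X" using subspace_0[OF subspace_total] .
        ultimately show ?thesis using t by (intro cmap_zero) auto
      next
        case 2
        then show ?thesis using len by (intro cmap_long) simp
      next
        case 3
        have "length ?a = 3" using len(1) 3(1) by (rule trans)
        from length_3_obtain[OF this] obtain u v w where a: "?a = [u, v, w]" by (elim exE) (rule that)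
        have "length ?b = 2" using len(2) 3(2) by (rule trans)
        from length_2_obtain[OF this] obtain y z where b: "?b = [y, z]" by (elim exE) (rule that)
        show ?thesis using t unfolding a b by (simp add: X1_def total_X_simps zero_prod_def)
      qed
    qed
    then show ?thesis by simp
  qed
qed

section \<open>From lists back to the exterior powers\<close>

text \<open>\<open>courant_maps_value\<close> applies to homogeneous words only.
  \<open>cmap_degree\<close> makes the inner value homogeneous, so the outer map can be evaluated as
  well.\<close>

lemma courant_maps_L_infinity:
  assumes l: "courant_maps l"
  shows "L_infinity X l"
  unfolding L_infinity_def
proof (intro conjI allI impI)
  show "graded_space X" by (rule graded_X)
next
  fix k :: nat assume "1 \<le> k"
  then show lin: "ext_linear X k (l k)" using l by (simp add: courant_maps_def)
  fix m
  have "l k w \<in> X (m + int k - 2)" if "w \<in> ext_power_deg X k m" for w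
  proof (rule ext_linear_power_deg[OF lin subspace_X _ that])
    fix xs ds assume xs: "length xs = k" "list_all2 (\<lambda>x d. x \<in> X d) xs ds" "sum_list ds = m"
    then have "xs \<noteq> []" using \<open>1 \<le> k\<close> by auto
    then show "l k (wedge X xs) \<in> X (m + int k - 2)"
      using courant_maps_value[OF l xs(2)] cmap_degree[OF xs(2)] xs(1,3) by simp
  qed
  then show "l k ` ext_power_deg X k m \<subseteq> X (m + int k - 2)" by blast
next
  fix n :: nat and x :: "nat \<Rightarrow> ('m, 'v) complex_space" and \<delta> :: "nat \<Rightarrow> int"
  assume n: "1 \<le> n" and x: "\<forall>m\<in>{1..n}. x m \<in> X (\<delta> m)"
  let ?t = "\<lambda>i j \<sigma>. l j (wedge X (l i (wedge X (map (\<lambda>m. x (\<sigma> m)) [1..<i+1])) # map (\<lambda>m. x (\<sigma> m)) [i+1..<n+1]))"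
  let ?G = "\<lambda>i j. (-1) ^ (i * (j - 1)) *\<^sub>R
    (\<Sum>\<sigma>\<in>unshuffles i n. (of_int (sign \<sigma>) * koszul \<delta> n \<sigma>) *\<^sub>R ?t i j \<sigma>)"
  have "?G i (n + 1 - i) = jac x \<delta> n i" if i: "i \<in> {1..n}" for i
  proof -
    have "?t i (n + 1 - i) \<sigma>
        = cmap (cmap (map (\<lambda>m. x (\<sigma> m)) [1..<i+1]) # map (\<lambda>m. x (\<sigma> m)) [i+1..<n+1])"
      if "\<sigma> \<in> unshuffles i n" for \<sigma>
    proof -
      have \<sigma>: "x (\<sigma> m) \<in> X (\<delta> (\<sigma> m))" if "1 \<le> m" "m \<le> n" for m
        using \<open>\<sigma> \<in> unshuffles i n\<close> permutes_in_image[of \<sigma> "{1..n}" m] x that by (simp add: unshuffles_iff)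
      have hom: "list_all2 (\<lambda>x d. x \<in> X d) (map (\<lambda>m. x (\<sigma> m)) [a..<b]) (map (\<lambda>m. \<delta> (\<sigma> m)) [a..<b])"
        if "1 \<le> a" "b \<le> n + 1" for a b
        using \<sigma> that by (simp add: list_all2_conv_all_nth)
      let ?a = "map (\<lambda>m. x (\<sigma> m)) [1..<i+1]" and ?b = "map (\<lambda>m. x (\<sigma> m)) [i+1..<n+1]"
      have ha: "list_all2 (\<lambda>x d. x \<in> X d) ?a (map (\<lambda>m. \<delta> (\<sigma> m)) [1..<i+1])" "?a \<noteq> []"
        using hom[of 1 "i+1"] i by (auto simp del: upt_Suc)
      have "l i (wedge X ?a) = cmap ?a"
        using courant_maps_value[OF l ha] by (simp del: upt_Suc)
      moreover have "l (length (cmap ?a # ?b)) (wedge X (cmap ?a # ?b)) = cmap (cmap ?a # ?b)"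
      proof (rule courant_maps_value[OF l])
        show "list_all2 (\<lambda>x d. x \<in> X d) (cmap ?a # ?b)
            ((sum_list (map (\<lambda>m. \<delta> (\<sigma> m)) [1..<i+1]) + int (length ?a) - 2) # map (\<lambda>m. \<delta> (\<sigma> m)) [i+1..<n+1])"
          using cmap_degree[OF ha] hom[of "i+1" "n+1"] by (simp del: upt_Suc)
      qed simp
      moreover have "length (cmap ?a # ?b) = n + 1 - i" using i by (simp add: Suc_diff_le del: upt_Suc)
      ultimately show ?thesis by simp
    qed
    then show ?thesis unfolding jac_def by simp
  qed
  then have "(\<Sum>i=1..n. ?G i (n + 1 - i)) = 0"
    using cmap_identity[OF n, of x \<delta>] x by simp
  moreover have "(\<Sum>(i, j) | 1 \<le> i \<and> 1 \<le> j \<and> i + j = n + 1. ?G i j) = (\<Sum>i=1..n. ?G i (n + 1 - i))"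
  proof -
    \<comment> \<open>The pair (i, j) is determined by i, which turns the double index into the
      range of \<open>cmap_identity\<close>.\<close>
    have set: "{(i, j). 1 \<le> i \<and> 1 \<le> j \<and> i + j = n + 1} = (\<lambda>i. (i, n + 1 - i)) ` {1..n}"
      by (auto simp: image_iff)
    have inj: "inj_on (\<lambda>i. (i, n + 1 - i)) {1..n}" by (rule inj_onI) simp
    show ?thesis unfolding set sum.reindex[OF inj] comp_def case_prod_conv ..
  qed
  ultimately show "(\<Sum>(i, j) | 1 \<le> i \<and> 1 \<le> j \<and> i + j = n + 1. ?G i j) = 0"
    by simp
qed

end

theorem theorem4p3:
  fixes atlas :: "('m::{t2_space,second_countable_topology} set \<times> ('m \<Rightarrow> 'b::real_inner)) set"
    and E :: "'m \<Rightarrow> 'v::real_vector set"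
    and trivs :: "('m set \<times> ('m \<Rightarrow> 'v \<Rightarrow> 'f::real_inner)) set"
    and g :: "'m \<Rightarrow> 'v \<Rightarrow> 'v \<Rightarrow> real"
    and \<rho> :: "'m \<Rightarrow> 'v \<Rightarrow> ('m \<Rightarrow> real) \<Rightarrow> real"
    and br :: "('m \<Rightarrow> 'v) \<Rightarrow> ('m \<Rightarrow> 'v) \<Rightarrow> 'm \<Rightarrow> 'v"
  assumes "courant_algebroid atlas E trivs g \<rho> br"
  defines "C_inf \<equiv> smooth_manifold.smooth_functions atlas"
    and "\<Gamma> \<equiv> vector_bundle.sections atlas E trivs"
    and "\<D> \<equiv> courant_data.\<D> atlas E trivs g \<rho>"
    and "X \<equiv> courant_data.X atlas E trivs g \<rho>"
    and "d \<equiv> courant_data.d atlas E trivs g \<rho>"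
    and "is_courant_maps \<equiv> courant_data.courant_maps atlas E trivs g \<rho> br"
  shows "resolution_of_quotient X d fst \<Gamma> (\<D> ` C_inf)
    \<and> (\<exists>l. is_courant_maps l)
    \<and> (\<forall>l. is_courant_maps l \<longrightarrow> L_infinity X l)"
proof -
  note defs = C_inf_def \<Gamma>_def \<D>_def X_def d_def is_courant_maps_def
  interpret courant_algebroid atlas E trivs g \<rho> br by fact
  show ?thesis
    unfolding defs by (intro conjI allI impI resolution_X courant_maps_exists courant_maps_L_infinity)
qed

end
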